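(* In $\mathsf{RCA}_0$, for a countable integral domain $R$, the following are equivalent: (1) $R$ is a field; (2) the polynomial ring $R[x]$ is a Euclidean domain; (3) $R[x]$ is a $\Sigma^0_1$-PID.
   Context: $\mathsf{RCA}_0$: basic arithmetic, $\Sigma^0_1$-induction, $\Delta^0_1$-comprehension. An integral domain $S$ is Euclidean if there is a function $f:S\setminus\{0\}\to\mathbb{N}$ such that for all $a,d\in S$ with $d\neq0$ there are $q,r\in S$ with $a=dq+r$ and $f(r)<f(d)$ if $r\neq0$. A $\Sigma^0_1$-PID is an integral domain in which every $\Sigma^0_1$-ideal (a sequence $\langle a_0,a_1,\ldots\rangle$ of ring elements such that for all $i,j,r,s$ some $a_k=a_ir+a_js$) equals, by mutual inclusion of membership, a principal ideal $(c)=\{cr:r\in S\}$. *)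

theory Defs
  imports "HOL-Algebra.Ring"
begin

section \<open>Structures for the language of second-order arithmetic\<close>

text \<open>
  A structure has the whole type \<^typ>\<open>'a\<close> as its (possibly nonstandard) domain of numbers, while the
  set variables range over an arbitrary family \<open>set_universe\<close> of subsets of that domain.
\<close>

record 'a l2_structure =
  nzero :: 'a
  none :: 'a
  nadd :: "'a \<Rightarrow> 'a \<Rightarrow> 'a" (infixl "\<boxplus>\<index>" 65)
  nmul :: "'a \<Rightarrow> 'a \<Rightarrow> 'a" (infixl "\<boxtimes>\<index>" 70)
  nless :: "'a \<Rightarrow> 'a \<Rightarrow> bool" (infix "\<prec>\<index>" 50)
  set_universe :: "'a set set"

datatype num_term =
    Var nat
  | Zero
  | One
  | Plus num_term num_term
  | Times num_term num_term

text \<open>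
  The formulas all of whose quantifiers are bounded number quantifiers.  Number and set variables
  are named by natural numbers; \<open>BAll x t \<phi>\<close> is \<open>\<forall>x < t. \<phi>\<close>, where \<open>t\<close> is evaluated outside
  the scope of \<open>x\<close>.
\<close>

datatype bounded_formula =
    Eq num_term num_term
  | Less num_term num_term
  | Mem num_term nat
  | Neg bounded_formula
  | Conj bounded_formula bounded_formula
  | BAll nat num_term bounded_formula

primrec term_val :: "'a l2_structure \<Rightarrow> (nat \<Rightarrow> 'a) \<Rightarrow> num_term \<Rightarrow> 'a" where
  "term_val M e (Var x) = e x"
| "term_val M e Zero = nzero M"
| "term_val M e One = none M"
| "term_val M e (Plus s t) = term_val M e s \<boxplus>\<^bsub>M\<^esub> term_val M e t"
| "term_val M e (Times s t) = term_val M e s \<boxtimes>\<^bsub>M\<^esub> term_val M e t"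

primrec holds :: "'a l2_structure \<Rightarrow> (nat \<Rightarrow> 'a set) \<Rightarrow> (nat \<Rightarrow> 'a) \<Rightarrow> bounded_formula \<Rightarrow> bool" where
  "holds M E e (Eq s t) \<longleftrightarrow> term_val M e s = term_val M e t"
| "holds M E e (Less s t) \<longleftrightarrow> term_val M e s \<prec>\<^bsub>M\<^esub> term_val M e t"
| "holds M E e (Mem t X) \<longleftrightarrow> term_val M e t \<in> E X"
| "holds M E e (Neg \<phi>) \<longleftrightarrow> \<not> holds M E e \<phi>"
| "holds M E e (Conj \<phi> \<psi>) \<longleftrightarrow> holds M E e \<phi> \<and> holds M E e \<psi>"
| "holds M E e (BAll x t \<phi>) \<longleftrightarrow>
     (\<forall>b. b \<prec>\<^bsub>M\<^esub> term_val M e t \<longrightarrow> holds M E (e(x := b)) \<phi>)"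


section \<open>Models of RCA0\<close>

definition basic_arithmetic :: "'a l2_structure \<Rightarrow> bool" where
  "basic_arithmetic M \<longleftrightarrow>
     (\<forall>n. n \<boxplus>\<^bsub>M\<^esub> none M \<noteq> nzero M) \<and>
     (\<forall>m n. m \<boxplus>\<^bsub>M\<^esub> none M = n \<boxplus>\<^bsub>M\<^esub> none M \<longrightarrow> m = n) \<and>
     (\<forall>m. m \<boxplus>\<^bsub>M\<^esub> nzero M = m) \<and>
     (\<forall>m n. m \<boxplus>\<^bsub>M\<^esub> (n \<boxplus>\<^bsub>M\<^esub> none M) = (m \<boxplus>\<^bsub>M\<^esub> n) \<boxplus>\<^bsub>M\<^esub> none M) \<and>
     (\<forall>m. m \<boxtimes>\<^bsub>M\<^esub> nzero M = nzero M) \<and>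
     (\<forall>m n. m \<boxtimes>\<^bsub>M\<^esub> (n \<boxplus>\<^bsub>M\<^esub> none M) = (m \<boxtimes>\<^bsub>M\<^esub> n) \<boxplus>\<^bsub>M\<^esub> m) \<and>
     (\<forall>m. \<not> m \<prec>\<^bsub>M\<^esub> nzero M) \<and>
     (\<forall>m n. m \<prec>\<^bsub>M\<^esub> n \<boxplus>\<^bsub>M\<^esub> none M \<longleftrightarrow> m \<prec>\<^bsub>M\<^esub> n \<or> m = n)"

text \<open>
  A \<open>\<Sigma>\<^sup>0\<^sub>1\<close> formula is one bounded formula preceded by one unbounded existential number quantifier;
  \<open>x\<close> is the distinguished free variable, \<open>y\<close> the quantified one, and \<open>e\<close>, \<open>E\<close> supply the
  number and set parameters.
\<close>

definition sigma1_holds ::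
  "'a l2_structure \<Rightarrow> (nat \<Rightarrow> 'a set) \<Rightarrow> (nat \<Rightarrow> 'a) \<Rightarrow> nat \<Rightarrow> nat \<Rightarrow> bounded_formula \<Rightarrow> 'a \<Rightarrow> bool" where
  "sigma1_holds M E e x y \<theta> a \<longleftrightarrow> (\<exists>b. holds M E (e(x := a, y := b)) \<theta>)"

definition pi1_holds ::
  "'a l2_structure \<Rightarrow> (nat \<Rightarrow> 'a set) \<Rightarrow> (nat \<Rightarrow> 'a) \<Rightarrow> nat \<Rightarrow> nat \<Rightarrow> bounded_formula \<Rightarrow> 'a \<Rightarrow> bool" where
  "pi1_holds M E e x y \<theta> a \<longleftrightarrow> (\<forall>b. holds M E (e(x := a, y := b)) \<theta>)"

definition sigma1_induction :: "'a l2_structure \<Rightarrow> bool" where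
  "sigma1_induction M \<longleftrightarrow>
     (\<forall>E e x y \<theta>. range E \<subseteq> set_universe M \<longrightarrow>
        sigma1_holds M E e x y \<theta> (nzero M) \<longrightarrow>
        (\<forall>a. sigma1_holds M E e x y \<theta> a \<longrightarrow> sigma1_holds M E e x y \<theta> (a \<boxplus>\<^bsub>M\<^esub> none M)) \<longrightarrow>
        (\<forall>a. sigma1_holds M E e x y \<theta> a))"

definition delta1_comprehension :: "'a l2_structure \<Rightarrow> bool" where
  "delta1_comprehension M \<longleftrightarrow>
     (\<forall>E e x y \<theta> \<theta>'. range E \<subseteq> set_universe M \<longrightarrow>
        (\<forall>a. sigma1_holds M E e x y \<theta> a \<longleftrightarrow> pi1_holds M E e x y \<theta>' a) \<longrightarrow>
        {a. sigma1_holds M E e x y \<theta> a} \<in> set_universe M)"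

definition RCA0_model :: "'a l2_structure \<Rightarrow> bool" where
  "RCA0_model M \<longleftrightarrow>
     set_universe M \<noteq> {} \<and> basic_arithmetic M \<and> sigma1_induction M \<and> delta1_comprehension M"


section \<open>Coding of pairs, functions and finite sequences\<close>

definition npair :: "'a l2_structure \<Rightarrow> 'a \<Rightarrow> 'a \<Rightarrow> 'a" where
  "npair M i j = (i \<boxplus>\<^bsub>M\<^esub> j) \<boxtimes>\<^bsub>M\<^esub> (i \<boxplus>\<^bsub>M\<^esub> j) \<boxplus>\<^bsub>M\<^esub> i"

text \<open>A function exists in the structure when its graph does.\<close>

definition fun1_in :: "'a l2_structure \<Rightarrow> 'a set \<Rightarrow> ('a \<Rightarrow> 'a) \<Rightarrow> bool" where
  "fun1_in M A f \<longleftrightarrow> {npair M a (f a) | a. a \<in> A} \<in> set_universe M"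

definition fun2_in :: "'a l2_structure \<Rightarrow> 'a set \<Rightarrow> ('a \<Rightarrow> 'a \<Rightarrow> 'a) \<Rightarrow> bool" where
  "fun2_in M A f \<longleftrightarrow>
     {npair M (npair M a b) (f a b) | a b. a \<in> A \<and> b \<in> A} \<in> set_universe M"

definition ndvd :: "'a l2_structure \<Rightarrow> 'a \<Rightarrow> 'a \<Rightarrow> bool" where
  "ndvd M d n \<longleftrightarrow> (\<exists>q. n = d \<boxtimes>\<^bsub>M\<^esub> q)"

text \<open>
  Simpson's coding of finite sets (as in the beta function): the triple \<open>(k, (m, n))\<close> represents
  the set of all \<open>i < k\<close> such that \<open>m (i + 1) + 1\<close> divides \<open>n\<close>.  The code of a finite set is
  the least such triple representing it.
\<close>

definition is_triple :: "'a l2_structure \<Rightarrow> 'a \<Rightarrow> bool" where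
  "is_triple M c \<longleftrightarrow> (\<exists>k m n. c = npair M k (npair M m n))"

definition code_mem :: "'a l2_structure \<Rightarrow> 'a \<Rightarrow> 'a \<Rightarrow> bool" where
  "code_mem M i c \<longleftrightarrow>
     (\<exists>k m n. c = npair M k (npair M m n) \<and> i \<prec>\<^bsub>M\<^esub> k \<and>
        ndvd M (m \<boxtimes>\<^bsub>M\<^esub> (i \<boxplus>\<^bsub>M\<^esub> none M) \<boxplus>\<^bsub>M\<^esub> none M) n)"

definition is_finset_code :: "'a l2_structure \<Rightarrow> 'a \<Rightarrow> bool" where
  "is_finset_code M c \<longleftrightarrow> is_triple M c \<and>
     (\<forall>c'. is_triple M c' \<longrightarrow> (\<forall>i. code_mem M i c' \<longleftrightarrow> code_mem M i c) \<longrightarrow> \<not> c' \<prec>\<^bsub>M\<^esub> c)"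

text \<open>
  \<open>entry M s j v\<close> says that the sequence coded by \<open>s\<close> has the value \<open>v\<close> at position \<open>j\<close>.
\<close>

definition entry :: "'a l2_structure \<Rightarrow> 'a \<Rightarrow> 'a \<Rightarrow> 'a \<Rightarrow> bool" where
  "entry M s j v \<longleftrightarrow> code_mem M (npair M j v) s"

definition is_seq :: "'a l2_structure \<Rightarrow> 'a \<Rightarrow> 'a \<Rightarrow> bool" where
  "is_seq M s l \<longleftrightarrow> is_finset_code M s \<and>
     (\<forall>i. code_mem M i s \<longrightarrow> (\<exists>j v. i = npair M j v \<and> j \<prec>\<^bsub>M\<^esub> l)) \<and>
     (\<forall>j. j \<prec>\<^bsub>M\<^esub> l \<longrightarrow> (\<exists>!v. entry M s j v))"


section \<open>Countable integral domains\<close>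

definition countable_domain :: "'a l2_structure \<Rightarrow> 'a ring \<Rightarrow> bool" where
  "countable_domain M S \<longleftrightarrow> domain S \<and> carrier S \<in> set_universe M \<and>
     fun2_in M (carrier S) (add S) \<and> fun2_in M (carrier S) (mult S)"

definition euclidean_dom :: "'a l2_structure \<Rightarrow> 'a ring \<Rightarrow> bool" where
  "euclidean_dom M S \<longleftrightarrow> countable_domain M S \<and>
     (\<exists>f. fun1_in M (carrier S - {\<zero>\<^bsub>S\<^esub>}) f \<and>
       (\<forall>a\<in>carrier S. \<forall>d\<in>carrier S. d \<noteq> \<zero>\<^bsub>S\<^esub> \<longrightarrow>
          (\<exists>q\<in>carrier S. \<exists>r\<in>carrier S.
             a = d \<otimes>\<^bsub>S\<^esub> q \<oplus>\<^bsub>S\<^esub> r \<and> (r \<noteq> \<zero>\<^bsub>S\<^esub> \<longrightarrow> f r \<prec>\<^bsub>M\<^esub> f d))))"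

definition sigma1_ideal :: "'a l2_structure \<Rightarrow> 'a ring \<Rightarrow> ('a \<Rightarrow> 'a) \<Rightarrow> bool" where
  "sigma1_ideal M S a \<longleftrightarrow> fun1_in M UNIV a \<and> range a \<subseteq> carrier S \<and>
     (\<forall>i j. \<forall>r\<in>carrier S. \<forall>s\<in>carrier S.
        \<exists>k. a k = a i \<otimes>\<^bsub>S\<^esub> r \<oplus>\<^bsub>S\<^esub> a j \<otimes>\<^bsub>S\<^esub> s)"

definition sigma1_PID :: "'a l2_structure \<Rightarrow> 'a ring \<Rightarrow> bool" where
  "sigma1_PID M S \<longleftrightarrow> countable_domain M S \<and>
     (\<forall>a. sigma1_ideal M S a \<longrightarrow>
        (\<exists>c\<in>carrier S. range a = {c \<otimes>\<^bsub>S\<^esub> r | r. r \<in> carrier S}))"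


section \<open>The polynomial ring inside a structure\<close>

text \<open>
  Polynomials are the codes of the coefficient sequences, lowest degree first, whose last entry (if
  any) is nonzero; the degree may be a nonstandard number.
\<close>

definition polys :: "'a l2_structure \<Rightarrow> 'a ring \<Rightarrow> 'a set" where
  "polys M R = {p. \<exists>l. is_seq M p l \<and>
     (\<forall>j v. entry M p j v \<longrightarrow> v \<in> carrier R) \<and>
     (\<forall>j. l = j \<boxplus>\<^bsub>M\<^esub> none M \<longrightarrow> \<not> entry M p j \<zero>\<^bsub>R\<^esub>)}"

definition pcoeff :: "'a l2_structure \<Rightarrow> 'a ring \<Rightarrow> 'a \<Rightarrow> 'a \<Rightarrow> 'a" where
  "pcoeff M R p j = (if \<exists>v. entry M p j v then THE v. entry M p j v else \<zero>\<^bsub>R\<^esub>)"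

text \<open>
  \<open>convolution M R p q k v\<close> says that \<open>v\<close> is the sum of the products \<open>p\<^sub>i q\<^sub>j\<close> over \<open>i + j = k\<close>.
  As \<open>k\<close> may be nonstandard, the sum is computed in the structure, by a coded sequence \<open>t\<close> of
  partial sums.
\<close>

definition convolution ::
  "'a l2_structure \<Rightarrow> 'a ring \<Rightarrow> 'a \<Rightarrow> 'a \<Rightarrow> 'a \<Rightarrow> 'a \<Rightarrow> bool" where
  "convolution M R p q k v \<longleftrightarrow>
     (\<exists>t. is_seq M t (k \<boxplus>\<^bsub>M\<^esub> none M \<boxplus>\<^bsub>M\<^esub> none M) \<and> entry M t (nzero M) \<zero>\<^bsub>R\<^esub> \<and>
        (\<forall>i j u. i \<boxplus>\<^bsub>M\<^esub> j = k \<longrightarrow> entry M t i u \<longrightarrow>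
           entry M t (i \<boxplus>\<^bsub>M\<^esub> none M) (u \<oplus>\<^bsub>R\<^esub> pcoeff M R p i \<otimes>\<^bsub>R\<^esub> pcoeff M R q j)) \<and>
        entry M t (k \<boxplus>\<^bsub>M\<^esub> none M) v)"

definition poly_with :: "'a l2_structure \<Rightarrow> 'a ring \<Rightarrow> ('a \<Rightarrow> 'a \<Rightarrow> bool) \<Rightarrow> 'a" where
  "poly_with M R P = (THE p. p \<in> polys M R \<and> (\<forall>k. P k (pcoeff M R p k)))"

definition polynomial_ring :: "'a l2_structure \<Rightarrow> 'a ring \<Rightarrow> 'a ring" where
  "polynomial_ring M R =
     \<lparr> carrier = polys M R,
       mult = (\<lambda>p q. poly_with M R (convolution M R p q)),
       one = poly_with M R (\<lambda>k v. v = (if k = nzero M then \<one>\<^bsub>R\<^esub> else \<zero>\<^bsub>R\<^esub>)),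
       zero = poly_with M R (\<lambda>k v. v = \<zero>\<^bsub>R\<^esub>),
       add = (\<lambda>p q. poly_with M R (\<lambda>k v. v = pcoeff M R p k \<oplus>\<^bsub>R\<^esub> pcoeff M R q k)) \<rparr>"

end

theory Submission
  imports Defs
begin

text \<open>
  Semantically, the sets and functions of a model of \<open>RCA\<^sub>0\<close> are closed under pairing, bounded
  quantification, primitive recursion and the formation of \<open>\<Delta>\<^sup>0\<^sub>1\<close> sets; once this is known, no
  formula has to be written down any more.  Coded polynomials then correspond to the functions of
  the structure with bounded support, and the ring axioms of \<open>R[x]\<close> become identities between
  internal sums, provable by induction.

  If \<open>R\<close> is a field, the length is a Euclidean function: among the pairs \<open>(q, r)\<close> with
  \<open>a = d q + r\<close> take one with \<open>r\<close> of least length, by the \<open>\<Sigma>\<^sup>0\<^sub>1\<close> least number principle.  In a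
  Euclidean domain, an element of a \<open>\<Sigma>\<^sup>0\<^sub>1\<close>-ideal with the least Euclidean value generates it.
  If \<open>R[x]\<close> is a \<open>\<Sigma>\<^sup>0\<^sub>1\<close>-PID, a generator of \<open>(a, x)\<close> is a constant dividing \<open>x\<close>, hence a unit,
  which makes \<open>a\<close> a unit.
\<close>

subsection \<open>Arithmetic in a model\<close>

text \<open>The numbers of \<open>M\<close> may be nonstandard, so no induction, minimum, recursion
  or finite sum of the metalogic applies to them. Each induction must be an instance of Sigma^0_1
  induction, and its predicate must be shown to come from a set of \<open>M\<close>. The calculus of
  \<open>dec\<close> and \<open>rec\<close> serves this purpose. It also explains why many
  statements carry an explicit bound or a default value: bounds keep predicates decidable, and
  defaults keep functions total, as the closure rules require. Lengths of sums may be nonstandard as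
  well. Sums are therefore primitive recursions inside \<open>M\<close>, and each law about them, up
  to the interchange of summation over a triangle, is again an induction in \<open>M\<close>. In the
  ideal theory two sets are treated as merely enumerable. The Euclidean values attained by an ideal
  call for a minimum over a Sigma^0_1 predicate. Membership in \<open>(a, x)\<close> hides the
  cofactor of \<open>a\<close>, so an enumeration has to list each polynomial together with such a
  cofactor.\<close>

locale rca0 =
  fixes M :: "'a l2_structure"
  assumes model: "RCA0_model M"
begin

abbreviation num_zero ("\<^bold>0") where "\<^bold>0 \<equiv> nzero M"
abbreviation num_one ("\<^bold>1") where "\<^bold>1 \<equiv> none M"
abbreviation num_add (infixl "\<^bold>+" 65) where "x \<^bold>+ y \<equiv> nadd M x y"
abbreviation num_mul (infixl "\<^bold>*" 70) where "x \<^bold>* y \<equiv> nmul M x y"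
abbreviation num_less (infix "\<^bold><" 50) where "x \<^bold>< y \<equiv> nless M x y"
abbreviation universe ("\<U>") where "\<U> \<equiv> set_universe M"

lemma basic: "basic_arithmetic M" and univ_ne: "\<U> \<noteq> {}"
  and s1ind: "sigma1_induction M" and d1comp: "delta1_comprehension M"
  using model by (auto simp: RCA0_model_def)

lemma
  shows S_ne_0 [simp]: "n \<^bold>+ \<^bold>1 \<noteq> \<^bold>0"
    and S_inj: "m \<^bold>+ \<^bold>1 = n \<^bold>+ \<^bold>1 \<Longrightarrow> m = n"
    and S_ne_0' [simp]: "\<^bold>0 \<noteq> n \<^bold>+ \<^bold>1"
    and add_0 [simp]: "m \<^bold>+ \<^bold>0 = m"
    and add_S: "m \<^bold>+ (n \<^bold>+ \<^bold>1) = m \<^bold>+ n \<^bold>+ \<^bold>1"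
    and mul_0 [simp]: "m \<^bold>* \<^bold>0 = \<^bold>0"
    and mul_S: "m \<^bold>* (n \<^bold>+ \<^bold>1) = m \<^bold>* n \<^bold>+ m"
    and not_less_0 [simp]: "\<not> m \<^bold>< \<^bold>0"
    and less_S: "m \<^bold>< n \<^bold>+ \<^bold>1 \<longleftrightarrow> m \<^bold>< n \<or> m = n"
  using basic unfolding basic_arithmetic_def by metis+

text \<open>Variables 0 and 1 are the induction variable and the unbounded witness, 2 and 3 hold
  number parameters. The formula enters only through its meaning \<open>Q\<close>, so the conclusion
  no longer mentions it.\<close>

lemma formula_sigma_induct:
  assumes "range E \<subseteq> \<U>"
    and "\<And>e. e 2 = p \<Longrightarrow> e 3 = q \<Longrightarrow> holds M E e \<theta> \<longleftrightarrow> Q (e 0) (e 1)"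
    and "\<exists>b. Q \<^bold>0 b"
    and "\<And>a b. Q a b \<Longrightarrow> \<exists>b. Q (a \<^bold>+ \<^bold>1) b"
  shows "\<exists>b. Q a b"
proof -
  let ?e = "(\<lambda>_. p)(3 := q)"
  have "sigma1_holds M E ?e 0 1 \<theta> a \<longleftrightarrow> (\<exists>b. Q a b)" for a
    by (simp add: sigma1_holds_def assms(2))
  moreover have "\<forall>a. sigma1_holds M E ?e 0 1 \<theta> a"
    using assms(1,3,4) s1ind[unfolded sigma1_induction_def, THEN spec[of _ E], THEN spec[of _ ?e],
        THEN spec[of _ 0], THEN spec[of _ 1], THEN spec[of _ \<theta>]]
    unfolding calculation by metis
  ultimately show ?thesis by metis
qed

text \<open>A bounded formula is Sigma^0_1 with a dummy witness. Without set parameters a constant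
  environment will do, and one exists because \<open>set_universe M\<close> is nonempty.\<close>

lemma formula_induct:
  assumes "\<And>E e. e 2 = p \<Longrightarrow> e 3 = q \<Longrightarrow> holds M E e \<theta> \<longleftrightarrow> P (e 0)"
    and "P \<^bold>0" and "\<And>a. P a \<Longrightarrow> P (a \<^bold>+ \<^bold>1)"
  shows "P a"
proof -
  obtain S where "S \<in> \<U>" using univ_ne by auto
  then have "range (\<lambda>_. S) \<subseteq> \<U>" by auto
  from formula_sigma_induct[OF this, of p q \<theta> "\<lambda>a _. P a" a] assms show ?thesis by metis
qed

section \<open>The commutative semiring laws\<close>

lemma zero_add [simp]: "\<^bold>0 \<^bold>+ n = n"
  by (rule formula_induct[where \<theta> = "Eq (Plus Zero (Var 0)) (Var 0)"]) (auto simp: add_S)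

lemma S_add: "m \<^bold>+ \<^bold>1 \<^bold>+ n = m \<^bold>+ n \<^bold>+ \<^bold>1"
  by (rule formula_induct[where \<theta> = "Eq (Plus (Plus (Var 2) One) (Var 0)) (Plus (Plus (Var 2) (Var 0)) One)"
        and p = m]) (auto simp: add_S)

lemma add_comm: "m \<^bold>+ n = n \<^bold>+ m"
  by (rule formula_induct[where \<theta> = "Eq (Plus (Var 2) (Var 0)) (Plus (Var 0) (Var 2))"
        and p = m]) (auto simp: add_S S_add)

lemma add_assoc: "m \<^bold>+ n \<^bold>+ k = m \<^bold>+ (n \<^bold>+ k)"
  by (rule formula_induct[where \<theta> = "Eq (Plus (Plus (Var 2) (Var 3)) (Var 0)) (Plus (Var 2) (Plus (Var 3) (Var 0)))"
        and p = m and q = n and a = k]) (auto simp: add_S)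

lemma add_left_comm: "m \<^bold>+ (n \<^bold>+ k) = n \<^bold>+ (m \<^bold>+ k)"
  by (metis add_assoc add_comm)

lemmas add_acs = add_assoc add_comm add_left_comm

lemma zero_mul [simp]: "\<^bold>0 \<^bold>* n = \<^bold>0"
  by (rule formula_induct[where \<theta> = "Eq (Times Zero (Var 0)) Zero"]) (auto simp: mul_S)

lemma S_mul: "(m \<^bold>+ \<^bold>1) \<^bold>* n = m \<^bold>* n \<^bold>+ n"
  by (rule formula_induct[where \<theta> = "Eq (Times (Plus (Var 2) One) (Var 0)) (Plus (Times (Var 2) (Var 0)) (Var 0))"
        and p = m]) (auto simp: mul_S add_acs)

lemma mul_comm: "m \<^bold>* n = n \<^bold>* m"
  by (rule formula_induct[where \<theta> = "Eq (Times (Var 2) (Var 0)) (Times (Var 0) (Var 2))"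
        and p = m]) (auto simp: mul_S S_mul)

lemma mul_add: "m \<^bold>* (n \<^bold>+ k) = m \<^bold>* n \<^bold>+ m \<^bold>* k"
  by (rule formula_induct[where \<theta> = "Eq (Times (Var 2) (Plus (Var 3) (Var 0)))
          (Plus (Times (Var 2) (Var 3)) (Times (Var 2) (Var 0)))"
        and p = m and q = n and a = k]) (auto simp: mul_S add_S, simp add: add_acs)

lemma one_mul [simp]: "\<^bold>1 \<^bold>* n = n" "n \<^bold>* \<^bold>1 = n"
proof -
  show "n \<^bold>* \<^bold>1 = n" using mul_S[of n "\<^bold>0"] by simp
  then show "\<^bold>1 \<^bold>* n = n" by (simp add: mul_comm)
qed

lemma mul_assoc: "m \<^bold>* n \<^bold>* k = m \<^bold>* (n \<^bold>* k)"
  by (rule formula_induct[where \<theta> = "Eq (Times (Times (Var 2) (Var 3)) (Var 0)) (Times (Var 2) (Times (Var 3) (Var 0)))"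
        and p = m and q = n and a = k]) (auto simp: mul_S mul_add)

lemma add_cancel: "m \<^bold>+ a = m \<^bold>+ b \<Longrightarrow> a = b"
proof -
  have "m \<^bold>+ a = m \<^bold>+ b \<longrightarrow> a = b"
    by (rule formula_induct[where \<theta> = "Neg (Conj (Eq (Plus (Var 0) (Var 2)) (Plus (Var 0) (Var 3))) (Neg (Eq (Var 2) (Var 3))))"
        and p = a and q = b]) (auto simp: S_add dest: S_inj)
  then show "m \<^bold>+ a = m \<^bold>+ b \<Longrightarrow> a = b" by simp
qed

section \<open>Order and truncated subtraction\<close>

text \<open>The predecessor is the witness of a Sigma^0_1 induction whose step ignores its
  hypothesis, since \<open>a + 1\<close> has the predecessor \<open>a\<close>.\<close>

lemma zero_or_S: "n = \<^bold>0 \<or> (\<exists>m. n = m \<^bold>+ \<^bold>1)"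
proof -
  obtain S where "S \<in> \<U>" using univ_ne by auto
  then have "\<exists>m. (n = \<^bold>0 \<or> n = m \<^bold>+ \<^bold>1)"
    by (intro formula_sigma_induct[where E = "\<lambda>_. S" and a = n and
        Q = "\<lambda>a b. a = \<^bold>0 \<or> a = b \<^bold>+ \<^bold>1" and
        \<theta> = "Neg (Conj (Neg (Eq (Var 0) Zero)) (Neg (Eq (Var 0) (Plus (Var 1) One))))"]) auto
  then show ?thesis by auto
qed

text \<open>The axioms describe the order only at 0 and at successors. A Sigma^0_1 induction on
  \<open>n\<close> produces \<open>d\<close>: the new case \<open>m = n\<close> takes
  \<open>d = 0\<close>, and an old \<open>d\<close> becomes \<open>d + 1\<close>. The order is
  thereby reduced to addition.\<close>

lemma less_iff: "m \<^bold>< n \<longleftrightarrow> (\<exists>d. n = m \<^bold>+ d \<^bold>+ \<^bold>1)"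
proof
  obtain S where "S \<in> \<U>" using univ_ne by auto
  then have "\<exists>d. (\<not> m \<^bold>< n \<or> n = m \<^bold>+ d \<^bold>+ \<^bold>1)"
    by (intro formula_sigma_induct[where E = "\<lambda>_. S" and p = m and a = n and
        Q = "\<lambda>a b. \<not> m \<^bold>< a \<or> a = m \<^bold>+ b \<^bold>+ \<^bold>1" and
        \<theta> = "Neg (Conj (Less (Var 2) (Var 0)) (Neg (Eq (Var 0) (Plus (Plus (Var 2) (Var 1)) One))))"])
      (auto simp: less_S add_S intro: exI[of _ "\<^bold>0"] exI[of _ "_ \<^bold>+ \<^bold>1"])
  then show "m \<^bold>< n \<Longrightarrow> \<exists>d. n = m \<^bold>+ d \<^bold>+ \<^bold>1" by auto
next
  have "m \<^bold>< m \<^bold>+ d \<^bold>+ \<^bold>1" for d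
    by (rule formula_induct[where \<theta> = "Less (Var 2) (Plus (Plus (Var 2) (Var 0)) One)"
          and p = m]) (auto simp: less_S add_S)
  then show "\<exists>d. n = m \<^bold>+ d \<^bold>+ \<^bold>1 \<Longrightarrow> m \<^bold>< n" by auto
qed

lemma zero_less: "\<^bold>0 \<^bold>< n \<longleftrightarrow> n \<noteq> \<^bold>0"
  using zero_or_S[of n] less_iff[of "\<^bold>0" n] by auto

lemma less_total: "m \<^bold>< n \<or> m = n \<or> n \<^bold>< m"
proof (rule formula_induct[where a = n and p = m and
      \<theta> = "Neg (Conj (Neg (Less (Var 2) (Var 0))) (Conj (Neg (Eq (Var 2) (Var 0))) (Neg (Less (Var 0) (Var 2)))))"])
  fix a assume *: "m \<^bold>< a \<or> m = a \<or> a \<^bold>< m"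
  have "a \<^bold>+ \<^bold>1 = m \<or> a \<^bold>+ \<^bold>1 \<^bold>< m" if am: "a \<^bold>< m"
  proof -
    obtain d where d: "m = a \<^bold>+ d \<^bold>+ \<^bold>1" using am less_iff by auto
    then show ?thesis
      using zero_or_S[of d] by (auto simp: less_iff add_acs)
  qed
  then show "m \<^bold>< a \<^bold>+ \<^bold>1 \<or> m = a \<^bold>+ \<^bold>1 \<or> a \<^bold>+ \<^bold>1 \<^bold>< m" using * less_S by blast
qed (use zero_less in auto)

lemma less_irrefl: "\<not> m \<^bold>< m"
proof
  assume "m \<^bold>< m"
  then obtain d where "m = m \<^bold>+ (d \<^bold>+ \<^bold>1)" unfolding less_iff by (auto simp: add_assoc)
  then have "m \<^bold>+ \<^bold>0 = m \<^bold>+ (d \<^bold>+ \<^bold>1)" by (simp only: add_0)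
  from add_cancel[OF this] S_ne_0 show False by metis
qed

lemma less_trans': "a \<^bold>< b \<Longrightarrow> b \<^bold>< c \<Longrightarrow> a \<^bold>< c"
  unfolding less_iff using add_assoc by metis

definition num_le (infix "\<^bold>\<le>" 50) where "x \<^bold>\<le> y \<longleftrightarrow> x \<^bold>< y \<or> x = y"

text \<open>Truncated at 0, as the laws of \<open>linordered_semidom\<close> demand; it also
  supplies the index \<open>k - i\<close> in convolutions.\<close>

definition num_sub (infixl "\<^bold>-" 65) where
  "x \<^bold>- y = (if y \<^bold>\<le> x then THE d. x = y \<^bold>+ d else \<^bold>0)"

lemma add_sub: "y \<^bold>\<le> x \<Longrightarrow> y \<^bold>+ (x \<^bold>- y) = x"
proof -
  assume yx: "y \<^bold>\<le> x"
  then have "\<exists>d. x = y \<^bold>+ d" by (auto simp: num_le_def less_iff add_assoc intro: add_0[symmetric])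
  then have "\<exists>!d. x = y \<^bold>+ d" using add_cancel by metis
  from theI'[OF this] show ?thesis using yx by (simp add: num_sub_def)
qed

lemma le_iff_add: "x \<^bold>\<le> y \<longleftrightarrow> (\<exists>d. y = x \<^bold>+ d)"
proof
  assume "\<exists>d. y = x \<^bold>+ d"
  then obtain d where d: "y = x \<^bold>+ d" ..
  show "x \<^bold>\<le> y"
    using zero_or_S[of d] d by (auto simp: num_le_def less_iff add_acs)
qed (metis add_sub)

lemma add_sub_cancel: "a \<^bold>+ b \<^bold>- a = b"
  using add_sub[of a "a \<^bold>+ b"] le_iff_add add_cancel by blast

lemma sub_sub: "a \<^bold>- b \<^bold>- c = a \<^bold>- (b \<^bold>+ c)"
proof (cases "b \<^bold>+ c \<^bold>\<le> a")
  case True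
  then obtain d where d: "a = b \<^bold>+ c \<^bold>+ d" unfolding le_iff_add by auto
  then have "a \<^bold>- b = c \<^bold>+ d" using add_sub_cancel[of b "c \<^bold>+ d"] by (simp add: add_assoc)
  then show ?thesis using d add_sub_cancel by metis
next
  case False
  have "a \<^bold>- b \<^bold>- c = \<^bold>0"
  proof (cases "b \<^bold>\<le> a")
    case True
    then obtain d where d: "a = b \<^bold>+ d" unfolding le_iff_add by auto
    with False have "\<not> c \<^bold>\<le> d" by (auto simp: le_iff_add add_acs)
    then show ?thesis using d add_sub_cancel[of b d] by (simp add: num_sub_def)
  next
    case False
    have "\<^bold>0 \<^bold>- c = \<^bold>0"
    proof (cases "c = \<^bold>0")
      case True
      then show ?thesis using add_sub_cancel[of "\<^bold>0" "\<^bold>0"] by simp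
    next
      case False
      then show ?thesis by (simp add: num_sub_def num_le_def)
    qed
    then show ?thesis using False by (simp add: num_sub_def)
  qed
  then show ?thesis using False by (simp add: num_sub_def)
qed

lemma mul_less: "a \<^bold>< b \<Longrightarrow> \<^bold>0 \<^bold>< c \<Longrightarrow> c \<^bold>* a \<^bold>< c \<^bold>* b"
proof -
  assume "a \<^bold>< b" "\<^bold>0 \<^bold>< c"
  then obtain d d' where "b = a \<^bold>+ d \<^bold>+ \<^bold>1" "c = d' \<^bold>+ \<^bold>1" unfolding less_iff by auto
  then have "c \<^bold>* b = c \<^bold>* a \<^bold>+ (c \<^bold>* d \<^bold>+ d') \<^bold>+ \<^bold>1" by (simp add: mul_add add_acs)
  then show ?thesis unfolding less_iff by blast
qed

text \<open>Interpreting the class as a locale makes the library facts on ordered semirings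
  available, under the prefix \<open>num\<close>, for the numbers of \<open>M\<close>.\<close>

sublocale num: linordered_semidom
  where plus = "nadd M" and times = "nmul M" and zero = "nzero M" and one = "none M"
    and less = "nless M" and less_eq = num_le and minus = num_sub
proof unfold_locales
  fix a b c
  show "a \<^bold>+ b \<^bold>+ c = a \<^bold>+ (b \<^bold>+ c)" by (rule add_assoc)
  show "a \<^bold>+ b = b \<^bold>+ a" by (rule add_comm)
  show "a \<^bold>+ b \<^bold>- a = b" by (rule add_sub_cancel)
  show "a \<^bold>- b \<^bold>- c = a \<^bold>- (b \<^bold>+ c)" by (rule sub_sub)
  show "a \<^bold>< b \<longleftrightarrow> a \<^bold>\<le> b \<and> \<not> b \<^bold>\<le> a"
    unfolding num_le_def using less_irrefl less_trans' by blast
  show "a \<^bold>\<le> a" by (simp add: num_le_def)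
  show "a \<^bold>\<le> b \<Longrightarrow> b \<^bold>\<le> c \<Longrightarrow> a \<^bold>\<le> c" unfolding num_le_def using less_trans' by blast
  show "a \<^bold>\<le> b \<Longrightarrow> b \<^bold>\<le> a \<Longrightarrow> a = b" unfolding num_le_def using less_irrefl less_trans' by blast
  show "a \<^bold>\<le> b \<Longrightarrow> c \<^bold>+ a \<^bold>\<le> c \<^bold>+ b" unfolding le_iff_add using add_assoc by metis
  show "a \<^bold>\<le> b \<or> b \<^bold>\<le> a" unfolding num_le_def using less_total by blast
  show "\<^bold>0 \<^bold>+ a = a" "\<^bold>0 \<^bold>* a = \<^bold>0" "a \<^bold>* \<^bold>0 = \<^bold>0" "\<^bold>1 \<^bold>* a = a" by simp_all
  show "a \<^bold>* b \<^bold>* c = a \<^bold>* (b \<^bold>* c)" by (rule mul_assoc)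
  show "a \<^bold>* b = b \<^bold>* a" by (rule mul_comm)
  show "a \<^bold>* (b \<^bold>+ c) = a \<^bold>* b \<^bold>+ a \<^bold>* c" by (rule mul_add)
  show "(a \<^bold>+ b) \<^bold>* c = a \<^bold>* c \<^bold>+ b \<^bold>* c" using mul_comm mul_add by metis
  show "a \<^bold>< b \<Longrightarrow> \<^bold>0 \<^bold>< c \<Longrightarrow> c \<^bold>* a \<^bold>< c \<^bold>* b" by (rule mul_less)
  show "\<^bold>0 \<noteq> \<^bold>1" using S_ne_0'[of "\<^bold>0"] by simp
  then show "\<^bold>0 \<^bold>< \<^bold>1" by (simp add: zero_less)
  show "a \<^bold>\<le> b \<Longrightarrow> b \<^bold>- a \<^bold>+ a = b" using add_sub add_comm by metis
  show "a \<^bold>* (b \<^bold>- c) = a \<^bold>* b \<^bold>- a \<^bold>* c"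
  proof (cases "c \<^bold>\<le> b")
    case True
    then obtain d where "b = c \<^bold>+ d" unfolding le_iff_add by auto
    then show ?thesis using add_sub_cancel by (simp add: mul_add)
  next
    case False
    then have "b \<^bold>< c" using less_total num_le_def by blast
    \<comment> \<open>Since \<open>b - c\<close> is truncated to 0, \<open>a * b - a * c\<close> has
      to be 0: for \<open>a = 0\<close> both products vanish, otherwise it is truncated too.\<close>
    then have "a = \<^bold>0 \<or> \<not> a \<^bold>* c \<^bold>\<le> a \<^bold>* b"
      using mul_less[of b c a] zero_less less_irrefl less_trans' unfolding num_le_def by metis
    then show ?thesis using False add_sub_cancel[of "\<^bold>0" "\<^bold>0"] by (auto simp: num_sub_def)
  qed
  show "a \<noteq> \<^bold>0 \<Longrightarrow> b \<noteq> \<^bold>0 \<Longrightarrow> a \<^bold>* b \<noteq> \<^bold>0"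
    using mul_less[of "\<^bold>0" b a] zero_less by auto
qed

end

subsection \<open>Pairing and relative computability\<close>

context rca0 begin

abbreviation pair ("\<langle>_,/ _\<rangle>") where "\<langle>i, j\<rangle> \<equiv> npair M i j"

lemma less_S_iff_le: "m \<^bold>< n \<^bold>+ \<^bold>1 \<longleftrightarrow> m \<^bold>\<le> n"
  by (simp add: less_S num_le_def)

lemma S_le_iff_less: "m \<^bold>+ \<^bold>1 \<^bold>\<le> n \<longleftrightarrow> m \<^bold>< n"
  using less_S_iff_le[of n m] by (metis num.not_less)

lemma less_1 [simp]: "n \<^bold>< \<^bold>1 \<longleftrightarrow> n = \<^bold>0"
  using less_S[of n "\<^bold>0"] by simp

lemma self_less_S [simp]: "n \<^bold>< n \<^bold>+ \<^bold>1"
  by (simp add: less_S)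

lemma zero_le [simp]: "\<^bold>0 \<^bold>\<le> n"
  by (simp add: le_iff_add)

lemma le_add [simp]: "m \<^bold>\<le> m \<^bold>+ n" "m \<^bold>\<le> n \<^bold>+ m"
  unfolding le_iff_add using add_comm by auto

lemma add_eq_0 [simp]: "m \<^bold>+ n = \<^bold>0 \<longleftrightarrow> m = \<^bold>0 \<and> n = \<^bold>0"
  by (metis add_S zero_or_S S_ne_0 add_0)

section \<open>Injectivity and bounds of the pairing function\<close>

lemma le_square: "m \<^bold>\<le> m \<^bold>* m"
  using zero_or_S[of m] by (auto simp: mul_add)

text \<open>This is behind the injectivity of \<open>npair\<close>: with \<open>s = i + j\<close>
  the code \<open>s * s + i\<close> lies between the square of \<open>s\<close> and that of
  \<open>s + 1\<close>, so the code determines \<open>s\<close>, and then \<open>i\<close>.\<close>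

lemma square_add_less:
  assumes "i \<^bold>\<le> s" "s \<^bold>< s'" shows "s \<^bold>* s \<^bold>+ i \<^bold>< s' \<^bold>* s'"
proof -
  have "s \<^bold>* s \<^bold>+ i \<^bold>\<le> s \<^bold>* (s \<^bold>+ \<^bold>1)" using assms(1) by (simp add: mul_add)
  also have "\<dots> \<^bold>< (s \<^bold>+ \<^bold>1) \<^bold>* (s \<^bold>+ \<^bold>1)"
    by (intro num.mult_strict_right_mono) (simp_all add: zero_less)
  also have "\<dots> \<^bold>\<le> s' \<^bold>* s'"
    using assms(2) by (intro num.mult_mono) (simp_all add: S_le_iff_less)
  finally show ?thesis .
qed

lemma pair_inject [simp]: "\<langle>i, j\<rangle> = \<langle>i', j'\<rangle> \<longleftrightarrow> i = i' \<and> j = j'"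
proof
  assume eq: "\<langle>i, j\<rangle> = \<langle>i', j'\<rangle>"
  have "\<langle>i, j\<rangle> \<noteq> \<langle>i', j'\<rangle>" if "i \<^bold>+ j \<^bold>< i' \<^bold>+ j'" for i j i' j'
  proof -
    have "\<langle>i, j\<rangle> \<^bold>< (i' \<^bold>+ j') \<^bold>* (i' \<^bold>+ j')"
      unfolding npair_def by (intro square_add_less that) simp
    also have "\<dots> \<^bold>\<le> \<langle>i', j'\<rangle>" unfolding npair_def by simp
    finally show ?thesis using less_irrefl by metis
  qed
  with eq have s: "i \<^bold>+ j = i' \<^bold>+ j'" using less_total by metis
  with eq have "i = i'" unfolding npair_def using add_cancel by metis
  with s show "i = i' \<and> j = j'" using add_cancel by metis
qed simp

lemma pair_ge [simp]: "i \<^bold>\<le> \<langle>i, j\<rangle>" "j \<^bold>\<le> \<langle>i, j\<rangle>"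
proof -
  show "i \<^bold>\<le> \<langle>i, j\<rangle>" by (simp add: npair_def)
  have "j \<^bold>\<le> i \<^bold>+ j" by simp
  also have "\<dots> \<^bold>\<le> (i \<^bold>+ j) \<^bold>* (i \<^bold>+ j)" by (rule le_square)
  also have "\<dots> \<^bold>\<le> \<langle>i, j\<rangle>" by (simp add: npair_def)
  finally show "j \<^bold>\<le> \<langle>i, j\<rangle>" .
qed

lemma pair_less_S [simp]: "i \<^bold>< \<langle>i, j\<rangle> \<^bold>+ \<^bold>1" "j \<^bold>< \<langle>i, j\<rangle> \<^bold>+ \<^bold>1"
  by (simp_all add: less_S_iff_le)

lemma pair_mono: "i \<^bold>\<le> i' \<Longrightarrow> j \<^bold>\<le> j' \<Longrightarrow> \<langle>i, j\<rangle> \<^bold>\<le> \<langle>i', j'\<rangle>"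
  unfolding npair_def by (intro num.add_mono num.mult_mono) simp_all

text \<open>Pairing is not onto (3 is not a code), so the projections get the default 0 and become
  total, which composition in \<open>rec\<close> requires.\<close>

definition is_pair :: "'a \<Rightarrow> bool" where "is_pair z \<longleftrightarrow> (\<exists>i j. z = \<langle>i, j\<rangle>)"
definition pfst :: "'a \<Rightarrow> 'a" where
  "pfst z = (if is_pair z then THE i. \<exists>j. z = \<langle>i, j\<rangle> else \<^bold>0)"
definition psnd :: "'a \<Rightarrow> 'a" where
  "psnd z = (if is_pair z then THE j. \<exists>i. z = \<langle>i, j\<rangle> else \<^bold>0)"

lemma is_pair_pair [simp]: "is_pair \<langle>i, j\<rangle>"
  by (auto simp: is_pair_def)

lemma pfst_pair [simp]: "pfst \<langle>i, j\<rangle> = i" and psnd_pair [simp]: "psnd \<langle>i, j\<rangle> = j"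
  by (simp_all add: pfst_def psnd_def)

lemma is_pairE: "is_pair z \<Longrightarrow> (\<And>i j. z = \<langle>i, j\<rangle> \<Longrightarrow> thesis) \<Longrightarrow> thesis"
  by (auto simp: is_pair_def)

lemma pfst_le: "pfst z \<^bold>\<le> z" and psnd_le: "psnd z \<^bold>\<le> z"
  by (cases "is_pair z"; force simp: is_pair_def pfst_def psnd_def)+

text \<open>
  \<open>dec\<close> and \<open>rec\<close> describe the sets and functions of the structure, which in \<open>RCA\<^sub>0\<close> are
  closed under relative computability.  Several arguments are packed into one by pairing.
\<close>

definition dec :: "('a \<Rightarrow> bool) \<Rightarrow> bool" where "dec P \<longleftrightarrow> Collect P \<in> \<U>"
definition graph :: "('a \<Rightarrow> 'a) \<Rightarrow> 'a set" where "graph f = {\<langle>a, f a\<rangle> | a. True}"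
definition rec :: "('a \<Rightarrow> 'a) \<Rightarrow> bool" where "rec f \<longleftrightarrow> graph f \<in> \<U>"

lemma pair_in_graph [simp]: "\<langle>a, b\<rangle> \<in> graph f \<longleftrightarrow> b = f a"
  by (auto simp: graph_def)

lemma rec_iff_fun1_in: "rec f \<longleftrightarrow> fun1_in M UNIV f"
  by (simp add: rec_def graph_def fun1_in_def)

section \<open>Closure properties obtained from explicit formulas\<close>

abbreviation "BEx x t \<phi> \<equiv> Neg (BAll x t (Neg \<phi>))"
abbreviation "Imp \<phi> \<psi> \<equiv> Neg (Conj \<phi> (Neg \<psi>))"
abbreviation "Disj \<phi> \<psi> \<equiv> Neg (Conj (Neg \<phi>) (Neg \<psi>))"
abbreviation "Npair s t \<equiv> Plus (Times (Plus s t) (Plus s t)) s"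

text \<open>Variable 3 is the argument, 4 the unbounded witness and 5 a number parameter; the
  remaining variables are free for bounded quantifiers.\<close>

lemma dec_formula:
  assumes E: "range E \<subseteq> \<U>"
    and Q: "\<And>e. e 5 = p \<Longrightarrow> holds M E e \<theta> \<longleftrightarrow> Q (e 3) (e 4)"
    and Q': "\<And>e. e 5 = p \<Longrightarrow> holds M E e \<theta>' \<longleftrightarrow> Q' (e 3) (e 4)"
    and P: "\<And>a. P a \<longleftrightarrow> (\<exists>b. Q a b)" and P': "\<And>a. P a \<longleftrightarrow> (\<forall>b. Q' a b)"
  shows "dec P"
proof -
  have s: "sigma1_holds M E (\<lambda>_. p) 3 4 \<theta> a \<longleftrightarrow> P a" for a
    by (simp add: sigma1_holds_def Q P)
  have p: "pi1_holds M E (\<lambda>_. p) 3 4 \<theta>' a \<longleftrightarrow> P a" for a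
    by (simp add: pi1_holds_def Q' P')
  have "{a. sigma1_holds M E (\<lambda>_. p) 3 4 \<theta> a} \<in> \<U>"
    using d1comp E s p unfolding delta1_comprehension_def by blast
  then show ?thesis unfolding s dec_def .
qed

lemma dec_bounded:
  assumes "range E \<subseteq> \<U>" and "\<And>e. e 5 = p \<Longrightarrow> holds M E e \<theta> \<longleftrightarrow> P (e 3)"
  shows "dec P"
  by (rule dec_formula[OF assms(1), where p = p and \<theta> = \<theta> and \<theta>' = \<theta> and Q = "\<lambda>a _. P a" and Q' = "\<lambda>a _. P a"])
    (use assms(2) in auto)

text \<open>A total function with a Sigma^0_1 graph has a Delta^0_1 graph: a pair is in it iff every
  value computed for its first component equals its second.\<close>

lemma rec_formula:
  assumes E: "range E \<subseteq> \<U>"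
    and Q: "\<And>e. holds M E e \<theta> \<longleftrightarrow> Q (e 0) (e 1) (e 2)"
    and f: "\<And>a b. b = f a \<longleftrightarrow> (\<exists>d. Q a b d)"
  shows "rec f"
proof -
  \<comment> \<open>Only one unbounded quantifier is allowed, so \<open>w\<close> is a common bound
    for the argument, the value and the witness. In the universal form the argument and the claimed
    value are bounded by the code \<open>z\<close> instead.\<close>
  let ?R = "\<lambda>z w. \<exists>a b d. a \<^bold>< w \<and> b \<^bold>< w \<and> d \<^bold>< w \<and> z = \<langle>a, b\<rangle> \<and> Q a b d"
  let ?R' = "\<lambda>z w. (\<exists>a b. z = \<langle>a, b\<rangle>) \<and> (\<forall>a b b' d. b' \<^bold>< w \<longrightarrow> d \<^bold>< w \<longrightarrow> Q a b' d \<longrightarrow> z = \<langle>a, b\<rangle> \<longrightarrow> b' = b)"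
  have bnd: "\<exists>w. a \<^bold>< w \<and> b \<^bold>< w \<and> d \<^bold>< w" for a b d
  proof -
    have "a \<^bold>\<le> a \<^bold>+ b \<^bold>+ d" "b \<^bold>\<le> a \<^bold>+ b \<^bold>+ d" "d \<^bold>\<le> a \<^bold>+ b \<^bold>+ d"
      using num.order_trans[OF le_add(1) le_add(1), of a b d] num.order_trans[OF le_add(2) le_add(1), of b a d]
      by simp_all
    then show ?thesis using less_S_iff_le by blast
  qed
  have "dec (\<lambda>z. \<exists>a. z = \<langle>a, f a\<rangle>)"
  proof (rule dec_formula[OF E, where Q = ?R and Q' = ?R'])
    show "holds M E e (BEx 0 (Var 4) (BEx 1 (Var 4) (BEx 2 (Var 4)
        (Conj (Eq (Var 3) (Npair (Var 0) (Var 1))) \<theta>)))) \<longleftrightarrow> ?R (e 3) (e 4)" for e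
      by (simp add: Q npair_def) blast
    have bq: "(\<exists>a b. z = \<langle>a, b\<rangle>) \<longleftrightarrow> (\<exists>a. a \<^bold>< z \<^bold>+ \<^bold>1 \<and> (\<exists>b. b \<^bold>< z \<^bold>+ \<^bold>1 \<and> z = \<langle>a, b\<rangle>))" for z
      using pair_less_S by metis
    have p: "z = \<langle>a, b\<rangle> \<Longrightarrow> a \<^bold>< z \<^bold>+ \<^bold>1 \<and> b \<^bold>< z \<^bold>+ \<^bold>1" for z a b
      by simp
    have bq': "(\<forall>a b b' d. b' \<^bold>< w \<longrightarrow> d \<^bold>< w \<longrightarrow> Q a b' d \<longrightarrow> z = \<langle>a, b\<rangle> \<longrightarrow> b' = b) \<longleftrightarrow>
      (\<forall>a. a \<^bold>< z \<^bold>+ \<^bold>1 \<longrightarrow> (\<forall>b. b \<^bold>< z \<^bold>+ \<^bold>1 \<longrightarrow> (\<forall>b'. b' \<^bold>< w \<longrightarrow> (\<forall>d. d \<^bold>< w \<longrightarrow> Q a b' d \<longrightarrow> z = \<langle>a, b\<rangle> \<longrightarrow> b' = b))))" for z w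
      using p by blast
    show "holds M E e (Conj (BEx 0 (Plus (Var 3) One) (BEx 1 (Plus (Var 3) One) (Eq (Var 3) (Npair (Var 0) (Var 1)))))
       (BAll 0 (Plus (Var 3) One) (BAll 6 (Plus (Var 3) One) (BAll 1 (Var 4) (BAll 2 (Var 4)
        (Imp (Eq (Var 3) (Npair (Var 0) (Var 6))) (Imp \<theta> (Eq (Var 1) (Var 6))))))))) \<longleftrightarrow> ?R' (e 3) (e 4)" for e
      unfolding bq bq' by (simp add: Q npair_def)
    fix z
    show "(\<exists>a. z = \<langle>a, f a\<rangle>) \<longleftrightarrow> (\<exists>w. ?R z w)"
      using f bnd by metis
    show "(\<exists>a. z = \<langle>a, f a\<rangle>) \<longleftrightarrow> (\<forall>w. ?R' z w)"
    proof
      assume "\<exists>a. z = \<langle>a, f a\<rangle>"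
      then show "\<forall>w. ?R' z w" using f by auto
    next
      assume *: "\<forall>w. ?R' z w"
      then obtain a b where z: "z = \<langle>a, b\<rangle>" by blast
      obtain d where d: "Q a (f a) d" using f by blast
      obtain w where "f a \<^bold>< w" "d \<^bold>< w" using bnd by blast
      with * z d have "f a = b" by blast
      with z show "\<exists>a. z = \<langle>a, f a\<rangle>" by blast
    qed
  qed
  moreover have "graph f = Collect (\<lambda>z. \<exists>a. z = \<langle>a, f a\<rangle>)" by (auto simp: graph_def)
  ultimately show ?thesis by (simp add: rec_def dec_def)
qed

abbreviation "two A B \<equiv> \<lambda>n::nat. if n = 0 then A else B"

lemma rec_comp:
  assumes "rec h" "rec f" shows "rec (\<lambda>x. h (f x))"
  by (rule rec_formula[where E = "two (graph h) (graph f)" and Q = "\<lambda>a b d. d = f a \<and> b = h d" and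
        \<theta> = "Conj (Mem (Npair (Var 0) (Var 2)) 1) (Mem (Npair (Var 2) (Var 1)) 0)"])
    (use assms in \<open>auto simp: rec_def npair_def[symmetric]\<close>)

lemma rec_id: "rec (\<lambda>x. x)"
proof -
  obtain S where "S \<in> \<U>" using univ_ne by auto
  then show ?thesis
    by (intro rec_formula[where E = "\<lambda>_. S" and Q = "\<lambda>a b d. b = a" and \<theta> = "Eq (Var 1) (Var 0)"]) auto
qed

text \<open>\<open>rec_formula\<close> admits no number parameter, so the graph is obtained
  directly, with \<open>k\<close> as variable 5.\<close>

lemma rec_const: "rec (\<lambda>x. k)"
proof -
  obtain S where S: "S \<in> \<U>" using univ_ne by auto
  have bq: "(\<exists>a. z = \<langle>a, k\<rangle>) \<longleftrightarrow> (\<exists>a. a \<^bold>< z \<^bold>+ \<^bold>1 \<and> z = \<langle>a, k\<rangle>)" for z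
    using pair_less_S by metis
  have "dec (\<lambda>z. \<exists>a. z = \<langle>a, k\<rangle>)" unfolding bq
    by (rule dec_bounded[where E = "\<lambda>_. S" and p = k and
      \<theta> = "BEx 0 (Plus (Var 3) One) (Eq (Var 3) (Npair (Var 0) (Var 5)))"])
      (use S in \<open>auto simp: npair_def\<close>)
  then show ?thesis unfolding rec_def dec_def graph_def by simp
qed

text \<open>The value \<open>f x\<close> is unique, so it can be quantified existentially with a
  conjunction or universally with an implication; this gives both forms for Delta^0_1
  comprehension.\<close>

lemma dec_comp:
  assumes "dec P" "rec f" shows "dec (\<lambda>x. P (f x))"
  by (rule dec_formula[where E = "two (Collect P) (graph f)" and
        Q = "\<lambda>a d. d = f a \<and> P d" and Q' = "\<lambda>a d. d = f a \<longrightarrow> P d" and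
        \<theta> = "Conj (Mem (Npair (Var 3) (Var 4)) 1) (Mem (Var 4) 0)" and
        \<theta>' = "Imp (Mem (Npair (Var 3) (Var 4)) 1) (Mem (Var 4) 0)"])
    (use assms in \<open>auto simp: rec_def dec_def npair_def[symmetric]\<close>)

lemma dec_not: "dec P \<Longrightarrow> dec (\<lambda>x. \<not> P x)"
  by (rule dec_bounded[where E = "\<lambda>_. Collect P" and \<theta> = "Neg (Mem (Var 3) 0)"]) (auto simp: dec_def)

lemma dec_and: "dec P \<Longrightarrow> dec Q \<Longrightarrow> dec (\<lambda>x. P x \<and> Q x)"
  by (rule dec_bounded[where E = "two (Collect P) (Collect Q)" and \<theta> = "Conj (Mem (Var 3) 0) (Mem (Var 3) 1)"])
    (auto simp: dec_def)

lemma dec_or: "dec P \<Longrightarrow> dec Q \<Longrightarrow> dec (\<lambda>x. P x \<or> Q x)"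
  using dec_not[OF dec_and[OF dec_not dec_not], of P Q] by simp

lemma dec_imp: "dec P \<Longrightarrow> dec Q \<Longrightarrow> dec (\<lambda>x. P x \<longrightarrow> Q x)"
  unfolding imp_conv_disj by (rule dec_or[OF dec_not])

lemma dec_iff: "dec P \<Longrightarrow> dec Q \<Longrightarrow> dec (\<lambda>x. P x \<longleftrightarrow> Q x)"
  unfolding iff_conv_conj_imp by (rule dec_and[OF dec_imp dec_imp])

text \<open>The components do not exceed the code, so bounded quantifiers suffice to look them up in
  the two graphs.\<close>

lemma rec_pair:
  assumes "rec f" "rec g" shows "rec (\<lambda>x. \<langle>f x, g x\<rangle>)"
proof (rule rec_formula[where E = "two (graph f) (graph g)" and Q = "\<lambda>a b d. b = \<langle>f a, g a\<rangle>"])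
  have bq: "(b = \<langle>f a, g a\<rangle>) \<longleftrightarrow> (\<exists>u. u \<^bold>< b \<^bold>+ \<^bold>1 \<and> (\<exists>v. v \<^bold>< b \<^bold>+ \<^bold>1 \<and>
      b = \<langle>u, v\<rangle> \<and> u = f a \<and> v = g a))" for a b
    using pair_less_S by metis
  show "holds M (two (graph f) (graph g)) e (BEx 3 (Plus (Var 1) One) (BEx 4 (Plus (Var 1) One)
      (Conj (Eq (Var 1) (Npair (Var 3) (Var 4)))
        (Conj (Mem (Npair (Var 0) (Var 3)) 0) (Mem (Npair (Var 0) (Var 4)) 1))))) \<longleftrightarrow> e 1 = \<langle>f (e 0), g (e 0)\<rangle>" for e
    unfolding bq by (simp add: npair_def[symmetric])
qed (use assms in \<open>auto simp: rec_def\<close>)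

lemma pfst_eq: "b = pfst a \<longleftrightarrow> (\<exists>j. j \<^bold>< a \<^bold>+ \<^bold>1 \<and> a = \<langle>b, j\<rangle>) \<or>
    (b = \<^bold>0 \<and> \<not> (\<exists>i. i \<^bold>< a \<^bold>+ \<^bold>1 \<and> (\<exists>j. j \<^bold>< a \<^bold>+ \<^bold>1 \<and> a = \<langle>i, j\<rangle>)))"
proof (cases "is_pair a")
  case True
  then obtain i j where "a = \<langle>i, j\<rangle>" by (rule is_pairE)
  then show ?thesis by auto
next
  case False
  then show ?thesis by (auto simp: is_pair_def pfst_def)
qed

lemma psnd_eq: "b = psnd a \<longleftrightarrow> (\<exists>i. i \<^bold>< a \<^bold>+ \<^bold>1 \<and> a = \<langle>i, b\<rangle>) \<or>
    (b = \<^bold>0 \<and> \<not> (\<exists>i. i \<^bold>< a \<^bold>+ \<^bold>1 \<and> (\<exists>j. j \<^bold>< a \<^bold>+ \<^bold>1 \<and> a = \<langle>i, j\<rangle>)))"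
proof (cases "is_pair a")
  case True
  then obtain i j where "a = \<langle>i, j\<rangle>" by (rule is_pairE)
  then show ?thesis by auto
next
  case False
  then show ?thesis by (auto simp: is_pair_def psnd_def)
qed

lemma rec_pfst': "rec pfst"
proof -
  obtain S where S: "S \<in> \<U>" using univ_ne by auto
  have "holds M (\<lambda>_. S) e (Disj (BEx 3 (Plus (Var 0) One) (Eq (Var 0) (Npair (Var 1) (Var 3))))
        (Conj (Eq (Var 1) Zero)
          (Neg (BEx 3 (Plus (Var 0) One) (BEx 4 (Plus (Var 0) One) (Eq (Var 0) (Npair (Var 3) (Var 4)))))))) \<longleftrightarrow> e 1 = pfst (e 0)" for e
    unfolding pfst_eq by (simp add: npair_def)
  then show ?thesis
    by (rule rec_formula[rotated, where Q = "\<lambda>a b d. b = pfst a"]) (use S in auto)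
qed

lemma rec_psnd': "rec psnd"
proof -
  obtain S where S: "S \<in> \<U>" using univ_ne by auto
  have "holds M (\<lambda>_. S) e (Disj (BEx 3 (Plus (Var 0) One) (Eq (Var 0) (Npair (Var 3) (Var 1))))
        (Conj (Eq (Var 1) Zero)
          (Neg (BEx 3 (Plus (Var 0) One) (BEx 4 (Plus (Var 0) One) (Eq (Var 0) (Npair (Var 3) (Var 4)))))))) \<longleftrightarrow> e 1 = psnd (e 0)" for e
    unfolding psnd_eq by (simp add: npair_def)
  then show ?thesis
    by (rule rec_formula[rotated, where Q = "\<lambda>a b d. b = psnd a"]) (use S in auto)
qed

lemmas rec_pfst = rec_comp[OF rec_pfst']
lemmas rec_psnd = rec_comp[OF rec_psnd']

lemma rec2_comp: "rec (\<lambda>z. h (pfst z) (psnd z)) \<Longrightarrow> rec f \<Longrightarrow> rec g \<Longrightarrow> rec (\<lambda>x. h (f x) (g x))"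
  using rec_comp[OF _ rec_pair, of "\<lambda>z. h (pfst z) (psnd z)" f g] by simp

lemma dec2_comp: "dec (\<lambda>z. P (pfst z) (psnd z)) \<Longrightarrow> rec f \<Longrightarrow> rec g \<Longrightarrow> dec (\<lambda>x. P (f x) (g x))"
  using dec_comp[OF _ rec_pair, of "\<lambda>z. P (pfst z) (psnd z)" f g] by simp

text \<open>In formulas functions occur only as graphs. The two arguments are therefore packed into
  one and recovered by bounded quantifiers, as projections do not exceed their argument.\<close>

lemma rec_term:
  assumes t: "\<And>e. term_val M e t = h (e 3) (e 4)" and fg: "rec f" "rec g"
  shows "rec (\<lambda>x. h (f x) (g x))"
proof (rule rec2_comp[OF _ fg], rule rec_formula[where E = "two (graph pfst) (graph psnd)"
      and Q = "\<lambda>a b d. b = h (pfst a) (psnd a)"])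
  have bq: "(b = h (pfst a) (psnd a)) \<longleftrightarrow> (\<exists>u. u \<^bold>< a \<^bold>+ \<^bold>1 \<and> (\<exists>v. v \<^bold>< a \<^bold>+ \<^bold>1 \<and>
      b = h u v \<and> u = pfst a \<and> v = psnd a))" for a b
    using pfst_le psnd_le unfolding less_S_iff_le by metis
  show "holds M (two (graph pfst) (graph psnd)) e (BEx 3 (Plus (Var 0) One) (BEx 4 (Plus (Var 0) One)
      (Conj (Eq (Var 1) t)
        (Conj (Mem (Npair (Var 0) (Var 3)) 0) (Mem (Npair (Var 0) (Var 4)) 1))))) \<longleftrightarrow>
        e 1 = h (pfst (e 0)) (psnd (e 0))" for e
    unfolding bq by (simp add: t npair_def[symmetric])
qed (use rec_pfst' rec_psnd' in \<open>auto simp: rec_def\<close>)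

lemma rec_add: "rec f \<Longrightarrow> rec g \<Longrightarrow> rec (\<lambda>x. f x \<^bold>+ g x)"
  by (rule rec_term[where t = "Plus (Var 3) (Var 4)"]) auto

lemma rec_mul: "rec f \<Longrightarrow> rec g \<Longrightarrow> rec (\<lambda>x. f x \<^bold>* g x)"
  by (rule rec_term[where t = "Times (Var 3) (Var 4)"]) auto

lemma dec_atomic:
  assumes \<phi>: "\<And>E e. holds M E e \<phi> \<longleftrightarrow> P (e 0) (e 1)" and fg: "rec f" "rec g"
  shows "dec (\<lambda>x. P (f x) (g x))"
proof (rule dec2_comp[OF _ fg], rule dec_bounded[where E = "two (graph pfst) (graph psnd)"])
  have bq: "P (pfst a) (psnd a) \<longleftrightarrow> (\<exists>u. u \<^bold>< a \<^bold>+ \<^bold>1 \<and> (\<exists>v. v \<^bold>< a \<^bold>+ \<^bold>1 \<and>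
      P u v \<and> u = pfst a \<and> v = psnd a))" for a
    using pfst_le psnd_le unfolding less_S_iff_le by metis
  show "holds M (two (graph pfst) (graph psnd)) e (BEx 0 (Plus (Var 3) One) (BEx 1 (Plus (Var 3) One)
      (Conj \<phi>
        (Conj (Mem (Npair (Var 3) (Var 0)) 0) (Mem (Npair (Var 3) (Var 1)) 1))))) \<longleftrightarrow>
        P (pfst (e 3)) (psnd (e 3))" for e
    unfolding bq by (simp add: \<phi> npair_def[symmetric])
qed (use rec_pfst' rec_psnd' in \<open>auto simp: rec_def\<close>)

lemma dec_eq: "rec f \<Longrightarrow> rec g \<Longrightarrow> dec (\<lambda>x. f x = g x)"
  by (rule dec_atomic[where \<phi> = "Eq (Var 0) (Var 1)"]) auto

lemma dec_less: "rec f \<Longrightarrow> rec g \<Longrightarrow> dec (\<lambda>x. f x \<^bold>< g x)"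
  by (rule dec_atomic[where \<phi> = "Less (Var 0) (Var 1)"]) auto

lemma dec_le: "rec f \<Longrightarrow> rec g \<Longrightarrow> dec (\<lambda>x. f x \<^bold>\<le> g x)"
  unfolding num_le_def by (intro dec_or dec_less dec_eq)

lemma dec_mem: "A \<in> \<U> \<Longrightarrow> rec f \<Longrightarrow> dec (\<lambda>x. f x \<in> A)"
  using dec_comp[of "\<lambda>x. x \<in> A" f] by (simp add: dec_def)

lemma dec_const: "dec (\<lambda>x. c)"
  using dec_eq[OF rec_id rec_id] dec_not by (cases c) fastforce+

text \<open>The unbounded quantifier, in either form, first fetches the bound \<open>t x\<close>
  from the graph of \<open>t\<close>; then the inner quantifier is bounded by a variable.\<close>

lemma dec_bex:
  assumes t: "rec t" and P: "dec (\<lambda>z. P (pfst z) (psnd z))"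
  shows "dec (\<lambda>x. \<exists>y. y \<^bold>< t x \<and> P x y)"
proof -
  let ?A = "Collect (\<lambda>z. P (pfst z) (psnd z))"
  have A: "\<langle>x, y\<rangle> \<in> ?A \<longleftrightarrow> P x y" for x y by simp
  show ?thesis
    by (rule dec_formula[where E = "two ?A (graph t)" and
          Q = "\<lambda>a d. d = t a \<and> (\<exists>y. y \<^bold>< d \<and> P a y)" and Q' = "\<lambda>a d. d = t a \<longrightarrow> (\<exists>y. y \<^bold>< d \<and> P a y)" and
          \<theta> = "Conj (Mem (Npair (Var 3) (Var 4)) 1) (BEx 0 (Var 4) (Mem (Npair (Var 3) (Var 0)) 0))" and
          \<theta>' = "Imp (Mem (Npair (Var 3) (Var 4)) 1) (BEx 0 (Var 4) (Mem (Npair (Var 3) (Var 0)) 0))"])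
      (use t P in \<open>auto simp: rec_def dec_def npair_def[symmetric]\<close>)
qed

lemma dec_ball:
  assumes t: "rec t" and P: "dec (\<lambda>z. P (pfst z) (psnd z))"
  shows "dec (\<lambda>x. \<forall>y. y \<^bold>< t x \<longrightarrow> P x y)"
  using dec_not[OF dec_bex[OF t dec_not[OF P]]] by simp

lemma dec_bex_le:
  assumes t: "rec t" and P: "dec (\<lambda>z. P (pfst z) (psnd z))"
  shows "dec (\<lambda>x. \<exists>y. y \<^bold>\<le> t x \<and> P x y)"
  using dec_bex[OF rec_add[OF t rec_const], of P "\<^bold>1"] assms by (simp add: less_S_iff_le)

lemma dec_ball_le:
  assumes t: "rec t" and P: "dec (\<lambda>z. P (pfst z) (psnd z))"
  shows "dec (\<lambda>x. \<forall>y. y \<^bold>\<le> t x \<longrightarrow> P x y)"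
  using dec_not[OF dec_bex_le[OF t dec_not[OF P]]] by simp

text \<open>The formula-free version of \<open>rec_formula\<close>, for functions whose values are
  found by an unbounded search.\<close>

lemma recI_ex:
  assumes P: "dec (\<lambda>z. P (pfst (pfst z)) (psnd (pfst z)) (psnd z))"
    and f: "\<And>x y. y = f x \<longleftrightarrow> (\<exists>w. P x y w)"
  shows "rec f"
proof -
  let ?A = "Collect (\<lambda>z. P (pfst (pfst z)) (psnd (pfst z)) (psnd z))"
  have A: "\<langle>\<langle>x, y\<rangle>, w\<rangle> \<in> ?A \<longleftrightarrow> P x y w" for x y w by simp
  show ?thesis
    by (rule rec_formula[where E = "\<lambda>_. ?A" and Q = P and \<theta> = "Mem (Npair (Npair (Var 0) (Var 1)) (Var 2)) 0"])
      (use P f in \<open>auto simp: rec_def dec_def npair_def[symmetric]\<close>)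
qed

lemma recI: "dec (\<lambda>z. psnd z = f (pfst z)) \<Longrightarrow> rec f"
  using recI_ex[of "\<lambda>x y w. y = f x" f] dec_comp[OF _ rec_pfst'] by auto

lemma dec_rec: "rec f \<Longrightarrow> dec (\<lambda>z. psnd z = f (pfst z))"
  by (rule dec_eq[OF rec_psnd' rec_comp[OF _ rec_pfst']])

lemma rec_if:
  assumes "dec P" "rec f" "rec g" shows "rec (\<lambda>x. if P x then f x else g x)"
proof (rule recI)
  have eq: "psnd z = (if P (pfst z) then f (pfst z) else g (pfst z)) \<longleftrightarrow>
      (P (pfst z) \<and> psnd z = f (pfst z)) \<or> (\<not> P (pfst z) \<and> psnd z = g (pfst z))" for z
    by simp
  show "dec (\<lambda>z. psnd z = (if P (pfst z) then f (pfst z) else g (pfst z)))"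
    unfolding eq by (intro dec_and dec_or dec_not dec_rec dec_comp[OF assms(1)] assms rec_pfst rec_id)
qed

lemma dec_if: "dec P \<Longrightarrow> dec Q \<Longrightarrow> dec R \<Longrightarrow> dec (\<lambda>x. if P x then Q x else R x)"
  unfolding if_bool_eq_conj by (intro dec_and dec_imp dec_not)

text \<open>As introduction rules these follow the syntax of a predicate or function; later
  membership proofs are derivations from them.\<close>

lemmas rec_basic = rec_id rec_const rec_pfst rec_psnd rec_pair rec_add rec_mul rec_if
  dec_eq dec_less dec_le dec_and dec_or dec_not dec_imp dec_iff dec_const dec_if
  dec_bex dec_ball dec_bex_le dec_ball_le

lemma rec_sub: assumes "rec f" "rec g" shows "rec (\<lambda>x. f x \<^bold>- g x)"
proof (rule rec2_comp[of num_sub, OF _ assms])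
  show "rec (\<lambda>z. pfst z \<^bold>- psnd z)"
  proof (rule recI)
    have "y = a \<^bold>- b \<longleftrightarrow> a = b \<^bold>+ y \<or> (a \<^bold>< b \<and> y = \<^bold>0)" for y a b
      using add_sub[of b a] add_sub_cancel[of b y] by (auto simp: num_sub_def num.not_le)
    then show "dec (\<lambda>z. psnd z = pfst (pfst z) \<^bold>- psnd (pfst z))"
      by (simp) (intro rec_basic)
  qed
qed

section \<open>Induction and least elements for predicates of the structure\<close>

text \<open>The pairs satisfying \<open>P\<close> form a set of the structure, which serves as a set
  parameter: one atomic membership formula stands for \<open>P\<close>.\<close>

lemma sigma_induct:
  assumes P: "dec (\<lambda>z. P (pfst z) (psnd z))"
    and base: "\<exists>y. P \<^bold>0 y" and step: "\<And>x y. P x y \<Longrightarrow> \<exists>y. P (x \<^bold>+ \<^bold>1) y"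
  shows "\<exists>y. P n y"
proof -
  let ?A = "Collect (\<lambda>z. P (pfst z) (psnd z))"
  show ?thesis
    by (rule formula_sigma_induct[where E = "\<lambda>_. ?A" and Q = P and \<theta> = "Mem (Npair (Var 0) (Var 1)) 0"])
      (use P base step in \<open>auto simp: dec_def npair_def[symmetric]\<close>)
qed

lemma dec_induct [case_names dec zero S]:
  assumes P: "dec P" and "P \<^bold>0" "\<And>n. P n \<Longrightarrow> P (n \<^bold>+ \<^bold>1)"
  shows "P n"
  using sigma_induct[of "\<lambda>x _. P x" n] dec_comp[OF P rec_pfst'] assms by auto

text \<open>Strong induction on the negation would be Pi^0_1. Instead, without a least element one
  can descend forever, and "some \<open>k < m + 1 - x\<close> satisfies \<open>P\<close>" is a
  Sigma^0_1 statement, proved by induction on \<open>x\<close>. For \<open>x = m + 1\<close> the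
  bound is 0.\<close>

lemma sigma_least:
  assumes P: "dec (\<lambda>z. P (pfst z) (psnd z))" and ex: "P m y"
  shows "\<exists>n y. P n y \<and> (\<forall>k y. k \<^bold>< n \<longrightarrow> \<not> P k y)"
proof (rule ccontr)
  assume none: "\<not> ?thesis"
  have "\<exists>w. \<exists>k. k \<^bold>< m \<^bold>+ \<^bold>1 \<^bold>- x \<and> P k w" for x
  proof (rule sigma_induct[where P = "\<lambda>x w. \<exists>k. k \<^bold>< m \<^bold>+ \<^bold>1 \<^bold>- x \<and> P k w"])
    show "dec (\<lambda>z. \<exists>k. k \<^bold>< m \<^bold>+ \<^bold>1 \<^bold>- pfst z \<and> P k (psnd z))"
      by (intro rec_basic rec_sub dec2_comp[OF P])
    show "\<exists>w k. k \<^bold>< m \<^bold>+ \<^bold>1 \<^bold>- \<^bold>0 \<and> P k w"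
      using ex self_less_S[of m] unfolding num.diff_zero by blast
    fix x w assume "\<exists>k. k \<^bold>< m \<^bold>+ \<^bold>1 \<^bold>- x \<and> P k w"
    then obtain k where k: "k \<^bold>< m \<^bold>+ \<^bold>1 \<^bold>- x" "P k w" by auto
    with none obtain k' w' where k': "k' \<^bold>< k" "P k' w'" by blast
    have "k' \<^bold>+ \<^bold>1 \<^bold>< m \<^bold>+ \<^bold>1 \<^bold>- x"
      using k k' S_le_iff_less num.le_less_trans by metis
    then obtain d where d: "m \<^bold>+ \<^bold>1 \<^bold>- x = k' \<^bold>+ \<^bold>1 \<^bold>+ d \<^bold>+ \<^bold>1" unfolding less_iff by auto
    have "k' \<^bold>+ \<^bold>1 \<^bold>+ d \<^bold>+ \<^bold>1 = \<^bold>1 \<^bold>+ (k' \<^bold>+ d \<^bold>+ \<^bold>1)" by (simp only: add_acs)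
    then have "m \<^bold>+ \<^bold>1 \<^bold>- (x \<^bold>+ \<^bold>1) = k' \<^bold>+ d \<^bold>+ \<^bold>1"
      using d add_sub_cancel unfolding sub_sub[symmetric] by metis
    then have "k' \<^bold>< m \<^bold>+ \<^bold>1 \<^bold>- (x \<^bold>+ \<^bold>1)" unfolding less_iff by blast
    with k' show "\<exists>w k. k \<^bold>< m \<^bold>+ \<^bold>1 \<^bold>- (x \<^bold>+ \<^bold>1) \<and> P k w" by blast
  qed
  from this[of "m \<^bold>+ \<^bold>1"] show False by simp
qed

lemma dec_least:
  assumes P: "dec P" and ex: "P m"
  shows "\<exists>n. P n \<and> (\<forall>k. k \<^bold>< n \<longrightarrow> \<not> P k)"
  using sigma_least[of "\<lambda>x _. P x" m] dec_comp[OF P rec_pfst'] ex by auto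

end

subsection \<open>Codes of finite sets and sequences\<close>

context rca0 begin

section \<open>Divisibility and pairwise coprime moduli\<close>

lemma ndvd_refl [simp]: "ndvd M A A" and ndvd_mult [simp]: "ndvd M A (A \<^bold>* X)" "ndvd M A (X \<^bold>* A)"
  unfolding ndvd_def using one_mul mul_comm by metis+

lemma ndvd_trans: "ndvd M A X \<Longrightarrow> ndvd M X Y \<Longrightarrow> ndvd M A Y"
  unfolding ndvd_def using mul_assoc by metis

lemma ndvd_add_cancel: "ndvd M A (X \<^bold>+ Y) \<Longrightarrow> ndvd M A X \<Longrightarrow> ndvd M A Y"
  unfolding ndvd_def by (metis num.add_diff_cancel_left' num.right_diff_distrib')

lemma dec_ndvd: assumes "rec f" "rec g" shows "dec (\<lambda>x. ndvd M (f x) (g x))"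
proof -
  have "ndvd M d n \<longleftrightarrow> (\<exists>q. q \<^bold>\<le> n \<and> n = d \<^bold>* q)" for d n
  proof
    assume "ndvd M d n"
    then obtain q where q: "n = d \<^bold>* q" by (auto simp: ndvd_def)
    show "\<exists>q. q \<^bold>\<le> n \<and> n = d \<^bold>* q"
    proof (cases "d = \<^bold>0")
      \<comment> \<open>For \<open>d = 0\<close> the given quotient may exceed \<open>n\<close>, but
        then \<open>n = 0\<close> and the quotient 0 works too.\<close>
      case True
      then show ?thesis using q by (intro exI[of _ "\<^bold>0"]) simp
    next
      case False
      then obtain e where "d = e \<^bold>+ \<^bold>1" using zero_or_S by blast
      with q have "q \<^bold>\<le> n" by (simp add: S_mul)
      with q show ?thesis by blast
    qed
  qed (auto simp: ndvd_def)
  then show ?thesis using assms by (simp, intro rec_basic rec_comp[OF assms(1)] rec_comp[OF assms(2)])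
qed

text \<open>Both moduli are congruent to \<open>1\<close> modulo \<open>m\<close>, and their difference \<open>m d\<close> divides \<open>m\<^sup>2\<close>.\<close>
lemma beta_moduli_coprime:
  assumes A: "A = m \<^bold>* (i \<^bold>+ \<^bold>1) \<^bold>+ \<^bold>1" and B: "B = m \<^bold>* (j \<^bold>+ \<^bold>1) \<^bold>+ \<^bold>1"
    and d: "j = i \<^bold>+ d \<or> i = j \<^bold>+ d" "ndvd M d m" and nB: "ndvd M A (n \<^bold>* B)"
  shows "ndvd M A n"
proof -
  have "B = A \<^bold>+ m \<^bold>* d \<or> A = B \<^bold>+ m \<^bold>* d"
    unfolding A B using d(1) by (auto simp: mul_add add_acs)
  then have "n \<^bold>* B = n \<^bold>* A \<^bold>+ n \<^bold>* (m \<^bold>* d) \<or> n \<^bold>* A = n \<^bold>* B \<^bold>+ n \<^bold>* (m \<^bold>* d)"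
    by (auto simp: mul_add)
  then have nmd: "ndvd M A (n \<^bold>* (m \<^bold>* d))"
    using nB ndvd_add_cancel ndvd_mult by metis
  obtain e where e: "m = d \<^bold>* e" using d(2) by (auto simp: ndvd_def)
  \<comment> \<open>\<open>A\<close> is \<open>x + 1\<close>. Hence a divisor \<open>A\<close> of
    \<open>n * x * x\<close> divides \<open>n * x\<close>, because it divides
    \<open>n * x * A\<close>; the same argument leads from \<open>n * x\<close> to
    \<open>n\<close>.\<close>
  define x where "x = m \<^bold>* (i \<^bold>+ \<^bold>1)"
  have "n \<^bold>* x \<^bold>* x = n \<^bold>* (m \<^bold>* d) \<^bold>* (e \<^bold>* (i \<^bold>+ \<^bold>1) \<^bold>* (i \<^bold>+ \<^bold>1))"
    unfolding x_def using e by (metis (no_types, lifting) mul_assoc mul_comm)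
  then have "ndvd M A (n \<^bold>* x \<^bold>* x)" using nmd ndvd_trans ndvd_mult by metis
  moreover have "n \<^bold>* x \<^bold>* A = n \<^bold>* x \<^bold>* x \<^bold>+ n \<^bold>* x" by (simp add: A x_def mul_add)
  ultimately have "ndvd M A (n \<^bold>* x)" using ndvd_add_cancel ndvd_mult by metis
  moreover have "n \<^bold>* A = n \<^bold>* x \<^bold>+ n" by (simp add: A x_def mul_add)
  ultimately show ?thesis using ndvd_add_cancel ndvd_mult by metis
qed

text \<open>The witness is in effect the factorial of \<open>k\<close>. It is built by Sigma^0_1
  induction because primitive recursion is only obtained later, from the coding that needs this
  number.\<close>

lemma common_multiple: "\<exists>m. m \<noteq> \<^bold>0 \<and> (\<forall>d. d \<^bold>< k \<longrightarrow> ndvd M (d \<^bold>+ \<^bold>1) m)"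
proof (rule sigma_induct[where P = "\<lambda>k m. m \<noteq> \<^bold>0 \<and> (\<forall>d. d \<^bold>< k \<longrightarrow> ndvd M (d \<^bold>+ \<^bold>1) m)"])
  show "dec (\<lambda>z. psnd z \<noteq> \<^bold>0 \<and> (\<forall>d. d \<^bold>< pfst z \<longrightarrow> ndvd M (d \<^bold>+ \<^bold>1) (psnd z)))"
    by (intro rec_basic dec_ndvd)
  show "\<exists>m. m \<noteq> \<^bold>0 \<and> (\<forall>d. d \<^bold>< \<^bold>0 \<longrightarrow> ndvd M (d \<^bold>+ \<^bold>1) m)"
    by (intro exI[of _ "\<^bold>1"]) simp
  fix k m assume m: "m \<noteq> \<^bold>0 \<and> (\<forall>d. d \<^bold>< k \<longrightarrow> ndvd M (d \<^bold>+ \<^bold>1) m)"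
  show "\<exists>m. m \<noteq> \<^bold>0 \<and> (\<forall>d. d \<^bold>< k \<^bold>+ \<^bold>1 \<longrightarrow> ndvd M (d \<^bold>+ \<^bold>1) m)"
    using m ndvd_trans[OF _ ndvd_mult(1)] by (intro exI[of _ "m \<^bold>* (k \<^bold>+ \<^bold>1)"]) (auto simp: less_S)
qed

text \<open>The witness is the product of the moduli for those \<open>i < j\<close> that satisfy
  \<open>P\<close>. The bound \<open>k\<close> is kept apart from \<open>j\<close> so that
  \<open>m\<close>, and with it all moduli, stay fixed while the product grows; coprimality leaves
  the other divisibilities unchanged.\<close>

lemma beta_product:
  assumes P: "dec P" and m: "m \<noteq> \<^bold>0" "\<And>d. d \<^bold>< k \<Longrightarrow> ndvd M (d \<^bold>+ \<^bold>1) m"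
  shows "\<exists>n. \<forall>i. i \<^bold>< k \<longrightarrow> (ndvd M (m \<^bold>* (i \<^bold>+ \<^bold>1) \<^bold>+ \<^bold>1) n \<longleftrightarrow> i \<^bold>< j \<and> P i)"
proof (rule sigma_induct[where P = "\<lambda>j n. \<forall>i. i \<^bold>< k \<longrightarrow> (ndvd M (m \<^bold>* (i \<^bold>+ \<^bold>1) \<^bold>+ \<^bold>1) n \<longleftrightarrow> i \<^bold>< j \<and> P i)"])
  show "dec (\<lambda>z. \<forall>i. i \<^bold>< k \<longrightarrow> (ndvd M (m \<^bold>* (i \<^bold>+ \<^bold>1) \<^bold>+ \<^bold>1) (psnd z) \<longleftrightarrow> i \<^bold>< pfst z \<and> P i))"
    by (intro rec_basic dec_ndvd dec_comp[OF P])
  \<comment> \<open>The empty product is 1, and no modulus divides it, because \<open>m\<close> is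
    nonzero.\<close>
  have "\<not> ndvd M (m \<^bold>* (i \<^bold>+ \<^bold>1) \<^bold>+ \<^bold>1) \<^bold>1" for i
  proof
    assume "ndvd M (m \<^bold>* (i \<^bold>+ \<^bold>1) \<^bold>+ \<^bold>1) \<^bold>1"
    then obtain q where q: "\<^bold>1 = (m \<^bold>* (i \<^bold>+ \<^bold>1) \<^bold>+ \<^bold>1) \<^bold>* q" by (auto simp: ndvd_def)
    then have "q \<noteq> \<^bold>0" using num.one_neq_zero by auto
    then obtain r where "q = r \<^bold>+ \<^bold>1" using zero_or_S by blast
    with q have "\<^bold>0 \<^bold>+ \<^bold>1 = (m \<^bold>* (i \<^bold>+ \<^bold>1) \<^bold>+ \<^bold>1) \<^bold>* r \<^bold>+ m \<^bold>* (i \<^bold>+ \<^bold>1) \<^bold>+ \<^bold>1"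
      by (simp add: mul_S add_S)
    from S_inj[OF this[symmetric]] show False using m(1) by (simp add: mul_S)
  qed
  then show "\<exists>n. \<forall>i. i \<^bold>< k \<longrightarrow> (ndvd M (m \<^bold>* (i \<^bold>+ \<^bold>1) \<^bold>+ \<^bold>1) n \<longleftrightarrow> i \<^bold>< \<^bold>0 \<and> P i)" by auto
  fix x n assume n: "\<forall>i. i \<^bold>< k \<longrightarrow> (ndvd M (m \<^bold>* (i \<^bold>+ \<^bold>1) \<^bold>+ \<^bold>1) n \<longleftrightarrow> i \<^bold>< x \<and> P i)"
  show "\<exists>n. \<forall>i. i \<^bold>< k \<longrightarrow> (ndvd M (m \<^bold>* (i \<^bold>+ \<^bold>1) \<^bold>+ \<^bold>1) n \<longleftrightarrow> i \<^bold>< x \<^bold>+ \<^bold>1 \<and> P i)"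
  proof (cases "x \<^bold>< k \<and> P x")
    case False
    then show ?thesis using n less_S by blast
  next
    case True
    let ?B = "m \<^bold>* (x \<^bold>+ \<^bold>1) \<^bold>+ \<^bold>1"
    have "ndvd M (m \<^bold>* (i \<^bold>+ \<^bold>1) \<^bold>+ \<^bold>1) (n \<^bold>* ?B) \<longleftrightarrow> i \<^bold>< x \<^bold>+ \<^bold>1 \<and> P i" if i: "i \<^bold>< k" for i
    proof (cases "i = x")
      case True
      then show ?thesis using \<open>x \<^bold>< k \<and> P x\<close> by simp
    next
      case False
      then obtain d where d: "x = i \<^bold>+ (d \<^bold>+ \<^bold>1) \<or> i = x \<^bold>+ (d \<^bold>+ \<^bold>1)"
        using less_total[of i x] less_iff add_assoc by metis
      \<comment> \<open>The distance of two indices is at most the larger one, hence below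
        \<open>k\<close>, and so divides \<open>m\<close>.\<close>
      then have "d \<^bold>+ \<^bold>1 \<^bold>\<le> i \<or> d \<^bold>+ \<^bold>1 \<^bold>\<le> x" using le_add(2) by metis
      then have "d \<^bold>< k" using i True num.less_trans S_le_iff_less by metis
      then have "ndvd M (d \<^bold>+ \<^bold>1) m" by (rule m(2))
      with d have "ndvd M (m \<^bold>* (i \<^bold>+ \<^bold>1) \<^bold>+ \<^bold>1) (n \<^bold>* ?B) \<longleftrightarrow> ndvd M (m \<^bold>* (i \<^bold>+ \<^bold>1) \<^bold>+ \<^bold>1) n"
        using beta_moduli_coprime[OF refl refl] ndvd_trans ndvd_mult(1) by blast
      then show ?thesis using False i n by (simp add: less_S)
    qed
    then show ?thesis by blast
  qed
qed

section \<open>Codes of finite sets\<close>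

lemma is_pair_iff: "is_pair z \<longleftrightarrow> z = \<langle>pfst z, psnd z\<rangle>"
  by (metis is_pair_def pfst_pair psnd_pair)

lemma dec_is_pair: "rec f \<Longrightarrow> dec (\<lambda>x. is_pair (f x))"
  unfolding is_pair_iff by (intro rec_basic)

lemma is_triple_iff: "is_triple M c \<longleftrightarrow> is_pair c \<and> is_pair (psnd c)"
  by (auto simp: is_triple_def is_pair_def)

lemma dec_is_triple: "rec f \<Longrightarrow> dec (\<lambda>x. is_triple M (f x))"
  unfolding is_triple_iff by (intro rec_basic dec_is_pair)

lemma code_mem_iff: "code_mem M i c \<longleftrightarrow> is_triple M c \<and> i \<^bold>< pfst c \<and>
    ndvd M (pfst (psnd c) \<^bold>* (i \<^bold>+ \<^bold>1) \<^bold>+ \<^bold>1) (psnd (psnd c))"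
  by (auto simp: code_mem_def is_triple_def)

lemma code_mem_triple: "code_mem M i \<langle>k, \<langle>m, n\<rangle>\<rangle> \<longleftrightarrow> i \<^bold>< k \<and> ndvd M (m \<^bold>* (i \<^bold>+ \<^bold>1) \<^bold>+ \<^bold>1) n"
  by (simp add: code_mem_iff is_triple_iff)

text \<open>Quantifiers over the members of a code can thus be bounded by the code, which makes
  statements about it decidable.\<close>

lemma code_mem_less: "code_mem M i c \<Longrightarrow> i \<^bold>< c"
  unfolding code_mem_iff using pfst_le num.less_le_trans by blast

lemma dec_code_mem: "rec f \<Longrightarrow> rec g \<Longrightarrow> dec (\<lambda>x. code_mem M (f x) (g x))"
  unfolding code_mem_iff by (intro rec_basic dec_is_triple dec_ndvd)

lemma triple_exists:
  assumes P: "dec P" shows "\<exists>c. is_triple M c \<and> (\<forall>i. code_mem M i c \<longleftrightarrow> i \<^bold>< k \<and> P i)"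
proof -
  obtain m where m: "m \<noteq> \<^bold>0" "\<And>d. d \<^bold>< k \<Longrightarrow> ndvd M (d \<^bold>+ \<^bold>1) m"
    using common_multiple by blast
  from beta_product[OF P m, of k] obtain n where
    "\<forall>i. i \<^bold>< k \<longrightarrow> (ndvd M (m \<^bold>* (i \<^bold>+ \<^bold>1) \<^bold>+ \<^bold>1) n \<longleftrightarrow> i \<^bold>< k \<and> P i)" by blast
  then show ?thesis
    by (intro exI[of _ "\<langle>k, \<langle>m, n\<rangle>\<rangle>"]) (auto simp: code_mem_triple is_triple_iff)
qed

lemma finset_code_exists:
  assumes P: "dec P" shows "\<exists>c. is_finset_code M c \<and> (\<forall>i. code_mem M i c \<longleftrightarrow> i \<^bold>< k \<and> P i)"
proof -
  \<comment> \<open>From \<open>c + k\<close> on both sides of the equivalence are false, so the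
    bound loses nothing; it makes \<open>?Q\<close> decidable and a least triple available.\<close>
  let ?Q = "\<lambda>c. is_triple M c \<and> (\<forall>i. i \<^bold>< c \<^bold>+ k \<longrightarrow> (code_mem M i c \<longleftrightarrow> i \<^bold>< k \<and> P i))"
  have Q: "?Q c \<longleftrightarrow> is_triple M c \<and> (\<forall>i. code_mem M i c \<longleftrightarrow> i \<^bold>< k \<and> P i)" for c
    using code_mem_less num.less_le_trans[OF _ le_add(1)] num.less_le_trans[OF _ le_add(2)] by blast
  obtain c where c: "?Q c" using triple_exists[OF P, of k] unfolding Q by blast
  have "dec ?Q" by (intro rec_basic dec_is_triple dec_code_mem dec_comp[OF P])
  from dec_least[OF this, of c] c obtain c where c: "?Q c" "\<And>c'. c' \<^bold>< c \<Longrightarrow> \<not> ?Q c'" by blast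
  then show ?thesis unfolding Q is_finset_code_def by (intro exI[of _ c]) blast
qed

lemma finset_code_unique:
  assumes "is_finset_code M c" "is_finset_code M c'" "\<And>i. code_mem M i c \<longleftrightarrow> code_mem M i c'"
  shows "c = c'"
  using assms less_total[of c c'] unfolding is_finset_code_def by blast

text \<open>Only competing triples below \<open>c\<close> matter, and their members lie below
  \<open>c\<close> as well.\<close>

lemma dec_is_finset_code: assumes "rec f" shows "dec (\<lambda>x. is_finset_code M (f x))"
proof -
  have "is_finset_code M c \<longleftrightarrow> is_triple M c \<and> (\<forall>c'. c' \<^bold>< c \<longrightarrow> is_triple M c' \<longrightarrow>
      \<not> (\<forall>i. i \<^bold>< c \<longrightarrow> (code_mem M i c' \<longleftrightarrow> code_mem M i c)))" for c
    unfolding is_finset_code_def using code_mem_less num.less_trans by blast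
  then show ?thesis
    by (simp only:) (intro rec_basic dec_is_triple dec_code_mem rec_comp[OF assms] assms)
qed

section \<open>Codes of finite sequences\<close>

lemma entry_less: "entry M s j v \<Longrightarrow> j \<^bold>< s" "entry M s j v \<Longrightarrow> v \<^bold>< s"
  unfolding entry_def using code_mem_less pair_ge num.le_less_trans by blast+

lemma dec_entry: "rec f \<Longrightarrow> rec g \<Longrightarrow> rec h \<Longrightarrow> dec (\<lambda>x. entry M (f x) (g x) (h x))"
  unfolding entry_def by (intro rec_basic dec_code_mem)

lemma dec_is_seq: assumes "rec f" "rec g" shows "dec (\<lambda>x. is_seq M (f x) (g x))"
proof (rule dec2_comp[OF _ assms])
  have "is_seq M s l \<longleftrightarrow> is_finset_code M s \<and>
     (\<forall>i. i \<^bold>< s \<longrightarrow> code_mem M i s \<longrightarrow> is_pair i \<and> pfst i \<^bold>< l) \<and>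
     (\<forall>j. j \<^bold>< l \<longrightarrow> (\<exists>v. v \<^bold>< s \<and> entry M s j v) \<and>
        (\<forall>v. v \<^bold>< s \<longrightarrow> (\<forall>v'. v' \<^bold>< s \<longrightarrow> entry M s j v \<longrightarrow> entry M s j v' \<longrightarrow> v = v')))" for s l
  proof -
    have "(\<exists>j v. i = \<langle>j, v\<rangle> \<and> j \<^bold>< l) \<longleftrightarrow> is_pair i \<and> pfst i \<^bold>< l" for i
      by (auto simp: is_pair_def)
    then have A: "(\<forall>i. code_mem M i s \<longrightarrow> (\<exists>j v. i = \<langle>j, v\<rangle> \<and> j \<^bold>< l)) \<longleftrightarrow>
        (\<forall>i. i \<^bold>< s \<longrightarrow> code_mem M i s \<longrightarrow> is_pair i \<and> pfst i \<^bold>< l)"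
      using code_mem_less by auto
    have B: "(\<exists>!v. entry M s j v) \<longleftrightarrow> (\<exists>v. v \<^bold>< s \<and> entry M s j v) \<and>
        (\<forall>v. v \<^bold>< s \<longrightarrow> (\<forall>v'. v' \<^bold>< s \<longrightarrow> entry M s j v \<longrightarrow> entry M s j v' \<longrightarrow> v = v'))" for j
      using entry_less(2)[of s j] by blast
    show ?thesis unfolding is_seq_def A B ..
  qed
  then show "dec (\<lambda>z. is_seq M (pfst z) (psnd z))"
    by (simp only:) (intro rec_basic dec_is_finset_code dec_code_mem dec_entry dec_is_pair)
qed

text \<open>A bounding principle: it places the entries of a sequence below one number, as the code
  of a finite set requires.\<close>

lemma rec_bounded:
  assumes f: "rec f" shows "\<exists>b. \<forall>j. j \<^bold>< l \<longrightarrow> f j \<^bold>< b"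
proof (rule sigma_induct[where P = "\<lambda>l b. \<forall>j. j \<^bold>< l \<longrightarrow> f j \<^bold>< b"])
  show "dec (\<lambda>z. \<forall>j. j \<^bold>< pfst z \<longrightarrow> f j \<^bold>< psnd z)"
    by (intro rec_basic rec_comp[OF f])
  fix l b assume b: "\<forall>j. j \<^bold>< l \<longrightarrow> f j \<^bold>< b"
  have "j \<^bold>< l \<^bold>+ \<^bold>1 \<Longrightarrow> f j \<^bold>< b \<^bold>+ (f l \<^bold>+ \<^bold>1)" for j
    using b num.less_le_trans[OF _ le_add(1), of "f j" b "f l \<^bold>+ \<^bold>1"]
      num.less_le_trans[OF self_less_S le_add(2), of "f l" b] by (auto simp: less_S)
  then show "\<exists>b. \<forall>j. j \<^bold>< l \<^bold>+ \<^bold>1 \<longrightarrow> f j \<^bold>< b" by blast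
qed simp

lemma seq_exists:
  assumes f: "rec f" shows "\<exists>s. is_seq M s l \<and> (\<forall>j v. entry M s j v \<longleftrightarrow> j \<^bold>< l \<and> v = f j)"
proof -
  obtain b where b: "\<And>j. j \<^bold>< l \<Longrightarrow> f j \<^bold>< b" using rec_bounded[OF f] by blast
  let ?P = "\<lambda>i. is_pair i \<and> pfst i \<^bold>< l \<and> psnd i = f (pfst i)"
  have "dec ?P" by (intro rec_basic dec_is_pair rec_comp[OF f])
  \<comment> \<open>By monotonicity of pairing all pairs of a position below \<open>l\<close> and
    its value lie below this bound.\<close>
  from finset_code_exists[OF this, of "\<langle>l, b\<rangle> \<^bold>+ \<^bold>1"] obtain s where
    s: "is_finset_code M s" "\<And>i. code_mem M i s \<longleftrightarrow> i \<^bold>< \<langle>l, b\<rangle> \<^bold>+ \<^bold>1 \<and> ?P i" by blast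
  have "\<langle>j, f j\<rangle> \<^bold>< \<langle>l, b\<rangle> \<^bold>+ \<^bold>1" if "j \<^bold>< l" for j
    unfolding less_S_iff_le using b[OF that] that by (intro pair_mono num.less_imp_le)
  then have e: "entry M s j v \<longleftrightarrow> j \<^bold>< l \<and> v = f j" for j v
    unfolding entry_def s(2) by auto
  have "is_seq M s l"
    unfolding is_seq_def e using s by (auto simp: is_pair_def)
  with e show ?thesis by blast
qed

end

subsection \<open>Primitive recursion\<close>

context rca0 begin

text \<open>\<open>c\<close> codes the course of values up to \<open>n\<close> of the recursion with start \<open>f x\<close> and step \<open>g\<close>.\<close>
definition trace :: "('a \<Rightarrow> 'a) \<Rightarrow> ('a \<Rightarrow> 'a) \<Rightarrow> 'a \<Rightarrow> 'a \<Rightarrow> 'a \<Rightarrow> bool" where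
  "trace f g x n c \<longleftrightarrow> code_mem M \<langle>\<^bold>0, f x\<rangle> c \<and>
     (\<forall>i. i \<^bold>\<le> n \<longrightarrow> (\<forall>u. u \<^bold>< c \<longrightarrow> (\<forall>v. v \<^bold>< c \<longrightarrow>
        code_mem M \<langle>i, u\<rangle> c \<longrightarrow> code_mem M \<langle>i, v\<rangle> c \<longrightarrow> u = v))) \<and>
     (\<forall>i. i \<^bold>< n \<longrightarrow> (\<forall>u. u \<^bold>< c \<longrightarrow> code_mem M \<langle>i, u\<rangle> c \<longrightarrow> code_mem M \<langle>i \<^bold>+ \<^bold>1, g \<langle>x, \<langle>i, u\<rangle>\<rangle>\<rangle> c))"

text \<open>The step function receives the parameter, the stage and the previous value in one
  argument, since \<open>rec\<close> speaks of unary functions.\<close>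

definition prec :: "('a \<Rightarrow> 'a) \<Rightarrow> ('a \<Rightarrow> 'a) \<Rightarrow> 'a \<Rightarrow> 'a \<Rightarrow> 'a" where
  "prec f g x n = (THE u. \<exists>c. trace f g x n c \<and> code_mem M \<langle>n, u\<rangle> c)"

lemma code_mem_pair_less: "code_mem M \<langle>i, u\<rangle> c \<Longrightarrow> u \<^bold>< c"
  using code_mem_less num.le_less_trans pair_ge(2) by blast

context
  fixes f g :: "'a \<Rightarrow> 'a"
  assumes f: "rec f" and g: "rec g"
begin

lemma dec_trace:
  assumes "rec a" "rec b" "rec c" shows "dec (\<lambda>x. trace f g (a x) (b x) (c x))"
  unfolding trace_def
  by (intro assms rec_basic dec_code_mem rec_comp[OF f] rec_comp[OF g] rec_comp[OF assms(1)]
      rec_comp[OF assms(2)] rec_comp[OF assms(3)])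

lemma trace_start: "trace f g x n c \<Longrightarrow> code_mem M \<langle>\<^bold>0, f x\<rangle> c"
  by (simp add: trace_def)

lemma trace_fun: "trace f g x n c \<Longrightarrow> i \<^bold>\<le> n \<Longrightarrow> code_mem M \<langle>i, u\<rangle> c \<Longrightarrow> code_mem M \<langle>i, v\<rangle> c \<Longrightarrow> u = v"
  using code_mem_pair_less[of i u c] code_mem_pair_less[of i v c] unfolding trace_def by blast

lemma trace_step: "trace f g x n c \<Longrightarrow> i \<^bold>< n \<Longrightarrow> code_mem M \<langle>i, u\<rangle> c \<Longrightarrow> code_mem M \<langle>i \<^bold>+ \<^bold>1, g \<langle>x, \<langle>i, u\<rangle>\<rangle>\<rangle> c"
  using code_mem_pair_less[of i u c] unfolding trace_def by blast

lemma traceI: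
  assumes "code_mem M \<langle>\<^bold>0, f x\<rangle> c"
    and "\<And>i u v. i \<^bold>\<le> n \<Longrightarrow> code_mem M \<langle>i, u\<rangle> c \<Longrightarrow> code_mem M \<langle>i, v\<rangle> c \<Longrightarrow> u = v"
    and "\<And>i u. i \<^bold>< n \<Longrightarrow> code_mem M \<langle>i, u\<rangle> c \<Longrightarrow> code_mem M \<langle>i \<^bold>+ \<^bold>1, g \<langle>x, \<langle>i, u\<rangle>\<rangle>\<rangle> c"
  shows "trace f g x n c"
  unfolding trace_def using assms by (intro conjI allI impI)

text \<open>Agreement is stated as the existence of a common entry, bounded by \<open>c\<close> to
  stay decidable. It gives uniqueness across traces and, for two equal traces, the existence of an
  entry at each stage.\<close>

lemma trace_common:
  assumes c: "trace f g x n c" "trace f g x n' c'"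
  shows "i \<^bold>\<le> n \<and> i \<^bold>\<le> n' \<longrightarrow> (\<exists>w. w \<^bold>< c \<and> code_mem M \<langle>i, w\<rangle> c \<and> code_mem M \<langle>i, w\<rangle> c')"
proof (induction i rule: dec_induct)
  show "dec (\<lambda>i. i \<^bold>\<le> n \<and> i \<^bold>\<le> n' \<longrightarrow> (\<exists>w. w \<^bold>< c \<and> code_mem M \<langle>i, w\<rangle> c \<and> code_mem M \<langle>i, w\<rangle> c'))"
    by (intro rec_basic dec_code_mem)
  show "\<^bold>0 \<^bold>\<le> n \<and> \<^bold>0 \<^bold>\<le> n' \<longrightarrow> (\<exists>w. w \<^bold>< c \<and> code_mem M \<langle>\<^bold>0, w\<rangle> c \<and> code_mem M \<langle>\<^bold>0, w\<rangle> c')"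
    using trace_start[OF c(1)] trace_start[OF c(2)] code_mem_pair_less by blast
  fix i assume IH: "i \<^bold>\<le> n \<and> i \<^bold>\<le> n' \<longrightarrow> (\<exists>w. w \<^bold>< c \<and> code_mem M \<langle>i, w\<rangle> c \<and> code_mem M \<langle>i, w\<rangle> c')"
  then show "i \<^bold>+ \<^bold>1 \<^bold>\<le> n \<and> i \<^bold>+ \<^bold>1 \<^bold>\<le> n' \<longrightarrow>
      (\<exists>w. w \<^bold>< c \<and> code_mem M \<langle>i \<^bold>+ \<^bold>1, w\<rangle> c \<and> code_mem M \<langle>i \<^bold>+ \<^bold>1, w\<rangle> c')"
    unfolding S_le_iff_less using trace_step[OF c(1)] trace_step[OF c(2)] code_mem_pair_less num.less_imp_le by blast
qed

lemma trace_unique: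
  assumes "trace f g x n c" "trace f g x n' c'" "i \<^bold>\<le> n" "i \<^bold>\<le> n'"
    "code_mem M \<langle>i, u\<rangle> c" "code_mem M \<langle>i, u'\<rangle> c'"
  shows "u = u'"
  using trace_common[OF assms(1,2), of i] trace_fun[OF assms(1), of i] trace_fun[OF assms(2), of i] assms
  by blast

lemma trace_entry: "trace f g x n c \<Longrightarrow> i \<^bold>\<le> n \<Longrightarrow> \<exists>u. code_mem M \<langle>i, u\<rangle> c"
  using trace_common by blast

lemma trace_exists: "\<exists>c. trace f g x n c"
proof (rule sigma_induct[where P = "\<lambda>n c. trace f g x n c"])
  show "dec (\<lambda>z. trace f g x (pfst z) (psnd z))"
    by (intro rec_basic dec_trace)
  have "dec (\<lambda>z. z = \<langle>\<^bold>0, f x\<rangle>)" by (intro rec_basic)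
  from finset_code_exists[OF this, of "\<langle>\<^bold>0, f x\<rangle> \<^bold>+ \<^bold>1"] obtain c where
    "\<And>i. code_mem M i c \<longleftrightarrow> i = \<langle>\<^bold>0, f x\<rangle>" using self_less_S by blast
  then show "\<exists>c. trace f g x \<^bold>0 c" by (intro exI[of _ c] traceI) auto
  fix n c assume c: "trace f g x n c"
  obtain u where u: "code_mem M \<langle>n, u\<rangle> c" using trace_entry[OF c, of n] by auto
  let ?e = "\<langle>n \<^bold>+ \<^bold>1, g \<langle>x, \<langle>n, u\<rangle>\<rangle>\<rangle>"
  \<comment> \<open>A trace up to \<open>n\<close> may contain arbitrary entries at later stages, so
    everything above \<open>n\<close> is dropped before the new entry is added.\<close>
  let ?P = "\<lambda>z. (code_mem M z c \<and> pfst z \<^bold>\<le> n) \<or> z = ?e"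
  have "dec ?P" by (intro rec_basic dec_code_mem)
  from finset_code_exists[OF this, of "c \<^bold>+ (?e \<^bold>+ \<^bold>1)"] obtain c' where
    c': "\<And>i. code_mem M i c' \<longleftrightarrow> i \<^bold>< c \<^bold>+ (?e \<^bold>+ \<^bold>1) \<and> ?P i" by blast
  have bnd: "?P i \<Longrightarrow> i \<^bold>< c \<^bold>+ (?e \<^bold>+ \<^bold>1)" for i
    using num.less_le_trans[OF code_mem_less le_add(1), of i c "?e \<^bold>+ \<^bold>1"]
      num.less_le_trans[OF self_less_S le_add(2), of ?e c] by blast
  have c'': "code_mem M i c' \<longleftrightarrow> ?P i" for i
    using c'[of i] bnd[of i] by blast
  have cm: "code_mem M \<langle>i, v\<rangle> c' \<longleftrightarrow> (code_mem M \<langle>i, v\<rangle> c \<and> i \<^bold>\<le> n) \<or> (i = n \<^bold>+ \<^bold>1 \<and> v = g \<langle>x, \<langle>n, u\<rangle>\<rangle>)" for i v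
    unfolding c'' by simp
  have no: "\<not> n \<^bold>+ \<^bold>1 \<^bold>\<le> n" by (simp add: S_le_iff_less)
  have "trace f g x (n \<^bold>+ \<^bold>1) c'"
  proof (rule traceI)
    show "code_mem M \<langle>\<^bold>0, f x\<rangle> c'" using trace_start[OF c] cm by auto
    show "v = w" if "code_mem M \<langle>i, v\<rangle> c'" "code_mem M \<langle>i, w\<rangle> c'" for i v w
      using that trace_fun[OF c, of i v w] no unfolding cm by auto
    show "code_mem M \<langle>i \<^bold>+ \<^bold>1, g \<langle>x, \<langle>i, v\<rangle>\<rangle>\<rangle> c'" if "i \<^bold>< n \<^bold>+ \<^bold>1" "code_mem M \<langle>i, v\<rangle> c'" for i v
    proof (cases "i = n")
      case True
      then have "v = u" using that(2) no trace_fun[OF c _ _ u] unfolding cm by auto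
      then show ?thesis using True unfolding cm by blast
    next
      case False
      then have i: "i \<^bold>< n" using that(1) by (simp add: less_S)
      then have "code_mem M \<langle>i, v\<rangle> c" using that(2) no unfolding cm by auto
      from trace_step[OF c i this] show ?thesis using i unfolding cm S_le_iff_less by blast
    qed
  qed
  then show "\<exists>c. trace f g x (n \<^bold>+ \<^bold>1) c" ..
qed

lemma prec_iff: "y = prec f g x n \<longleftrightarrow> (\<exists>c. trace f g x n c \<and> code_mem M \<langle>n, y\<rangle> c)"
proof -
  have "\<exists>!u. \<exists>c. trace f g x n c \<and> code_mem M \<langle>n, u\<rangle> c"
    using trace_exists[of x n] trace_entry[of x n] trace_unique[of x n _ n] by blast
  from theI'[OF this] this show ?thesis unfolding prec_def by blast
qed

lemma prec_0: "prec f g x \<^bold>0 = f x"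
  using trace_exists[of x "\<^bold>0"] trace_start prec_iff[of "f x" x "\<^bold>0"] by auto

lemma prec_S: "prec f g x (n \<^bold>+ \<^bold>1) = g \<langle>x, \<langle>n, prec f g x n\<rangle>\<rangle>"
proof -
  obtain c where c: "trace f g x (n \<^bold>+ \<^bold>1) c" using trace_exists by blast
  then have c': "trace f g x n c"
    unfolding trace_def using less_S num.order_trans self_less_S num.less_imp_le by meson
  obtain u where u: "code_mem M \<langle>n, u\<rangle> c" using trace_entry[OF c', of n] by auto
  then have "u = prec f g x n" using c' prec_iff by blast
  moreover have "g \<langle>x, \<langle>n, u\<rangle>\<rangle> = prec f g x (n \<^bold>+ \<^bold>1)"
    unfolding prec_iff using c trace_step[OF c self_less_S u] by blast
  ultimately show ?thesis by simp
qed

text \<open>The value is found by an unbounded search for a trace, so the graph is Sigma^0_1, and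
  \<open>recI_ex\<close> applies.\<close>

lemma rec_prec:
  assumes "rec a" "rec b" shows "rec (\<lambda>x. prec f g (a x) (b x))"
  by (rule rec2_comp[OF recI_ex[where P = "\<lambda>x y c. trace f g (pfst x) (psnd x) c \<and> code_mem M \<langle>psnd x, y\<rangle> c"] assms])
    (simp_all only: prec_iff, intro rec_basic dec_trace dec_code_mem)

end

end

subsection \<open>Sums and convolutions\<close>

locale rca0_domain = rca0 M + R: domain R
  for M :: "'a l2_structure" and R (structure) +
  assumes countable: "countable_domain M R"
begin

lemma carrier_in: "carrier R \<in> \<U>"
  and add_in: "fun2_in M (carrier R) (\<oplus>)" and mult_in: "fun2_in M (carrier R) (\<otimes>)"
  using countable by (auto simp: countable_domain_def)

section \<open>Functions of the structure with values in the ring\<close>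

text \<open>The graphs of the operations are given on the carrier only; the default \<open>k\<close>
  elsewhere yields total functions, to which the composition rules apply.\<close>

lemma rec_fun2_total:
  assumes C: "C \<in> \<U>" and op: "fun2_in M C op" and fg: "rec f" "rec g"
  shows "rec (\<lambda>x. if f x \<in> C \<and> g x \<in> C then op (f x) (g x) else k)"
proof (rule rec2_comp[where h = "\<lambda>a b. if a \<in> C \<and> b \<in> C then op a b else k", OF _ fg], rule recI)
  let ?A = "{\<langle>\<langle>a, b\<rangle>, op a b\<rangle> | a b. a \<in> C \<and> b \<in> C}"
  have A: "?A \<in> \<U>" using op by (simp add: fun2_in_def)
  have "y = (if a \<in> C \<and> b \<in> C then op a b else k) \<longleftrightarrow>
     \<langle>\<langle>a, b\<rangle>, y\<rangle> \<in> ?A \<or> (\<not> (a \<in> C \<and> b \<in> C) \<and> y = k)" for y a b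
    by auto
  then show "dec (\<lambda>z. psnd z = (if pfst (pfst z) \<in> C \<and> psnd (pfst z) \<in> C
      then op (pfst (pfst z)) (psnd (pfst z)) else k))"
    by (simp only:) (intro rec_basic dec_mem[OF A] dec_mem[OF C])
qed

lemma rec_fun2:
  assumes "C \<in> \<U>" "fun2_in M C op" "rec f" "rec g" "\<And>x. f x \<in> C" "\<And>x. g x \<in> C"
  shows "rec (\<lambda>x. op (f x) (g x))"
  using rec_fun2_total[OF assms(1-4)] assms(5,6) by simp

lemmas rec_radd = rec_fun2[OF carrier_in add_in] and rec_rmult = rec_fun2[OF carrier_in mult_in]

text \<open>Membership in the structure is essential: only for such functions does the recursion
  computing a sum of nonstandard length take place inside \<open>M\<close>.\<close>

definition coefs :: "('a \<Rightarrow> 'a) set" where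
  "coefs = {h. rec h \<and> (\<forall>i. h i \<in> carrier R)}"

lemma coefsI: "rec h \<Longrightarrow> (\<And>i. h i \<in> carrier R) \<Longrightarrow> h \<in> coefs"
  by (simp add: coefs_def)

lemma coefs_rec: "h \<in> coefs \<Longrightarrow> rec h" and coefs_closed [simp]: "h \<in> coefs \<Longrightarrow> h i \<in> carrier R"
  by (simp_all add: coefs_def)

section \<open>Sums of possibly nonstandard length\<close>

text \<open>The guard makes the step total; that it is never violated in a sum of ring elements is
  \<open>rsum_closed\<close>.\<close>

definition rstep :: "('a \<Rightarrow> 'a \<Rightarrow> 'a) \<Rightarrow> 'a \<Rightarrow> 'a" where
  "rstep F z = (if psnd (psnd z) \<in> carrier R \<and> F (pfst z) (pfst (psnd z)) \<in> carrier R
     then psnd (psnd z) \<oplus> F (pfst z) (pfst (psnd z)) else \<zero>)"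

definition rsum :: "('a \<Rightarrow> 'a) \<Rightarrow> 'a \<Rightarrow> 'a" where
  "rsum h = prec (\<lambda>_. \<zero>) (rstep (\<lambda>_. h)) \<^bold>0"

lemma rec_rstep: assumes "rec (\<lambda>z. F (pfst z) (psnd z))" shows "rec (rstep F)"
  unfolding rstep_def
  by (intro rec_fun2_total[OF carrier_in add_in] rec_basic rec2_comp[OF assms])

text \<open>The recursion of \<open>rsum\<close> carries the dummy parameter 0. With
  \<open>x\<close> in its place the whole family of sums becomes one recursion with a
  parameter.\<close>

lemma rec_rsum:
  assumes F: "rec (\<lambda>z. F (pfst z) (psnd z))" and b: "rec b"
  shows "rec (\<lambda>x. rsum (F x) (b x))"
proof -
  have "rsum (F x) n = prec (\<lambda>_. \<zero>) (rstep F) x n" for x n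
    by (simp add: rsum_def prec_def trace_def rstep_def)
  then show ?thesis by (simp only:) (intro rec_prec rec_const rec_rstep F rec_id b)
qed

lemma rec_rstep1: "h \<in> coefs \<Longrightarrow> rec (rstep (\<lambda>_. h))"
  by (rule rec_rstep[OF rec_comp[OF coefs_rec rec_psnd']])

lemma rsum_0 [simp]: "h \<in> coefs \<Longrightarrow> rsum h \<^bold>0 = \<zero>"
  unfolding rsum_def by (rule prec_0[OF rec_const rec_rstep1])

lemma rec_rsum_fixed: "h \<in> coefs \<Longrightarrow> rec f \<Longrightarrow> rec (\<lambda>x. rsum h (f x))"
  by (rule rec_rsum[OF rec_comp[OF coefs_rec rec_psnd']])

lemma rsum_S':
  assumes "h \<in> coefs"
  shows "rsum h (n \<^bold>+ \<^bold>1) = (if rsum h n \<in> carrier R then rsum h n \<oplus> h n else \<zero>)"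
proof -
  have "rsum h (n \<^bold>+ \<^bold>1) = rstep (\<lambda>_. h) \<langle>\<^bold>0, \<langle>n, rsum h n\<rangle>\<rangle>"
    unfolding rsum_def by (rule prec_S[OF rec_const rec_rstep1[OF assms]])
  then show ?thesis using assms by (simp add: rstep_def)
qed

lemma rsum_closed [simp]: assumes "h \<in> coefs" shows "rsum h n \<in> carrier R"
proof (induction n rule: dec_induct)
  show "dec (\<lambda>n. rsum h n \<in> carrier R)"
    by (intro dec_mem carrier_in rec_rsum_fixed rec_id assms)
qed (use assms in \<open>simp_all add: rsum_S'\<close>)

lemma rsum_S [simp]: "h \<in> coefs \<Longrightarrow> rsum h (n \<^bold>+ \<^bold>1) = rsum h n \<oplus> h n"
  by (simp add: rsum_S')

lemma coefs_rsum:
  assumes "rec (\<lambda>z. F (pfst z) (psnd z))" "\<And>x i. F x i \<in> carrier R" "rec b"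
  shows "(\<lambda>x. rsum (F x) (b x)) \<in> coefs"
proof (rule coefsI)
  have "F x \<in> coefs" for x
    using rec2_comp[OF assms(1) rec_const rec_id] assms(2) by (intro coefsI) 
  then show "rsum (F x) (b x) \<in> carrier R" for x by simp
qed (intro rec_rsum assms)

lemma coefs_add [simp]: "f \<in> coefs \<Longrightarrow> g \<in> coefs \<Longrightarrow> (\<lambda>i. f i \<oplus> g i) \<in> coefs"
  by (rule coefsI[OF rec_radd]) (simp_all add: coefs_rec)

lemma coefs_mult [simp]: "f \<in> coefs \<Longrightarrow> g \<in> coefs \<Longrightarrow> (\<lambda>i. f i \<otimes> g i) \<in> coefs"
  by (rule coefsI[OF rec_rmult]) (simp_all add: coefs_rec)

lemma coefs_const [simp]: "a \<in> carrier R \<Longrightarrow> (\<lambda>_. a) \<in> coefs"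
  by (rule coefsI[OF rec_const])

lemma coefs_comp: "f \<in> coefs \<Longrightarrow> rec t \<Longrightarrow> (\<lambda>i. f (t i)) \<in> coefs"
  by (rule coefsI[OF rec_comp[OF coefs_rec]]) auto

lemma coefs_shift [simp]:
  assumes f: "f \<in> coefs"
  shows "(\<lambda>i. f (i \<^bold>+ k)) \<in> coefs" "(\<lambda>i. f (k \<^bold>+ i)) \<in> coefs" "(\<lambda>i. f (k \<^bold>- i)) \<in> coefs"
  by (intro coefs_comp[OF f] rec_basic rec_sub)+

lemma rsum_cong:
  assumes fg: "f \<in> coefs" "g \<in> coefs" and eq: "\<And>i. i \<^bold>< n \<Longrightarrow> f i = g i"
  shows "rsum f n = rsum g n"
proof -
  have "m \<^bold>\<le> n \<longrightarrow> rsum f m = rsum g m" for m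
  proof (induction m rule: dec_induct)
    show "dec (\<lambda>m. m \<^bold>\<le> n \<longrightarrow> rsum f m = rsum g m)"
      by (intro rec_basic rec_rsum_fixed fg)
    fix m assume "m \<^bold>\<le> n \<longrightarrow> rsum f m = rsum g m"
    then show "m \<^bold>+ \<^bold>1 \<^bold>\<le> n \<longrightarrow> rsum f (m \<^bold>+ \<^bold>1) = rsum g (m \<^bold>+ \<^bold>1)"
      using fg eq by (simp add: S_le_iff_less num.less_imp_le)
  qed (use fg in simp)
  then show ?thesis by simp
qed

lemma rsum_add:
  assumes fg: "f \<in> coefs" "g \<in> coefs"
  shows "rsum (\<lambda>i. f i \<oplus> g i) n = rsum f n \<oplus> rsum g n"
proof (induction n rule: dec_induct)
  show "dec (\<lambda>n. rsum (\<lambda>i. f i \<oplus> g i) n = rsum f n \<oplus> rsum g n)"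
    by (intro dec_eq rec_radd rec_rsum_fixed rec_id fg coefs_add rsum_closed)
qed (use fg in \<open>simp_all add: R.a_ac\<close>)

lemma rsum_smult:
  assumes f: "f \<in> coefs" and a: "a \<in> carrier R"
  shows "rsum (\<lambda>i. a \<otimes> f i) n = a \<otimes> rsum f n"
proof (induction n rule: dec_induct)
  show "dec (\<lambda>n. rsum (\<lambda>i. a \<otimes> f i) n = a \<otimes> rsum f n)"
    by (intro dec_eq rec_rmult rec_const rec_rsum_fixed rec_id f a coefs_mult coefs_const rsum_closed)
qed (use f a in \<open>simp_all add: R.r_distr\<close>)

lemma rsum_single:
  assumes f: "f \<in> coefs" and k: "k \<^bold>< n" and 0: "\<And>i. i \<^bold>< n \<Longrightarrow> i \<noteq> k \<Longrightarrow> f i = \<zero>"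
  shows "rsum f n = f k"
proof -
  have "m \<^bold>\<le> n \<longrightarrow> rsum f m = (if k \<^bold>< m then f k else \<zero>)" for m
  proof (induction m rule: dec_induct)
    show "dec (\<lambda>m. m \<^bold>\<le> n \<longrightarrow> rsum f m = (if k \<^bold>< m then f k else \<zero>))"
      by (intro rec_basic rec_rsum_fixed f)
    fix m assume "m \<^bold>\<le> n \<longrightarrow> rsum f m = (if k \<^bold>< m then f k else \<zero>)"
    then show "m \<^bold>+ \<^bold>1 \<^bold>\<le> n \<longrightarrow> rsum f (m \<^bold>+ \<^bold>1) = (if k \<^bold>< m \<^bold>+ \<^bold>1 then f k else \<zero>)"
      using f 0[of m] less_irrefl[of k] by (auto simp: S_le_iff_less num.less_imp_le less_S)
  qed (use f in simp)
  then show ?thesis using k by simp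
qed

lemma rsum_zero: "f \<in> coefs \<Longrightarrow> (\<And>i. i \<^bold>< n \<Longrightarrow> f i = \<zero>) \<Longrightarrow> rsum f n = \<zero>"
proof (cases "n = \<^bold>0")
  case False
  then have "\<^bold>0 \<^bold>< n" by (simp add: zero_less)
  then show "f \<in> coefs \<Longrightarrow> (\<And>i. i \<^bold>< n \<Longrightarrow> f i = \<zero>) \<Longrightarrow> rsum f n = \<zero>"
    using rsum_single[of f "\<^bold>0" n] by simp
qed simp

lemma rsum_first:
  assumes f: "f \<in> coefs"
  shows "rsum f (n \<^bold>+ \<^bold>1) = f \<^bold>0 \<oplus> rsum (\<lambda>i. f (i \<^bold>+ \<^bold>1)) n"
proof (induction n rule: dec_induct)
  show "dec (\<lambda>n. rsum f (n \<^bold>+ \<^bold>1) = f \<^bold>0 \<oplus> rsum (\<lambda>i. f (i \<^bold>+ \<^bold>1)) n)"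
    by (intro dec_eq rec_radd rec_const rec_rsum_fixed rec_id rec_add f coefs_closed[OF f] coefs_shift(1)[OF f]
        rsum_closed)
  show "rsum f (\<^bold>0 \<^bold>+ \<^bold>1) = f \<^bold>0 \<oplus> rsum (\<lambda>i. f (i \<^bold>+ \<^bold>1)) \<^bold>0"
    unfolding rsum_S[OF f] using f by simp
  fix n assume IH: "rsum f (n \<^bold>+ \<^bold>1) = f \<^bold>0 \<oplus> rsum (\<lambda>i. f (i \<^bold>+ \<^bold>1)) n"
  have "rsum f (n \<^bold>+ \<^bold>1 \<^bold>+ \<^bold>1) = f \<^bold>0 \<oplus> rsum (\<lambda>i. f (i \<^bold>+ \<^bold>1)) n \<oplus> f (n \<^bold>+ \<^bold>1)"
    unfolding rsum_S[OF f, of "n \<^bold>+ \<^bold>1"] IH ..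
  then show "rsum f (n \<^bold>+ \<^bold>1 \<^bold>+ \<^bold>1) = f \<^bold>0 \<oplus> rsum (\<lambda>i. f (i \<^bold>+ \<^bold>1)) (n \<^bold>+ \<^bold>1)"
    using f rsum_S[OF coefs_shift(1)[OF f], of "\<^bold>1" n] by (simp only: R.a_assoc coefs_closed coefs_shift rsum_closed)
qed

text \<open>The first term of the reversed sum up to \<open>n + 1\<close> is
  \<open>f (n + 1)\<close>. Peeled off at the front by \<open>rsum_first\<close>, it is the last
  term of the other sum.\<close>

lemma rsum_rev:
  assumes f: "f \<in> coefs"
  shows "rsum (\<lambda>i. f (n \<^bold>- i)) (n \<^bold>+ \<^bold>1) = rsum f (n \<^bold>+ \<^bold>1)"
proof (induction n rule: dec_induct)
  show "dec (\<lambda>n. rsum (\<lambda>i. f (n \<^bold>- i)) (n \<^bold>+ \<^bold>1) = rsum f (n \<^bold>+ \<^bold>1))"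
    by (intro dec_eq rec_rsum rec_rsum_fixed rec_basic rec_sub f rec_comp[OF coefs_rec[OF f]])
  show "rsum (\<lambda>i. f (\<^bold>0 \<^bold>- i)) (\<^bold>0 \<^bold>+ \<^bold>1) = rsum f (\<^bold>0 \<^bold>+ \<^bold>1)"
    by (rule rsum_cong) (use f in simp_all)
  fix n assume IH: "rsum (\<lambda>i. f (n \<^bold>- i)) (n \<^bold>+ \<^bold>1) = rsum f (n \<^bold>+ \<^bold>1)"
  have "n \<^bold>+ \<^bold>1 \<^bold>- (i \<^bold>+ \<^bold>1) = n \<^bold>- i" for i
    using add_sub_cancel[of "\<^bold>1" n] sub_sub[of "n \<^bold>+ \<^bold>1" "\<^bold>1" i] by (simp add: add_comm)
  then have "rsum (\<lambda>i. f (n \<^bold>+ \<^bold>1 \<^bold>- i)) (n \<^bold>+ \<^bold>1 \<^bold>+ \<^bold>1) = f (n \<^bold>+ \<^bold>1) \<oplus> rsum f (n \<^bold>+ \<^bold>1)"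
    using rsum_first[of "\<lambda>i. f (n \<^bold>+ \<^bold>1 \<^bold>- i)" "n \<^bold>+ \<^bold>1"] f IH by (simp del: rsum_S)
  also have "\<dots> = rsum f (n \<^bold>+ \<^bold>1 \<^bold>+ \<^bold>1)"
    using f rsum_S[OF f, of "n \<^bold>+ \<^bold>1"] R.a_comm by simp
  finally show "rsum (\<lambda>i. f (n \<^bold>+ \<^bold>1 \<^bold>- i)) (n \<^bold>+ \<^bold>1 \<^bold>+ \<^bold>1) = rsum f (n \<^bold>+ \<^bold>1 \<^bold>+ \<^bold>1)" .
qed

lemma S_sub: "j \<^bold>\<le> n \<Longrightarrow> n \<^bold>+ \<^bold>1 \<^bold>- j = n \<^bold>- j \<^bold>+ \<^bold>1"
  using add_sub[of j n] add_sub_cancel[of j "n \<^bold>- j \<^bold>+ \<^bold>1"] by (simp add: add_S)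

text \<open>Both sides add up \<open>F i j\<close> over \<open>j \<le> i < n\<close>, by rows
  \<open>i\<close> and by columns \<open>j\<close> with \<open>i = j + m\<close>. This is the
  interchange behind the associativity of convolution.\<close>

lemma rsum_triangle:
  assumes F: "rec (\<lambda>z. F (pfst z) (psnd z))" and Fc: "\<And>x i. F x i \<in> carrier R"
  shows "rsum (\<lambda>i. rsum (F i) (i \<^bold>+ \<^bold>1)) n = rsum (\<lambda>j. rsum (\<lambda>m. F (j \<^bold>+ m) j) (n \<^bold>- j)) n"
proof (induction n rule: dec_induct)
  have Fx: "F x \<in> coefs" for x
    using rec2_comp[OF F rec_const rec_id] Fc by (intro coefsI)
  have Fx': "(\<lambda>m. F (j \<^bold>+ m) j) \<in> coefs" for j
    by (intro coefsI rec2_comp[OF F] rec_basic Fc)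
  have L: "(\<lambda>i. rsum (F i) (i \<^bold>+ \<^bold>1)) \<in> coefs"
    by (intro coefs_rsum F Fc rec_basic)
  have R: "(\<lambda>j. rsum (\<lambda>m. F (j \<^bold>+ m) j) (n \<^bold>- j)) \<in> coefs" for n
    by (intro coefs_rsum rec2_comp[OF F] Fc rec_basic rec_sub)
  show "dec (\<lambda>n. rsum (\<lambda>i. rsum (F i) (i \<^bold>+ \<^bold>1)) n = rsum (\<lambda>j. rsum (\<lambda>m. F (j \<^bold>+ m) j) (n \<^bold>- j)) n)"
    by (intro dec_eq rec_rsum_fixed L rec_rsum rec2_comp[OF F] rec_basic rec_sub)
  show "rsum (\<lambda>i. rsum (F i) (i \<^bold>+ \<^bold>1)) \<^bold>0 = rsum (\<lambda>j. rsum (\<lambda>m. F (j \<^bold>+ m) j) (\<^bold>0 \<^bold>- j)) \<^bold>0"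
    using L R by simp
  fix n assume IH: "rsum (\<lambda>i. rsum (F i) (i \<^bold>+ \<^bold>1)) n = rsum (\<lambda>j. rsum (\<lambda>m. F (j \<^bold>+ m) j) (n \<^bold>- j)) n"
  \<comment> \<open>The new row \<open>n\<close> lengthens each column \<open>j \<le> n\<close> by
    the entry \<open>F n j\<close>.\<close>
  have "rsum (\<lambda>j. rsum (\<lambda>m. F (j \<^bold>+ m) j) (n \<^bold>+ \<^bold>1 \<^bold>- j)) (n \<^bold>+ \<^bold>1) =
      rsum (\<lambda>j. rsum (\<lambda>m. F (j \<^bold>+ m) j) (n \<^bold>- j) \<oplus> F n j) (n \<^bold>+ \<^bold>1)"
  proof (rule rsum_cong[OF R])
    fix j assume "j \<^bold>< n \<^bold>+ \<^bold>1"
    then have j: "j \<^bold>\<le> n" by (simp add: less_S_iff_le)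
    then show "rsum (\<lambda>m. F (j \<^bold>+ m) j) (n \<^bold>+ \<^bold>1 \<^bold>- j) = rsum (\<lambda>m. F (j \<^bold>+ m) j) (n \<^bold>- j) \<oplus> F n j"
      using Fx' add_sub by (simp add: S_sub)
  qed (intro coefs_add R Fx)
  also have "\<dots> = rsum (\<lambda>j. rsum (\<lambda>m. F (j \<^bold>+ m) j) (n \<^bold>- j)) (n \<^bold>+ \<^bold>1) \<oplus> rsum (F n) (n \<^bold>+ \<^bold>1)"
    by (intro rsum_add R Fx)
  \<comment> \<open>Before the new row, column \<open>n\<close> has length \<open>n - n\<close> and
    contributes nothing.\<close>
  also have "rsum (\<lambda>j. rsum (\<lambda>m. F (j \<^bold>+ m) j) (n \<^bold>- j)) (n \<^bold>+ \<^bold>1) =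
      rsum (\<lambda>j. rsum (\<lambda>m. F (j \<^bold>+ m) j) (n \<^bold>- j)) n"
    using rsum_S[OF R] rsum_closed[OF R] Fx' by simp
  finally show "rsum (\<lambda>i. rsum (F i) (i \<^bold>+ \<^bold>1)) (n \<^bold>+ \<^bold>1) =
      rsum (\<lambda>j. rsum (\<lambda>m. F (j \<^bold>+ m) j) (n \<^bold>+ \<^bold>1 \<^bold>- j)) (n \<^bold>+ \<^bold>1)"
    using rsum_S[OF L] IH by simp
qed

section \<open>Convolution of coefficient functions\<close>

definition conv :: "('a \<Rightarrow> 'a) \<Rightarrow> ('a \<Rightarrow> 'a) \<Rightarrow> 'a \<Rightarrow> 'a" where
  "conv c d k = rsum (\<lambda>i. c i \<otimes> d (k \<^bold>- i)) (k \<^bold>+ \<^bold>1)"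

lemma coefs_conv [simp]: assumes "c \<in> coefs" "d \<in> coefs" shows "conv c d \<in> coefs"
  unfolding conv_def[abs_def]
  by (intro coefs_rsum rec_rmult rec_comp[OF coefs_rec[OF assms(1)]] rec_comp[OF coefs_rec[OF assms(2)]]
      rec_basic rec_sub R.m_closed coefs_closed assms)

lemma conv_comm: assumes "c \<in> coefs" "d \<in> coefs" shows "conv c d = conv d c"
proof
  fix k
  have "conv c d k = rsum (\<lambda>i. c (k \<^bold>- i) \<otimes> d (k \<^bold>- (k \<^bold>- i))) (k \<^bold>+ \<^bold>1)"
    unfolding conv_def using assms by (subst rsum_rev[of "\<lambda>i. c i \<otimes> d (k \<^bold>- i)"]) simp_all
  also have "\<dots> = conv d c k"
    unfolding conv_def
  proof (rule rsum_cong)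
    show "(\<lambda>i. c (k \<^bold>- i) \<otimes> d (k \<^bold>- (k \<^bold>- i))) \<in> coefs"
      by (intro coefs_mult coefs_comp[OF assms(1)] coefs_comp[OF assms(2)] rec_basic rec_sub)
    fix i assume "i \<^bold>< k \<^bold>+ \<^bold>1"
    then have "k \<^bold>- (k \<^bold>- i) = i"
      using add_sub[of i k] add_sub_cancel[of "k \<^bold>- i" i] by (simp add: less_S_iff_le add_comm)
    then show "c (k \<^bold>- i) \<otimes> d (k \<^bold>- (k \<^bold>- i)) = d i \<otimes> c (k \<^bold>- i)"
      using assms R.m_comm by simp
  qed (use assms in simp)
  finally show "conv c d k = conv d c k" .
qed

lemma conv_add:
  assumes "a \<in> coefs" "c \<in> coefs" "d \<in> coefs"
  shows "conv a (\<lambda>i. c i \<oplus> d i) k = conv a c k \<oplus> conv a d k"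
  unfolding conv_def using assms by (subst rsum_add[symmetric]) (simp_all add: R.r_distr)

text \<open>The products of \<open>a\<close> at \<open>j\<close>, \<open>b\<close> at
  \<open>i - j\<close> and \<open>c\<close> at \<open>k - i\<close> form a triangle. Its rows sum to
  the left side; its columns, with \<open>m = i - j\<close>, sum to the right side.\<close>

lemma conv_assoc:
  assumes "a \<in> coefs" "b \<in> coefs" "c \<in> coefs"
  shows "conv (conv a b) c = conv a (conv b c)"
proof
  fix k
  let ?F = "\<lambda>i j. a j \<otimes> b (i \<^bold>- j) \<otimes> c (k \<^bold>- i)"
  have F: "rec (\<lambda>z. ?F (pfst z) (psnd z))"
    by (intro rec_rmult rec_comp[OF coefs_rec[OF assms(1)]] rec_comp[OF coefs_rec[OF assms(2)]]
        rec_comp[OF coefs_rec[OF assms(3)]] rec_basic rec_sub R.m_closed coefs_closed assms)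
  have Fc: "?F i j \<in> carrier R" for i j using assms by simp
  have "conv (conv a b) c k = rsum (\<lambda>i. rsum (?F i) (i \<^bold>+ \<^bold>1)) (k \<^bold>+ \<^bold>1)"
    unfolding conv_def[of "conv a b"]
  proof (rule rsum_cong)
    show "(\<lambda>i. rsum (?F i) (i \<^bold>+ \<^bold>1)) \<in> coefs" by (intro coefs_rsum F Fc rec_basic)
    fix i
    have "rsum (?F i) (i \<^bold>+ \<^bold>1) = rsum (\<lambda>j. c (k \<^bold>- i) \<otimes> (a j \<otimes> b (i \<^bold>- j))) (i \<^bold>+ \<^bold>1)"
      by (rule rsum_cong) (use assms R.m_comm in simp_all)
    also have "\<dots> = c (k \<^bold>- i) \<otimes> conv a b i" 
      unfolding conv_def by (rule rsum_smult) (use assms in simp_all)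
    finally show "conv a b i \<otimes> c (k \<^bold>- i) = rsum (?F i) (i \<^bold>+ \<^bold>1)"
      using assms R.m_comm by simp
  qed (use assms in simp)
  also have "\<dots> = rsum (\<lambda>j. rsum (\<lambda>m. ?F (j \<^bold>+ m) j) (k \<^bold>+ \<^bold>1 \<^bold>- j)) (k \<^bold>+ \<^bold>1)"
    by (rule rsum_triangle[OF F Fc])
  also have "\<dots> = conv a (conv b c) k"
    unfolding conv_def[of a]
  proof (rule rsum_cong)
    show "(\<lambda>j. rsum (\<lambda>m. ?F (j \<^bold>+ m) j) (k \<^bold>+ \<^bold>1 \<^bold>- j)) \<in> coefs"
      by (intro coefs_rsum rec2_comp[OF F] rec_basic rec_sub Fc)
    fix j assume "j \<^bold>< k \<^bold>+ \<^bold>1"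
    then have j: "j \<^bold>\<le> k" by (simp add: less_S_iff_le)
    have "rsum (\<lambda>m. ?F (j \<^bold>+ m) j) (k \<^bold>+ \<^bold>1 \<^bold>- j) = rsum (\<lambda>m. a j \<otimes> (b m \<otimes> c (k \<^bold>- j \<^bold>- m))) (k \<^bold>- j \<^bold>+ \<^bold>1)"
      unfolding S_sub[OF j]
    proof (rule rsum_cong)
      show "(\<lambda>m. ?F (j \<^bold>+ m) j) \<in> coefs" 
        by (intro coefsI rec2_comp[OF F] rec_basic Fc)
      show "(\<lambda>m. a j \<otimes> (b m \<otimes> c (k \<^bold>- j \<^bold>- m))) \<in> coefs"
        by (intro coefs_mult coefs_const coefs_shift(3)[OF assms(3)] coefs_closed assms)
    qed (use assms in \<open>simp_all add: R.m_assoc sub_sub add_sub_cancel\<close>)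
    also have "\<dots> = a j \<otimes> conv b c (k \<^bold>- j)"
      unfolding conv_def by (rule rsum_smult) (use assms in simp_all)
    finally show "rsum (\<lambda>m. ?F (j \<^bold>+ m) j) (k \<^bold>+ \<^bold>1 \<^bold>- j) = a j \<otimes> conv b c (k \<^bold>- j)" .
  qed (use assms in simp)
  finally show "conv (conv a b) c k = conv a (conv b c) k" .
qed

end

subsection \<open>The polynomial ring\<close>

context rca0 begin

lemma is_seq_entry:
  assumes "is_seq M s l"
  shows "entry M s j v \<Longrightarrow> j \<^bold>< l" "j \<^bold>< l \<Longrightarrow> \<exists>v. entry M s j v"
    "entry M s j v \<Longrightarrow> entry M s j v' \<Longrightarrow> v = v'"
proof -
  show j: "entry M s j v \<Longrightarrow> j \<^bold>< l" for j v
    using assms unfolding is_seq_def entry_def by fastforce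
  show "j \<^bold>< l \<Longrightarrow> \<exists>v. entry M s j v" "entry M s j v \<Longrightarrow> entry M s j v' \<Longrightarrow> v = v'"
    using assms j unfolding is_seq_def by blast+
qed

lemma is_seq_length_unique: "is_seq M s l \<Longrightarrow> is_seq M s l' \<Longrightarrow> l = l'"
  using is_seq_entry(1,2) less_total less_irrefl by metis

lemma is_seq_eqI:
  assumes "is_seq M s l" "is_seq M s' l'" "\<And>j v. entry M s j v \<longleftrightarrow> entry M s' j v"
  shows "s = s'"
proof (rule finset_code_unique)
  show "is_finset_code M s" "is_finset_code M s'" using assms by (auto simp: is_seq_def)
  have "\<exists>j v. i = \<langle>j, v\<rangle>" if "code_mem M i s \<or> code_mem M i s'" for i
    using that assms(1,2) unfolding is_seq_def by blast
  then show "code_mem M i s \<longleftrightarrow> code_mem M i s'" for i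
    using assms(3) unfolding entry_def by blast
qed

end

context rca0_domain begin

section \<open>Length and coefficients of coded polynomials\<close>

abbreviation "PS \<equiv> polys M R"
abbreviation "pc \<equiv> pcoeff M R"

text \<open>The degree plus 1, and 0 for the zero polynomial, so that no special degree is needed
  there. The default off \<open>PS\<close> makes it total.\<close>

definition plen :: "'a \<Rightarrow> 'a" where
  "plen p = (if p \<in> PS then THE l. is_seq M p l else \<^bold>0)"

lemma is_seq_plen: assumes "p \<in> PS" shows "is_seq M p (plen p)"
proof -
  have "\<exists>!l. is_seq M p l" using assms is_seq_length_unique unfolding polys_def by blast
  from theI'[OF this] show ?thesis using assms by (simp add: plen_def)
qed

lemma plen_eqI: "p \<in> PS \<Longrightarrow> is_seq M p l \<Longrightarrow> plen p = l"
  using is_seq_plen is_seq_length_unique by blast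

lemma poly_entry_iff:
  assumes p: "p \<in> PS" shows "entry M p j v \<longleftrightarrow> j \<^bold>< plen p \<and> v = pc p j"
proof -
  note s = is_seq_entry[OF is_seq_plen[OF p], of j]
  have "pc p j = v" if "entry M p j v" for v
    using that s(3) unfolding pcoeff_def by (metis the_equality)
  then show ?thesis using s(1,2) by blast
qed

lemma pc_beyond: "p \<in> PS \<Longrightarrow> plen p \<^bold>\<le> j \<Longrightarrow> pc p j = \<zero>"
  using is_seq_entry(1)[OF is_seq_plen, of p j] unfolding pcoeff_def by (auto simp: num.not_less[symmetric])

lemma pc_closed [simp]: "p \<in> PS \<Longrightarrow> pc p j \<in> carrier R"
proof (cases "j \<^bold>< plen p")
  case True
  then show "p \<in> PS \<Longrightarrow> pc p j \<in> carrier R"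
    using poly_entry_iff[of p j "pc p j"] unfolding polys_def by blast
next
  case False
  then show "p \<in> PS \<Longrightarrow> pc p j \<in> carrier R"
    using pc_beyond[of p j] by (simp add: num.not_less)
qed

lemma pc_lead: "p \<in> PS \<Longrightarrow> plen p = j \<^bold>+ \<^bold>1 \<Longrightarrow> pc p j \<noteq> \<zero>"
proof -
  assume p: "p \<in> PS" and l: "plen p = j \<^bold>+ \<^bold>1"
  obtain l where "is_seq M p l" "\<And>j. l = j \<^bold>+ \<^bold>1 \<Longrightarrow> \<not> entry M p j \<zero>"
    using p unfolding polys_def by blast
  then have "\<not> entry M p j \<zero>" using plen_eqI[OF p] l by blast
  then show ?thesis using poly_entry_iff[OF p, of j \<zero>] l by auto
qed

lemma plen_le_iff:
  assumes p: "p \<in> PS" shows "plen p \<^bold>\<le> N \<longleftrightarrow> (\<forall>k. N \<^bold>\<le> k \<longrightarrow> pc p k = \<zero>)"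
proof
  show "plen p \<^bold>\<le> N \<Longrightarrow> \<forall>k. N \<^bold>\<le> k \<longrightarrow> pc p k = \<zero>"
    using pc_beyond[OF p] num.order_trans by blast
  assume 0: "\<forall>k. N \<^bold>\<le> k \<longrightarrow> pc p k = \<zero>"
  show "plen p \<^bold>\<le> N"
  proof (rule ccontr)
    assume "\<not> plen p \<^bold>\<le> N"
    then have N: "N \<^bold>< plen p" by (simp add: num.not_le)
    then obtain j where j: "plen p = j \<^bold>+ \<^bold>1" using zero_or_S[of "plen p"] by auto
    with N 0 have "pc p j = \<zero>" by (simp add: less_S_iff_le)
    with pc_lead[OF p j] show False ..
  qed
qed

lemma plen_le: "plen p \<^bold>\<le> p"
proof (cases "p \<in> PS")
  case True
  show ?thesis
  proof (cases "plen p = \<^bold>0")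
    case False
    then obtain j where j: "plen p = j \<^bold>+ \<^bold>1" using zero_or_S by blast
    then have "entry M p j (pc p j)" using poly_entry_iff[OF True] by simp
    then show ?thesis using j entry_less(1) by (simp add: S_le_iff_less)
  qed simp
qed (simp add: plen_def)

text \<open>The nonzero last entry lets the coefficients determine the length, and minimality of set
  codes lets the entries determine the code. Hence equality in the ring is equality of
  numbers.\<close>

lemma poly_eqI:
  assumes p: "p \<in> PS" and q: "q \<in> PS" and eq: "\<And>k. pc p k = pc q k" shows "p = q"
proof -
  have "plen p \<^bold>\<le> N \<longleftrightarrow> plen q \<^bold>\<le> N" for N
    using plen_le_iff[OF p] plen_le_iff[OF q] eq by simp
  then have "plen p = plen q" using num.order_antisym num.order_refl by metis
  then show ?thesis
    using is_seq_eqI[OF is_seq_plen[OF p] is_seq_plen[OF q]] eq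
    unfolding poly_entry_iff[OF p] poly_entry_iff[OF q] by simp
qed

text \<open>The length, the positions and the values of a polynomial are bounded by its code, so
  \<open>PS\<close> is decidable and a set of the structure.\<close>

lemma PS_iff: "p \<in> PS \<longleftrightarrow> (\<exists>l. l \<^bold>\<le> p \<and> is_seq M p l \<and>
     (\<forall>j. j \<^bold>< p \<longrightarrow> (\<forall>v. v \<^bold>< p \<longrightarrow> entry M p j v \<longrightarrow> v \<in> carrier R)) \<and>
     (\<forall>j. j \<^bold>< p \<longrightarrow> l = j \<^bold>+ \<^bold>1 \<longrightarrow> \<not> entry M p j \<zero>))" (is "_ \<longleftrightarrow> (\<exists>l. ?Q l)")
proof
  assume p: "p \<in> PS"
  then obtain l where "is_seq M p l"
     "\<forall>j v. entry M p j v \<longrightarrow> v \<in> carrier R" "\<forall>j. l = j \<^bold>+ \<^bold>1 \<longrightarrow> \<not> entry M p j \<zero>"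
    unfolding polys_def by blast
  moreover from this have "l \<^bold>\<le> p" using plen_eqI[OF p] plen_le[of p] by auto
  ultimately show "\<exists>l. ?Q l" by blast
next
  assume "\<exists>l. ?Q l"
  then obtain l where l: "?Q l" by blast
  have "\<forall>j v. entry M p j v \<longrightarrow> v \<in> carrier R" "\<forall>j. l = j \<^bold>+ \<^bold>1 \<longrightarrow> \<not> entry M p j \<zero>"
    using l entry_less[of p] by blast+
  then show "p \<in> PS" using l unfolding polys_def by blast
qed

lemma PS_in: "PS \<in> \<U>"
proof -
  have "dec (\<lambda>p. p \<in> PS)"
    unfolding PS_iff by (intro rec_basic dec_is_seq dec_entry dec_mem[OF carrier_in])
  then show ?thesis by (simp add: dec_def)
qed

text \<open>A total variant of \<open>pcoeff\<close>: with 0 off \<open>PS\<close> it is a function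
  of the structure and always has values in the ring.\<close>

definition cf :: "'a \<Rightarrow> 'a \<Rightarrow> 'a" where "cf p j = (if p \<in> PS then pc p j else \<zero>)"

lemma cf_closed [simp]: "cf p j \<in> carrier R"
  by (simp add: cf_def)

lemma rec_cf: "rec f \<Longrightarrow> rec g \<Longrightarrow> rec (\<lambda>x. cf (f x) (g x))"
proof (rule rec2_comp[of cf], rule recI)
  have "y = cf p j \<longleftrightarrow> p \<in> PS \<and> (entry M p j y \<or> \<not> (\<exists>v. v \<^bold>< p \<and> entry M p j v) \<and> y = \<zero>)
      \<or> p \<notin> PS \<and> y = \<zero>" for y p j
  proof (cases "p \<in> PS")
    case True
    have e: "entry M p j v \<longleftrightarrow> j \<^bold>< plen p \<and> v = pc p j" for v by (rule poly_entry_iff[OF True])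
    have ex: "(\<exists>v. v \<^bold>< p \<and> entry M p j v) \<longleftrightarrow> j \<^bold>< plen p"
      using e entry_less(2) by blast
    show ?thesis
    proof (cases "j \<^bold>< plen p")
      case False
      then have "pc p j = \<zero>" using pc_beyond[OF True] num.not_less by blast
      then show ?thesis unfolding cf_def ex unfolding e using True False by simp
    qed (unfold cf_def ex, unfold e, use True in simp)
  qed (simp add: cf_def)
  then show "dec (\<lambda>z. psnd z = cf (pfst (pfst z)) (psnd (pfst z)))"
    by (simp only:) (intro rec_basic dec_entry dec_mem[OF PS_in])
qed

lemma rec_plen: "rec f \<Longrightarrow> rec (\<lambda>x. plen (f x))"
proof (rule rec_comp[of plen], rule recI)
  have "y = plen p \<longleftrightarrow> p \<in> PS \<and> is_seq M p y \<or> p \<notin> PS \<and> y = \<^bold>0" for y p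
    using is_seq_plen plen_eqI by (cases "p \<in> PS") (auto simp: plen_def)
  then show "dec (\<lambda>z. psnd z = plen (pfst z))"
    by (simp only:) (intro rec_basic dec_is_seq dec_mem[OF PS_in])
qed

section \<open>Coefficient functions of bounded support\<close>

definition pfuns :: "('a \<Rightarrow> 'a) set" where
  "pfuns = {c \<in> coefs. \<exists>N. \<forall>k. N \<^bold>\<le> k \<longrightarrow> c k = \<zero>}"

lemma cf_coefs [simp]: "cf p \<in> coefs"
  by (intro coefsI rec_cf rec_basic cf_closed)

lemma pc_eq_cf: "p \<in> PS \<Longrightarrow> pc p = cf p"
  by (auto simp: cf_def)

lemma pc_coefs [simp]: "p \<in> PS \<Longrightarrow> pc p \<in> coefs"
  using cf_coefs[of p] by (simp only: pc_eq_cf)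

lemma pc_pfuns: assumes p: "p \<in> PS" shows "pc p \<in> pfuns"
proof -
  have "\<forall>k. plen p \<^bold>\<le> k \<longrightarrow> pc p k = \<zero>" using pc_beyond[OF p] by blast
  then show ?thesis unfolding pfuns_def using pc_coefs[OF p] by blast
qed

lemma pfuns_coefs: "c \<in> pfuns \<Longrightarrow> c \<in> coefs"
  by (simp add: pfuns_def)

lemma poly_exists:
  assumes c: "c \<in> pfuns" shows "\<exists>p. p \<in> PS \<and> (\<forall>k. pc p k = c k)"
proof -
  obtain N where N: "\<And>k. N \<^bold>\<le> k \<Longrightarrow> c k = \<zero>" using c unfolding pfuns_def by blast
  have rc: "rec c" using c by (simp add: coefs_rec pfuns_coefs)
  \<comment> \<open>The length is the least number from which on \<open>c\<close> vanishes. The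
    bound \<open>N\<close> keeps this decidable, and nothing is lost, as \<open>c\<close> vanishes
    from \<open>N\<close> on.\<close>
  have "dec (\<lambda>l. \<forall>k. k \<^bold>< N \<longrightarrow> l \<^bold>\<le> k \<longrightarrow> c k = \<zero>)"
    by (intro rec_basic rec_comp[OF rc])
  from dec_least[OF this, of N] obtain l where
    l: "\<And>k. k \<^bold>< N \<Longrightarrow> l \<^bold>\<le> k \<Longrightarrow> c k = \<zero>" and least: "\<And>l'. l' \<^bold>< l \<Longrightarrow> \<exists>k. k \<^bold>< N \<and> l' \<^bold>\<le> k \<and> c k \<noteq> \<zero>"
    using num.not_less by blast
  have l0: "c k = \<zero>" if "l \<^bold>\<le> k" for k
    using that l N num.not_less by blast
  obtain p where p: "is_seq M p l" "\<And>j v. entry M p j v \<longleftrightarrow> j \<^bold>< l \<and> v = c j"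
    using seq_exists[OF rc, of l] by blast
  \<comment> \<open>By minimality of \<open>l\<close> some nonzero coefficient has an index at least
    \<open>j\<close>, and that index can only be \<open>j\<close>.\<close>
  have "c j \<noteq> \<zero>" if "l = j \<^bold>+ \<^bold>1" for j
  proof -
    obtain k where k: "j \<^bold>\<le> k" "c k \<noteq> \<zero>" using least[of j] \<open>l = j \<^bold>+ \<^bold>1\<close> by auto
    then have "\<not> j \<^bold>+ \<^bold>1 \<^bold>\<le> k" using l0 that by blast
    then have "k = j" using k(1) unfolding S_le_iff_less unfolding num_le_def by blast
    then show ?thesis using k by simp
  qed
  then have "\<forall>j. l = j \<^bold>+ \<^bold>1 \<longrightarrow> \<not> entry M p j \<zero>" using p(2) by auto
  moreover have "\<forall>j v. entry M p j v \<longrightarrow> v \<in> carrier R" using p(2) c pfuns_coefs by simp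
  ultimately have PS: "p \<in> PS" unfolding polys_def using p(1) by blast
  have pl: "plen p = l" using plen_eqI[OF PS p(1)] .
  have "pc p k = c k" for k
  proof (cases "k \<^bold>< l")
    case True
    then show ?thesis using p(2)[of k "c k"] poly_entry_iff[OF PS, of k "c k"] by simp
  next
    case False
    then show ?thesis using pc_beyond[OF PS, of k] l0[of k] pl by (simp add: num.not_less)
  qed
  with PS show ?thesis by blast
qed

text \<open>All operations of \<open>polynomial_ring\<close> are definite descriptions; this
  resolves them once their coefficients are known to be in \<open>pfuns\<close>.\<close>

lemma poly_with:
  assumes c: "c \<in> pfuns" and Q: "\<And>k v. Q k v \<longleftrightarrow> v = c k"
  shows "poly_with M R Q \<in> PS" "pc (poly_with M R Q) = c"
proof -
  have "\<exists>!p. p \<in> PS \<and> (\<forall>k. Q k (pc p k))"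
    using poly_exists[OF c] poly_eqI unfolding Q by (intro ex_ex1I) auto
  from theI'[OF this] show "poly_with M R Q \<in> PS" "pc (poly_with M R Q) = c"
    unfolding poly_with_def Q by auto
qed

text \<open>If \<open>i + (k - i) = k\<close> is at least \<open>n + m\<close>, then
  \<open>i\<close> reaches \<open>n\<close> or \<open>k - i\<close> reaches \<open>m\<close>, so
  each product has a zero factor.\<close>

lemma conv_beyond:
  assumes c: "c \<in> coefs" "\<And>k. n \<^bold>\<le> k \<Longrightarrow> c k = \<zero>" and d: "d \<in> coefs" "\<And>k. m \<^bold>\<le> k \<Longrightarrow> d k = \<zero>"
    and k: "n \<^bold>+ m \<^bold>\<le> k"
  shows "conv c d k = \<zero>"
  unfolding conv_def
proof (rule rsum_zero)
  fix i assume "i \<^bold>< k \<^bold>+ \<^bold>1"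
  then have i: "i \<^bold>+ (k \<^bold>- i) = k" by (simp add: less_S_iff_le add_sub)
  have "n \<^bold>\<le> i \<or> m \<^bold>\<le> k \<^bold>- i"
    using num.add_strict_mono[of i n "k \<^bold>- i" m] k unfolding i num.not_less[symmetric] by blast
  then show "c i \<otimes> d (k \<^bold>- i) = \<zero>" using c d by auto
qed (use c d in simp)

text \<open>Any index other than \<open>n\<close> pushes one of the two factors above its degree
  bound, so a single product survives.\<close>

lemma conv_lead:
  assumes c: "c \<in> coefs" "\<And>k. n \<^bold>< k \<Longrightarrow> c k = \<zero>" and d: "d \<in> coefs" "\<And>k. m \<^bold>< k \<Longrightarrow> d k = \<zero>"
  shows "conv c d (n \<^bold>+ m) = c n \<otimes> d m"
proof -
  have "conv c d (n \<^bold>+ m) = c n \<otimes> d (n \<^bold>+ m \<^bold>- n)"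
    unfolding conv_def
  proof (rule rsum_single)
    show "n \<^bold>< n \<^bold>+ m \<^bold>+ \<^bold>1" by (simp add: less_S_iff_le)
    fix i assume "i \<^bold>< n \<^bold>+ m \<^bold>+ \<^bold>1" "i \<noteq> n"
    then have i: "i \<^bold>+ (n \<^bold>+ m \<^bold>- i) = n \<^bold>+ m" "i \<^bold>< n \<or> n \<^bold>< i"
      using less_total[of i n] by (auto simp: less_S_iff_le add_sub)
    have "n \<^bold>< i \<or> m \<^bold>< n \<^bold>+ m \<^bold>- i"
      using i num.add_less_le_mono[of i n "n \<^bold>+ m \<^bold>- i" m] num.not_less less_irrefl by metis
    then show "c i \<otimes> d (n \<^bold>+ m \<^bold>- i) = \<zero>" using c d by auto
  qed (use c d in simp)
  then show ?thesis by (simp add: add_sub_cancel)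
qed

lemma coefs_delta: "a \<in> carrier R \<Longrightarrow> (\<lambda>k. if k = m then a else \<zero>) \<in> coefs"
  by (intro coefsI rec_basic) auto

lemma pfuns_delta: assumes "a \<in> carrier R" shows "(\<lambda>k. if k = m then a else \<zero>) \<in> pfuns"
proof -
  have "\<forall>k. m \<^bold>+ \<^bold>1 \<^bold>\<le> k \<longrightarrow> (if k = m then a else \<zero>) = \<zero>"
    unfolding S_le_iff_less using less_irrefl by auto
  then show ?thesis unfolding pfuns_def using coefs_delta[OF assms] by blast
qed

lemma pfuns_zero: "(\<lambda>_. \<zero>) \<in> pfuns"
  using pfuns_delta[of \<zero>] by simp

lemma pfuns_common:
  assumes "c \<in> pfuns" "d \<in> pfuns"
  obtains N where "\<And>k. N \<^bold>\<le> k \<Longrightarrow> c k = \<zero>" "\<And>k. N \<^bold>\<le> k \<Longrightarrow> d k = \<zero>"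
proof -
  obtain N N' where "\<And>k. N \<^bold>\<le> k \<Longrightarrow> c k = \<zero>" "\<And>k. N' \<^bold>\<le> k \<Longrightarrow> d k = \<zero>"
    using assms unfolding pfuns_def by blast
  then show ?thesis
    using that[of "N \<^bold>+ N'"] num.order_trans[OF le_add(1)] num.order_trans[OF le_add(2)] by blast
qed

lemma pfuns_add: assumes "c \<in> pfuns" "d \<in> pfuns" shows "(\<lambda>k. c k \<oplus> d k) \<in> pfuns"
proof -
  obtain N where "\<And>k. N \<^bold>\<le> k \<Longrightarrow> c k = \<zero>" "\<And>k. N \<^bold>\<le> k \<Longrightarrow> d k = \<zero>" using pfuns_common[OF assms] by blast
  then have "\<forall>k. N \<^bold>\<le> k \<longrightarrow> c k \<oplus> d k = \<zero>" by simp
  then show ?thesis using coefs_add assms unfolding pfuns_def by blast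
qed

lemma pfuns_smult: assumes a: "a \<in> carrier R" and c: "c \<in> pfuns" shows "(\<lambda>k. a \<otimes> c k) \<in> pfuns"
proof -
  obtain N where "\<forall>k. N \<^bold>\<le> k \<longrightarrow> c k = \<zero>" using c unfolding pfuns_def by blast
  then have "\<forall>k. N \<^bold>\<le> k \<longrightarrow> a \<otimes> c k = \<zero>" using a by simp
  then show ?thesis using coefs_mult[OF coefs_const[OF a]] c unfolding pfuns_def by blast
qed

lemma pfuns_conv: assumes "c \<in> pfuns" "d \<in> pfuns" shows "conv c d \<in> pfuns"
proof -
  obtain N where N: "\<And>k. N \<^bold>\<le> k \<Longrightarrow> c k = \<zero>" "\<And>k. N \<^bold>\<le> k \<Longrightarrow> d k = \<zero>" using pfuns_common[OF assms] by blast
  have "conv c d k = \<zero>" if "N \<^bold>+ N \<^bold>\<le> k" for k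
    using conv_beyond[of c N d N k] N that assms pfuns_coefs by blast
  then show ?thesis using coefs_conv assms unfolding pfuns_def by blast
qed

text \<open>The coded sequence in \<open>convolution\<close> must list the partial sums of
  \<open>rsum\<close>: induction along it shows this, and conversely \<open>rsum\<close> restricted
  to \<open>k + 2\<close> places, from the empty to the full sum of \<open>k + 1\<close> products,
  has a code.\<close>

lemma convolution_iff:
  assumes p: "p \<in> PS" and q: "q \<in> PS"
  shows "convolution M R p q k v \<longleftrightarrow> v = conv (pc p) (pc q) k"
proof -
  define h where "h = (\<lambda>i. pc p i \<otimes> pc q (k \<^bold>- i))"
  have h: "h \<in> coefs" unfolding h_def using p q by simp
  have step: "u \<oplus> pc p i \<otimes> pc q j = u \<oplus> h i" if "i \<^bold>+ j = k" for i j u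
    using that add_sub_cancel[of i j] by (simp add: h_def)
  show ?thesis
  proof
    assume "convolution M R p q k v"
    then obtain t where t: "is_seq M t (k \<^bold>+ \<^bold>1 \<^bold>+ \<^bold>1)" "entry M t \<^bold>0 \<zero>" "entry M t (k \<^bold>+ \<^bold>1) v"
      and ts: "\<And>i j u. i \<^bold>+ j = k \<Longrightarrow> entry M t i u \<Longrightarrow> entry M t (i \<^bold>+ \<^bold>1) (u \<oplus> h i)"
      unfolding convolution_def using step by metis
    have "i \<^bold>\<le> k \<^bold>+ \<^bold>1 \<longrightarrow> entry M t i (rsum h i)" for i
    proof (induction i rule: dec_induct)
      show "dec (\<lambda>i. i \<^bold>\<le> k \<^bold>+ \<^bold>1 \<longrightarrow> entry M t i (rsum h i))"
        by (intro rec_basic dec_entry rec_rsum_fixed h)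
      fix i assume IH: "i \<^bold>\<le> k \<^bold>+ \<^bold>1 \<longrightarrow> entry M t i (rsum h i)"
      show "i \<^bold>+ \<^bold>1 \<^bold>\<le> k \<^bold>+ \<^bold>1 \<longrightarrow> entry M t (i \<^bold>+ \<^bold>1) (rsum h (i \<^bold>+ \<^bold>1))"
      proof
        assume "i \<^bold>+ \<^bold>1 \<^bold>\<le> k \<^bold>+ \<^bold>1"
        then have i: "i \<^bold>< k \<^bold>+ \<^bold>1" by (simp only: S_le_iff_less)
        then have "i \<^bold>+ (k \<^bold>- i) = k" by (simp add: add_sub less_S_iff_le)
        from ts[OF this] IH i show "entry M t (i \<^bold>+ \<^bold>1) (rsum h (i \<^bold>+ \<^bold>1))"
          using h by (simp add: num.less_imp_le)
      qed
    qed (use t h in simp)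
    then have "entry M t (k \<^bold>+ \<^bold>1) (rsum h (k \<^bold>+ \<^bold>1))" using num.order_refl by blast
    from is_seq_entry(3)[OF t(1) t(3) this] show "v = conv (pc p) (pc q) k"
      by (simp only: conv_def h_def)
  next
    assume v: "v = conv (pc p) (pc q) k"
    have "rec (rsum h)" by (intro rec_rsum_fixed h rec_id)
    from seq_exists[OF this, of "k \<^bold>+ \<^bold>1 \<^bold>+ \<^bold>1"] obtain t where
      t: "is_seq M t (k \<^bold>+ \<^bold>1 \<^bold>+ \<^bold>1)" "\<And>j v. entry M t j v \<longleftrightarrow> j \<^bold>< k \<^bold>+ \<^bold>1 \<^bold>+ \<^bold>1 \<and> v = rsum h j" by blast
    have "entry M t (i \<^bold>+ \<^bold>1) (u \<oplus> pc p i \<otimes> pc q j)" if ij: "i \<^bold>+ j = k" and u: "entry M t i u" for i j u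
    proof -
      have "i \<^bold>\<le> k" using ij le_add(1) by blast
      then have "i \<^bold>+ \<^bold>1 \<^bold>< k \<^bold>+ \<^bold>1 \<^bold>+ \<^bold>1" by (simp add: less_S_iff_le)
      then show ?thesis using u h unfolding step[OF ij] t(2) by simp
    qed
    moreover have "entry M t \<^bold>0 \<zero>" using h by (simp add: t(2) zero_less)
    moreover have "entry M t (k \<^bold>+ \<^bold>1) v" unfolding t(2) v conv_def h_def by simp
    ultimately show "convolution M R p q k v" unfolding convolution_def using t(1) by blast
  qed
qed

section \<open>The ring operations on codes\<close>

abbreviation "RX \<equiv> polynomial_ring M R"

lemma carrier_RX [simp]: "carrier RX = PS"
  by (simp add: polynomial_ring_def)

lemma
  assumes "p \<in> PS" "q \<in> PS"
  shows add_RX [simp]: "p \<oplus>\<^bsub>RX\<^esub> q \<in> PS" "pc (p \<oplus>\<^bsub>RX\<^esub> q) = (\<lambda>k. pc p k \<oplus> pc q k)"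
    and mult_RX [simp]: "p \<otimes>\<^bsub>RX\<^esub> q \<in> PS" "pc (p \<otimes>\<^bsub>RX\<^esub> q) = conv (pc p) (pc q)"
  using poly_with[OF pfuns_add[OF pc_pfuns pc_pfuns, OF assms] refl]
    poly_with[OF pfuns_conv[OF pc_pfuns pc_pfuns, OF assms] convolution_iff[OF assms]]
  by (simp_all add: polynomial_ring_def)

lemma
  shows zero_RX [simp]: "\<zero>\<^bsub>RX\<^esub> \<in> PS" "pc \<zero>\<^bsub>RX\<^esub> = (\<lambda>_. \<zero>)"
    and one_RX [simp]: "\<one>\<^bsub>RX\<^esub> \<in> PS" "pc \<one>\<^bsub>RX\<^esub> = (\<lambda>k. if k = \<^bold>0 then \<one> else \<zero>)"
  using poly_with[OF pfuns_zero refl] poly_with[OF pfuns_delta[of \<one> "\<^bold>0"] refl]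
  by (simp_all add: polynomial_ring_def)

lemma eq_zero_RX_iff: "p \<in> PS \<Longrightarrow> p = \<zero>\<^bsub>RX\<^esub> \<longleftrightarrow> plen p = \<^bold>0"
proof -
  assume p: "p \<in> PS"
  have "plen p = \<^bold>0 \<longleftrightarrow> plen p \<^bold>\<le> \<^bold>0" by (auto simp: num_le_def)
  then show ?thesis unfolding plen_le_iff[OF p] using poly_eqI[OF p zero_RX(1)] by auto
qed

lemma nonzero_RX_lead:
  assumes "p \<in> PS" "p \<noteq> \<zero>\<^bsub>RX\<^esub>"
  obtains n where "plen p = n \<^bold>+ \<^bold>1" "pc p n \<noteq> \<zero>" "\<And>k. n \<^bold>< k \<Longrightarrow> pc p k = \<zero>"
proof -
  obtain n where n: "plen p = n \<^bold>+ \<^bold>1" using assms eq_zero_RX_iff zero_or_S by blast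
  then show ?thesis using that[of n] pc_lead[OF assms(1) n] pc_beyond[OF assms(1)] by (simp add: S_le_iff_less)
qed

lemma conv_one: assumes c: "c \<in> coefs" shows "conv (\<lambda>k. if k = \<^bold>0 then \<one> else \<zero>) c = c"
proof
  fix k
  have "conv (\<lambda>k. if k = \<^bold>0 then \<one> else \<zero>) c k = (if \<^bold>0 = \<^bold>0 then \<one> else \<zero>) \<otimes> c (k \<^bold>- \<^bold>0)"
    unfolding conv_def using c coefs_delta[of \<one> "\<^bold>0"]
    by (intro rsum_single) (auto simp: zero_less intro: coefs_mult)
  then show "conv (\<lambda>k. if k = \<^bold>0 then \<one> else \<zero>) c k = c k" using c by simp
qed

text \<open>Each law is checked on coefficients, where it is a law of pointwise sums or of
  \<open>conv\<close>. Zero divisors are excluded by the product of the leading coefficients, found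
  at the sum of the degrees.\<close>

lemma domain_RX: "domain RX"
proof (intro domain.intro domain_axioms.intro)
  show "cring RX"
  proof (rule cringI)
    show "abelian_group RX"
    proof (rule abelian_groupI)
      fix p assume p: "p \<in> carrier RX"
      then have "(\<lambda>k. \<ominus> \<one> \<otimes> pc p k) \<in> pfuns" by (intro pfuns_smult pc_pfuns) simp_all
      then obtain q where q: "q \<in> PS" "\<And>k. pc q k = \<ominus> \<one> \<otimes> pc p k" using poly_exists by blast
      have "q \<oplus>\<^bsub>RX\<^esub> p = \<zero>\<^bsub>RX\<^esub>"
        using p q by (rule_tac poly_eqI) (simp_all add: R.l_minus R.l_neg)
      then show "\<exists>q\<in>carrier RX. q \<oplus>\<^bsub>RX\<^esub> p = \<zero>\<^bsub>RX\<^esub>" using q by auto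
    next
      fix p q r assume "p \<in> carrier RX" "q \<in> carrier RX" "r \<in> carrier RX"
      then show "p \<oplus>\<^bsub>RX\<^esub> q \<oplus>\<^bsub>RX\<^esub> r = p \<oplus>\<^bsub>RX\<^esub> (q \<oplus>\<^bsub>RX\<^esub> r)"
        by (rule_tac poly_eqI) (simp_all add: R.a_assoc)
    next
      fix p q assume "p \<in> carrier RX" "q \<in> carrier RX"
      then show "p \<oplus>\<^bsub>RX\<^esub> q = q \<oplus>\<^bsub>RX\<^esub> p"
        by (rule_tac poly_eqI) (simp_all add: R.a_comm)
    next
      fix p assume "p \<in> carrier RX"
      then show "\<zero>\<^bsub>RX\<^esub> \<oplus>\<^bsub>RX\<^esub> p = p"
        by (rule_tac poly_eqI) simp_all
    qed simp_all
    show "comm_monoid RX"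
    proof (rule comm_monoidI)
      fix p q r assume "p \<in> carrier RX" "q \<in> carrier RX" "r \<in> carrier RX"
      then show "p \<otimes>\<^bsub>RX\<^esub> q \<otimes>\<^bsub>RX\<^esub> r = p \<otimes>\<^bsub>RX\<^esub> (q \<otimes>\<^bsub>RX\<^esub> r)"
        by (rule_tac poly_eqI) (simp_all add: conv_assoc)
    next
      fix p q assume pq: "p \<in> carrier RX" "q \<in> carrier RX"
      then have "conv (pc p) (pc q) = conv (pc q) (pc p)" by (intro conv_comm) simp_all
      with pq show "p \<otimes>\<^bsub>RX\<^esub> q = q \<otimes>\<^bsub>RX\<^esub> p"
        by (rule_tac poly_eqI) simp_all
    next
      fix p assume "p \<in> carrier RX"
      then show "\<one>\<^bsub>RX\<^esub> \<otimes>\<^bsub>RX\<^esub> p = p"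
        by (rule_tac poly_eqI) (simp_all add: conv_one)
    qed simp_all
    fix p q r assume pqr: "p \<in> carrier RX" "q \<in> carrier RX" "r \<in> carrier RX"
    then show "(p \<oplus>\<^bsub>RX\<^esub> q) \<otimes>\<^bsub>RX\<^esub> r = p \<otimes>\<^bsub>RX\<^esub> r \<oplus>\<^bsub>RX\<^esub> q \<otimes>\<^bsub>RX\<^esub> r"
      by (rule_tac poly_eqI) (simp_all add: conv_comm[of _ "pc r"] conv_add)
  qed
  show "\<one>\<^bsub>RX\<^esub> \<noteq> \<zero>\<^bsub>RX\<^esub>"
  proof
    assume "\<one>\<^bsub>RX\<^esub> = \<zero>\<^bsub>RX\<^esub>"
    then have "pc \<one>\<^bsub>RX\<^esub> \<^bold>0 = pc \<zero>\<^bsub>RX\<^esub> \<^bold>0" by simp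
    then show False by simp
  qed
  fix p q assume pq: "p \<otimes>\<^bsub>RX\<^esub> q = \<zero>\<^bsub>RX\<^esub>" "p \<in> carrier RX" "q \<in> carrier RX"
  show "p = \<zero>\<^bsub>RX\<^esub> \<or> q = \<zero>\<^bsub>RX\<^esub>"
  proof (rule ccontr)
    assume n: "\<not> ?thesis"
    obtain n m where nm: "pc p n \<noteq> \<zero>" "\<And>k. n \<^bold>< k \<Longrightarrow> pc p k = \<zero>"
        "pc q m \<noteq> \<zero>" "\<And>k. m \<^bold>< k \<Longrightarrow> pc q k = \<zero>"
      using pq n nonzero_RX_lead[of p] nonzero_RX_lead[of q] by (metis carrier_RX)
    have "pc (p \<otimes>\<^bsub>RX\<^esub> q) (n \<^bold>+ m) = pc p n \<otimes> pc q m"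
      using conv_lead[of "pc p" n "pc q" m] nm(2,4) pq(2,3) by simp
    then have "pc p n \<otimes> pc q m = \<zero>" unfolding pq(1) by simp
    then show False using R.integral[of "pc p n" "pc q m"] nm(1,3) pq(2,3) by simp
  qed
qed

lemma cf_beyond: "p \<^bold>\<le> k \<Longrightarrow> cf p k = \<zero>"
  unfolding cf_def using pc_beyond plen_le num.order_trans by metis

text \<open>To decide \<open>r = op p q\<close> it suffices to compare the coefficients below
  \<open>p + q + r\<close>: a code bounds its own length, so from there on both sides vanish. The
  description operator in \<open>op\<close> is thereby avoided.\<close>

lemma fun2_in_RX:
  assumes F: "\<And>f g h. rec f \<Longrightarrow> rec g \<Longrightarrow> rec h \<Longrightarrow> rec (\<lambda>x. F (f x) (g x) (h x))"
    and 0: "\<And>p q k. p \<^bold>+ q \<^bold>\<le> k \<Longrightarrow> F p q k = \<zero>"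
    and op: "\<And>p q. p \<in> PS \<Longrightarrow> q \<in> PS \<Longrightarrow> op p q \<in> PS"
      "\<And>p q k. p \<in> PS \<Longrightarrow> q \<in> PS \<Longrightarrow> pc (op p q) k = F p q k"
  shows "fun2_in M PS op"
proof -
  let ?D = "\<lambda>z. is_pair z \<and> is_pair (pfst z) \<and> pfst (pfst z) \<in> PS \<and> psnd (pfst z) \<in> PS \<and> psnd z \<in> PS \<and>
    (\<forall>k. k \<^bold>< pfst (pfst z) \<^bold>+ psnd (pfst z) \<^bold>+ psnd z \<longrightarrow> cf (psnd z) k = F (pfst (pfst z)) (psnd (pfst z)) k)"
  have D: "dec ?D"
    by (intro rec_basic dec_is_pair dec_mem[OF PS_in] rec_cf F)
  have eq: "r = op p q \<longleftrightarrow> (\<forall>k. k \<^bold>< p \<^bold>+ q \<^bold>+ r \<longrightarrow> cf r k = F p q k)"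
    if p: "p \<in> PS" and q: "q \<in> PS" and r: "r \<in> PS" for p q r
  proof
    show "r = op p q \<Longrightarrow> \<forall>k. k \<^bold>< p \<^bold>+ q \<^bold>+ r \<longrightarrow> cf r k = F p q k"
      using op that by (simp add: cf_def)
    assume *: "\<forall>k. k \<^bold>< p \<^bold>+ q \<^bold>+ r \<longrightarrow> cf r k = F p q k"
    show "r = op p q"
    proof (rule poly_eqI[OF r op(1)[OF p q]])
      fix k
      have "cf r k = F p q k" if "p \<^bold>+ q \<^bold>+ r \<^bold>\<le> k"
        using 0[OF num.order_trans[OF le_add(1) that]] cf_beyond[OF num.order_trans[OF le_add(2) that]] by simp
      with * have "cf r k = F p q k" using num.not_less by blast
      then show "pc r k = pc (op p q) k" using op p q r by (simp add: cf_def)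
    qed
  qed
  have D_iff: "?D \<langle>\<langle>p, q\<rangle>, r\<rangle> \<longleftrightarrow> p \<in> PS \<and> q \<in> PS \<and> r = op p q" for p q r
    using eq[of p q r] op(1)[of p q] unfolding pfst_pair psnd_pair by (simp only: is_pair_pair) blast
  have "z \<in> {\<langle>\<langle>a, b\<rangle>, op a b\<rangle> | a b. a \<in> PS \<and> b \<in> PS} \<longleftrightarrow> ?D z" for z
  proof (cases "is_pair z \<and> is_pair (pfst z)")
    case True
    then obtain p q r where z: "z = \<langle>\<langle>p, q\<rangle>, r\<rangle>" by (metis is_pairE pfst_pair)
    show ?thesis unfolding z D_iff by auto
  qed auto
  then have "{\<langle>\<langle>a, b\<rangle>, op a b\<rangle> | a b. a \<in> PS \<and> b \<in> PS} = Collect ?D" by blast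
  then show ?thesis using D unfolding fun2_in_def dec_def by simp
qed

lemma countable_domain_RX: "countable_domain M RX"
proof -
  have "fun2_in M PS (add RX)"
  proof (rule fun2_in_RX[where F = "\<lambda>p q k. cf p k \<oplus> cf q k"])
    show "p \<^bold>+ q \<^bold>\<le> k \<Longrightarrow> cf p k \<oplus> cf q k = \<zero>" for p q k
      using cf_beyond num.order_trans[OF le_add(1)] num.order_trans[OF le_add(2)] by (metis R.l_zero R.zero_closed)
  qed (simp_all add: rec_radd rec_cf pc_eq_cf[symmetric])
  moreover have "fun2_in M PS (mult RX)"
  proof (rule fun2_in_RX[where F = "\<lambda>p q k. conv (cf p) (cf q) k"])
    show "p \<^bold>+ q \<^bold>\<le> k \<Longrightarrow> conv (cf p) (cf q) k = \<zero>" for p q k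
      by (rule conv_beyond[of _ p _ q]) (simp_all add: cf_beyond)
    show "rec (\<lambda>x. conv (cf (f x)) (cf (g x)) (h x))" if fgh: "rec f" "rec g" "rec h" for f g h
      unfolding conv_def
      by (intro rec_rsum rec_rmult rec_cf rec_basic rec_sub cf_closed fgh
          rec_comp[OF fgh(1)] rec_comp[OF fgh(2)] rec_comp[OF fgh(3)])
  qed (simp_all add: pc_eq_cf[symmetric])
  ultimately show ?thesis unfolding countable_domain_def using domain_RX PS_in by simp
qed

end

subsection \<open>The three implications\<close>

context rca0 begin

section \<open>Generators of ideals in Euclidean domains\<close>

lemma euclidean_imp_sigma1_PID:
  assumes "euclidean_dom M S" shows "sigma1_PID M S"
proof -
  have cd: "countable_domain M S" using assms by (simp add: euclidean_dom_def)
  then interpret S: domain S by (simp add: countable_domain_def)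
  obtain f where f: "fun1_in M (carrier S - {\<zero>\<^bsub>S\<^esub>}) f"
    and div: "\<And>a d. a \<in> carrier S \<Longrightarrow> d \<in> carrier S \<Longrightarrow> d \<noteq> \<zero>\<^bsub>S\<^esub> \<Longrightarrow>
      \<exists>q\<in>carrier S. \<exists>r\<in>carrier S. a = d \<otimes>\<^bsub>S\<^esub> q \<oplus>\<^bsub>S\<^esub> r \<and> (r \<noteq> \<zero>\<^bsub>S\<^esub> \<longrightarrow> f r \<^bold>< f d)"
    using assms unfolding euclidean_dom_def by blast
  \<comment> \<open>Off the nonzero elements \<open>f\<close> is arbitrary, so its graph on them is
    used as a set instead of \<open>f\<close> as a function.\<close>
  let ?G = "{\<langle>z, f z\<rangle> | z. z \<in> carrier S - {\<zero>\<^bsub>S\<^esub>}}"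
  have G: "?G \<in> \<U>" using f by (simp add: fun1_in_def)
  have "\<exists>c\<in>carrier S. range a = {c \<otimes>\<^bsub>S\<^esub> r | r. r \<in> carrier S}" if a: "sigma1_ideal M S a" for a
  proof -
    have ra: "rec a" and ac: "\<And>i. a i \<in> carrier S"
      using a by (auto simp: sigma1_ideal_def rec_iff_fun1_in)
    have ideal: "\<exists>k. a k = a i \<otimes>\<^bsub>S\<^esub> r \<oplus>\<^bsub>S\<^esub> a j \<otimes>\<^bsub>S\<^esub> s" if "r \<in> carrier S" "s \<in> carrier S" for i j r s
      using a that unfolding sigma1_ideal_def by blast
    have G_iff: "\<langle>a k, n\<rangle> \<in> ?G \<longleftrightarrow> a k \<noteq> \<zero>\<^bsub>S\<^esub> \<and> n = f (a k)" for k n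
      using ac by auto
    show ?thesis
    proof (cases "\<exists>k. a k \<noteq> \<zero>\<^bsub>S\<^esub>")
      case False
      then have "range a = {\<zero>\<^bsub>S\<^esub>}" by auto
      also have "\<dots> = {\<zero>\<^bsub>S\<^esub> \<otimes>\<^bsub>S\<^esub> r | r. r \<in> carrier S}" using S.zero_closed by force
      finally show ?thesis by blast
    next
      case True
      then obtain k0 where "\<langle>a k0, f (a k0)\<rangle> \<in> ?G" using G_iff by blast
      \<comment> \<open>The index of an ideal element attaining the value is an unbounded witness,
        so the minimum is taken over a Sigma^0_1 predicate.\<close>
      moreover have "dec (\<lambda>z. \<langle>a (psnd z), pfst z\<rangle> \<in> ?G)"
        by (intro dec_mem[OF G] rec_basic rec_comp[OF ra])
      ultimately obtain k n where "\<langle>a k, n\<rangle> \<in> ?G" and "\<And>n' k'. n' \<^bold>< n \<Longrightarrow> \<langle>a k', n'\<rangle> \<notin> ?G"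
        using sigma_least[of "\<lambda>n k. \<langle>a k, n\<rangle> \<in> ?G"] by blast
      then have k: "a k \<noteq> \<zero>\<^bsub>S\<^esub>" and least: "\<And>k'. a k' \<noteq> \<zero>\<^bsub>S\<^esub> \<Longrightarrow> \<not> f (a k') \<^bold>< f (a k)"
        unfolding G_iff by blast+
      have "range a = {a k \<otimes>\<^bsub>S\<^esub> r | r. r \<in> carrier S}"
      proof
        show "range a \<subseteq> {a k \<otimes>\<^bsub>S\<^esub> r | r. r \<in> carrier S}"
        proof
          fix x assume "x \<in> range a"
          then obtain i where x: "x = a i" by blast
          obtain q r where q: "q \<in> carrier S" and r: "r \<in> carrier S" and
            eq: "a i = a k \<otimes>\<^bsub>S\<^esub> q \<oplus>\<^bsub>S\<^esub> r" and small: "r \<noteq> \<zero>\<^bsub>S\<^esub> \<longrightarrow> f r \<^bold>< f (a k)"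
            using div[OF ac ac k] by blast
          \<comment> \<open>The remainder is a combination of two ideal elements with the
            coefficients 1 and \<open>- q\<close>, hence again enumerated.\<close>
          have "a i \<otimes>\<^bsub>S\<^esub> \<one>\<^bsub>S\<^esub> \<oplus>\<^bsub>S\<^esub> a k \<otimes>\<^bsub>S\<^esub> (\<ominus>\<^bsub>S\<^esub> q) = r"
            unfolding eq using ac q r by (simp add: S.r_minus S.a_ac S.r_neg1 S.r_neg)
          then obtain k' where "a k' = r" using ideal[of "\<one>\<^bsub>S\<^esub>" "\<ominus>\<^bsub>S\<^esub> q" i k] q by auto
          then have "r = \<zero>\<^bsub>S\<^esub>" using least small by blast
          then show "x \<in> {a k \<otimes>\<^bsub>S\<^esub> r | r. r \<in> carrier S}" using eq x ac q by auto
        qed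
        show "{a k \<otimes>\<^bsub>S\<^esub> r | r. r \<in> carrier S} \<subseteq> range a"
        proof clarify
          fix r assume r: "r \<in> carrier S"
          obtain k' where "a k' = a k \<otimes>\<^bsub>S\<^esub> r \<oplus>\<^bsub>S\<^esub> a k \<otimes>\<^bsub>S\<^esub> \<zero>\<^bsub>S\<^esub>"
            using ideal[OF r S.zero_closed] by blast
          then show "a k \<otimes>\<^bsub>S\<^esub> r \<in> range a" using r ac by (auto intro: range_eqI[of _ a k'])
        qed
      qed
      then show ?thesis using ac by blast
    qed
  qed
  then show ?thesis using cd by (simp add: sigma1_PID_def)
qed

end

context rca0_domain begin

section \<open>Division with remainder over a field\<close>

text \<open>Here \<open>n\<close> and \<open>m\<close> bound degrees, not lengths.
  \<open>conv_beyond\<close> with the lengths \<open>n + 1\<close> and \<open>m + 1\<close> would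
  leave the index \<open>n + m + 1\<close> open, and the remainder would not be seen to
  shrink.\<close>

lemma conv_above:
  assumes c: "c \<in> coefs" "\<And>k. n \<^bold>< k \<Longrightarrow> c k = \<zero>" and d: "d \<in> coefs" "\<And>k. m \<^bold>< k \<Longrightarrow> d k = \<zero>"
    and k: "n \<^bold>+ m \<^bold>< k"
  shows "conv c d k = \<zero>"
  unfolding conv_def
proof (rule rsum_zero)
  fix i assume "i \<^bold>< k \<^bold>+ \<^bold>1"
  then have i: "i \<^bold>+ (k \<^bold>- i) = k" by (simp add: less_S_iff_le add_sub)
  have "n \<^bold>< i \<or> m \<^bold>< k \<^bold>- i"
    using num.add_mono[of i n "k \<^bold>- i" m] k unfolding i num.not_less[symmetric] by blast
  then show "c i \<otimes> d (k \<^bold>- i) = \<zero>" using c d by auto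
qed (use c d in simp)

lemma poly_division:
  assumes "field R" and a: "a \<in> PS" and d: "d \<in> PS" "d \<noteq> \<zero>\<^bsub>RX\<^esub>"
  shows "\<exists>q\<in>PS. \<exists>r\<in>PS. a = d \<otimes>\<^bsub>RX\<^esub> q \<oplus>\<^bsub>RX\<^esub> r \<and> (r \<noteq> \<zero>\<^bsub>RX\<^esub> \<longrightarrow> plen r \<^bold>< plen d)"
proof -
  interpret K: field R by fact
  interpret RX: domain RX by (rule domain_RX)
  have add: "fun2_in M PS (add RX)" and mult: "fun2_in M PS (mult RX)"
    using countable_domain_RX by (auto simp: countable_domain_def)
  \<comment> \<open>Total versions of the ring operations, so that the relation to be minimised is
    decidable for all arguments.\<close>
  define ta where "ta p q = (if p \<in> PS \<and> q \<in> PS then p \<oplus>\<^bsub>RX\<^esub> q else \<zero>\<^bsub>RX\<^esub>)" for p q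
  define tm where "tm p q = (if p \<in> PS \<and> q \<in> PS then p \<otimes>\<^bsub>RX\<^esub> q else \<zero>\<^bsub>RX\<^esub>)" for p q
  let ?P = "\<lambda>m q r. q \<in> PS \<and> r \<in> PS \<and> m = plen r \<and> a = ta (tm d q) r"
  have "dec (\<lambda>z. ?P (pfst z) (pfst (psnd z)) (psnd (psnd z)))"
    unfolding ta_def tm_def
    by (intro rec_basic dec_mem[OF PS_in] rec_plen rec_fun2_total[OF PS_in add] rec_fun2_total[OF PS_in mult])
  \<comment> \<open>The search is nonempty: quotient 0 and remainder \<open>a\<close>.\<close>
  moreover have "?P (plen a) \<zero>\<^bsub>RX\<^esub> a" using a d by (simp add: ta_def tm_def)
  ultimately obtain m z where "?P m (pfst z) (psnd z)"
    and "\<And>m' z'. m' \<^bold>< m \<Longrightarrow> \<not> ?P m' (pfst z') (psnd z')"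
    using sigma_least[of "\<lambda>m z. ?P m (pfst z) (psnd z)" "plen a" "\<langle>\<zero>\<^bsub>RX\<^esub>, a\<rangle>"] by auto
  then obtain q r where q: "q \<in> PS" and r: "r \<in> PS" and eq: "a = d \<otimes>\<^bsub>RX\<^esub> q \<oplus>\<^bsub>RX\<^esub> r"
    and least: "\<And>q' r'. plen r' \<^bold>< plen r \<Longrightarrow> \<not> ?P (plen r') q' r'"
    using d(1) by (auto simp: ta_def tm_def) (metis pfst_pair psnd_pair)
  have "plen r \<^bold>< plen d" if nz: "r \<noteq> \<zero>\<^bsub>RX\<^esub>"
  proof (rule ccontr)
    assume ge: "\<not> plen r \<^bold>< plen d"
    obtain n where n: "plen r = n \<^bold>+ \<^bold>1" "pc r n \<noteq> \<zero>" "\<And>k. n \<^bold>< k \<Longrightarrow> pc r k = \<zero>"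
      using nonzero_RX_lead[OF r nz] by blast
    obtain m where m: "plen d = m \<^bold>+ \<^bold>1" "pc d m \<noteq> \<zero>" "\<And>k. m \<^bold>< k \<Longrightarrow> pc d k = \<zero>"
      using nonzero_RX_lead[OF d] by blast
    have "m \<^bold>\<le> n" using ge n(1) m(1) by (simp add: num.not_less)
    then obtain e where e: "n = m \<^bold>+ e" unfolding le_iff_add by blast
    \<comment> \<open>Chosen so that the monomial \<open>t\<close> with coefficient \<open>c\<close>
      and degree \<open>e = n - m\<close> makes \<open>d t\<close> cancel the leading term of
      \<open>r\<close>.\<close>
    define c where "c = \<ominus> (inv (pc d m) \<otimes> pc r n)"
    have inv: "inv (pc d m) \<in> carrier R" "pc d m \<otimes> inv (pc d m) = \<one>"
      using m(2) d(1) K.field_Units by auto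
    have c: "c \<in> carrier R" "pc d m \<otimes> c = \<ominus> pc r n"
      using inv d(1) r by (simp_all add: c_def R.r_minus R.m_assoc[symmetric])
    obtain t where t: "t \<in> PS" "\<And>k. pc t k = (if k = e then c else \<zero>)"
      using poly_exists[OF pfuns_delta[OF c(1)]] by blast
    have t0: "e \<^bold>< k \<Longrightarrow> pc t k = \<zero>" for k using t(2) less_irrefl by auto
    define r' where "r' = r \<oplus>\<^bsub>RX\<^esub> d \<otimes>\<^bsub>RX\<^esub> t"
    have r': "r' \<in> PS" using r d(1) t(1) by (simp add: r'_def)
    have "pc r' k = \<zero>" if k: "n \<^bold>\<le> k" for k
    proof (cases "k = n")
      case True
      have "conv (pc d) (pc t) (m \<^bold>+ e) = pc d m \<otimes> pc t e"
        using conv_lead[of "pc d" m "pc t" e] m(3) t0 pc_coefs d(1) t(1) by blast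
      then show ?thesis using True r d(1) t c(2) by (simp add: r'_def e R.r_neg)
    next
      case False
      with k have "n \<^bold>< k" by (simp add: num_le_def)
      then have "conv (pc d) (pc t) k = \<zero>"
        using conv_above[of "pc d" m "pc t" e k] m(3) t0 pc_coefs d(1) t(1) e by blast
      then show ?thesis using \<open>n \<^bold>< k\<close> n(3) r d(1) t(1) by (simp add: r'_def)
    qed
    then have "plen r' \<^bold>\<le> n" unfolding plen_le_iff[OF r'] by blast
    then have "plen r' \<^bold>< plen r" unfolding n(1) less_S_iff_le .
    \<comment> \<open>Adding \<open>d t\<close> to the remainder is compensated by subtracting
      \<open>t\<close> from the quotient.\<close>
    moreover have "a = d \<otimes>\<^bsub>RX\<^esub> (q \<oplus>\<^bsub>RX\<^esub> \<ominus>\<^bsub>RX\<^esub> t) \<oplus>\<^bsub>RX\<^esub> r'"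
    proof -
      have cl: "d \<otimes>\<^bsub>RX\<^esub> q \<in> carrier RX" "d \<otimes>\<^bsub>RX\<^esub> t \<in> carrier RX" "r \<in> carrier RX"
          "d \<in> carrier RX" "q \<in> carrier RX" "t \<in> carrier RX"
        using d(1) q t(1) r by auto
      then have "d \<otimes>\<^bsub>RX\<^esub> (q \<oplus>\<^bsub>RX\<^esub> \<ominus>\<^bsub>RX\<^esub> t) \<oplus>\<^bsub>RX\<^esub> r' =
          d \<otimes>\<^bsub>RX\<^esub> q \<oplus>\<^bsub>RX\<^esub> (\<ominus>\<^bsub>RX\<^esub> (d \<otimes>\<^bsub>RX\<^esub> t) \<oplus>\<^bsub>RX\<^esub> (d \<otimes>\<^bsub>RX\<^esub> t \<oplus>\<^bsub>RX\<^esub> r))"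
        unfolding r'_def by (simp only: RX.r_distr RX.r_minus RX.a_assoc RX.a_closed RX.a_inv_closed RX.m_closed
            RX.a_comm[of r])
      also have "\<dots> = a" unfolding eq using cl by (simp only: RX.r_neg1)
      finally show ?thesis ..
    qed
    moreover have "q \<oplus>\<^bsub>RX\<^esub> \<ominus>\<^bsub>RX\<^esub> t \<in> PS" using q t(1) RX.a_inv_closed[of t] by simp
    ultimately show False
      using least[of r' "q \<oplus>\<^bsub>RX\<^esub> \<ominus>\<^bsub>RX\<^esub> t"] r' d(1) by (simp add: ta_def tm_def)
  qed
  then show ?thesis using q r eq by blast
qed

lemma field_imp_euclidean:
  assumes "field R" shows "euclidean_dom M RX"
proof -
  have "dec (\<lambda>z. is_pair z \<and> pfst z \<in> PS \<and> pfst z \<noteq> \<zero>\<^bsub>RX\<^esub> \<and> psnd z = plen (pfst z))"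
    by (intro rec_basic dec_is_pair dec_mem[OF PS_in] rec_plen)
  moreover have "{\<langle>a, plen a\<rangle> | a. a \<in> PS - {\<zero>\<^bsub>RX\<^esub>}} =
      Collect (\<lambda>z. is_pair z \<and> pfst z \<in> PS \<and> pfst z \<noteq> \<zero>\<^bsub>RX\<^esub> \<and> psnd z = plen (pfst z))"
    by (auto simp: is_pair_def)
  ultimately have "fun1_in M (carrier RX - {\<zero>\<^bsub>RX\<^esub>}) plen"
    unfolding fun1_in_def dec_def by simp
  then show ?thesis
    using poly_division[OF assms] countable_domain_RX unfolding euclidean_dom_def carrier_RX by blast
qed

section \<open>Inverses from principal ideals\<close>

lemma conv_0: assumes "c \<in> coefs" "d \<in> coefs" shows "conv c d \<^bold>0 = c \<^bold>0 \<otimes> d \<^bold>0"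
proof -
  have "conv c d \<^bold>0 = c \<^bold>0 \<otimes> d (\<^bold>0 \<^bold>- \<^bold>0)"
    unfolding conv_def by (rule rsum_single) (use assms in simp_all)
  then show ?thesis by simp
qed

text \<open>
  In the ideal \<open>(a, X)\<close>, enumerated as the polynomials with constant coefficient in \<open>a R\<close>, a
  generator \<open>g\<close> divides \<open>a\<close> and so is constant; it divides \<open>X\<close> and so is a unit, while
  its constant coefficient is a multiple of \<open>a\<close>.
\<close>
lemma sigma1_PID_imp_unit:
  assumes PID: "sigma1_PID M RX" and a: "a \<in> carrier R" "a \<noteq> \<zero>"
  shows "\<exists>b\<in>carrier R. a \<otimes> b = \<one>"
proof -
  interpret RX: domain RX by (rule domain_RX)
  define I where "I = {g \<in> PS. \<exists>c\<in>carrier R. pc g \<^bold>0 = a \<otimes> c}"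
  \<comment> \<open>An index packs a cofactor \<open>c\<close> with a polynomial, so the unbounded
    search for \<open>c\<close> in \<open>I\<close> turns into a decidable test. Indices that fail
    it yield 0, which lies in \<open>I\<close>.\<close>
  define e where "e n = (if psnd n \<in> PS \<and> pfst n \<in> carrier R \<and> cf (psnd n) \<^bold>0 =
    (if a \<in> carrier R \<and> pfst n \<in> carrier R then a \<otimes> pfst n else \<zero>) then psnd n else \<zero>\<^bsub>RX\<^esub>)" for n
  have "rec e"
    unfolding e_def
    by (intro rec_basic dec_mem[OF PS_in] dec_mem[OF carrier_in] rec_cf rec_fun2_total[OF carrier_in mult_in])
  have "\<zero>\<^bsub>RX\<^esub> \<in> I"
    using a by (auto simp: I_def intro!: bexI[of _ \<zero>])
  then have e_in: "e n \<in> I" for n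
    unfolding e_def using a by (auto simp: I_def cf_def)
  have "g \<in> range e" if g: "g \<in> I" for g
  proof -
    obtain c where "c \<in> carrier R" "pc g \<^bold>0 = a \<otimes> c" "g \<in> PS" using g by (auto simp: I_def)
    then have "e \<langle>c, g\<rangle> = g" using a by (simp add: e_def cf_def)
    then show ?thesis by (metis rangeI)
  qed
  with e_in have range: "range e = I" by blast
  have I_comb: "p \<otimes>\<^bsub>RX\<^esub> r \<oplus>\<^bsub>RX\<^esub> q \<otimes>\<^bsub>RX\<^esub> s \<in> I" if "p \<in> I" "q \<in> I" "r \<in> PS" "s \<in> PS" for p q r s
  proof -
    obtain c where c: "c \<in> carrier R" "pc p \<^bold>0 = a \<otimes> c" "p \<in> PS"
      using \<open>p \<in> I\<close> by (auto simp: I_def)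
    obtain c' where c': "c' \<in> carrier R" "pc q \<^bold>0 = a \<otimes> c'" "q \<in> PS"
      using \<open>q \<in> I\<close> by (auto simp: I_def)
    have "pc (p \<otimes>\<^bsub>RX\<^esub> r \<oplus>\<^bsub>RX\<^esub> q \<otimes>\<^bsub>RX\<^esub> s) \<^bold>0 = pc p \<^bold>0 \<otimes> pc r \<^bold>0 \<oplus> pc q \<^bold>0 \<otimes> pc s \<^bold>0"
      using c(3) c'(3) that(3,4) by (simp add: conv_0)
    also have "\<dots> = a \<otimes> (c \<otimes> pc r \<^bold>0 \<oplus> c' \<otimes> pc s \<^bold>0)"
      unfolding c(2) c'(2) using c(1) c'(1) that(3,4) a(1) by (simp add: R.r_distr R.m_assoc)
    finally show ?thesis
      unfolding I_def using c(1,3) c'(1,3) that(3,4) by (auto intro!: bexI[of _ "c \<otimes> pc r \<^bold>0 \<oplus> c' \<otimes> pc s \<^bold>0"])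
  qed
  have I_sub: "I \<subseteq> PS" by (auto simp: I_def)
  have "\<exists>k. e k = e i \<otimes>\<^bsub>RX\<^esub> r \<oplus>\<^bsub>RX\<^esub> e j \<otimes>\<^bsub>RX\<^esub> s" if "r \<in> PS" "s \<in> PS" for i j r s
  proof -
    have "e i \<otimes>\<^bsub>RX\<^esub> r \<oplus>\<^bsub>RX\<^esub> e j \<otimes>\<^bsub>RX\<^esub> s \<in> range e"
      unfolding range by (rule I_comb[OF e_in e_in that])
    then show ?thesis by (auto dest: sym)
  qed
  then have "sigma1_ideal M RX e"
    unfolding sigma1_ideal_def rec_iff_fun1_in[symmetric] carrier_RX range
    using \<open>rec e\<close> I_sub by simp
  then have "\<exists>g\<in>carrier RX. range e = {g \<otimes>\<^bsub>RX\<^esub> r | r. r \<in> carrier RX}"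
    using PID unfolding sigma1_PID_def by simp
  then obtain g where g: "g \<in> PS" "I = {g \<otimes>\<^bsub>RX\<^esub> r | r. r \<in> PS}"
    unfolding range carrier_RX by (elim bexE)
  obtain A where A: "A \<in> PS" "\<And>k. pc A k = (if k = \<^bold>0 then a else \<zero>)"
    using poly_exists[OF pfuns_delta[OF a(1)]] by blast
  obtain X where X: "X \<in> PS" "\<And>k. pc X k = (if k = \<^bold>1 then \<one> else \<zero>)"
    using poly_exists[OF pfuns_delta[OF R.one_closed]] by blast
  have "A \<in> I" using A a unfolding I_def by (auto intro!: bexI[of _ \<one>])
  then obtain r where r: "A = g \<otimes>\<^bsub>RX\<^esub> r" "r \<in> PS" using g(2) by blast
  have "X \<in> I" using X a unfolding I_def by (auto intro!: bexI[of _ \<zero>])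
  then obtain s where s: "X = g \<otimes>\<^bsub>RX\<^esub> s" "s \<in> PS" using g(2) by blast
  have "A \<noteq> \<zero>\<^bsub>RX\<^esub>" using A(2)[of "\<^bold>0"] a by auto
  then have nz: "g \<noteq> \<zero>\<^bsub>RX\<^esub>" "r \<noteq> \<zero>\<^bsub>RX\<^esub>" using r g(1) by auto
  obtain n where n: "pc g n \<noteq> \<zero>" "\<And>k. n \<^bold>< k \<Longrightarrow> pc g k = \<zero>"
    using nonzero_RX_lead[OF g(1) nz(1)] by blast
  obtain m where m: "pc r m \<noteq> \<zero>" "\<And>k. m \<^bold>< k \<Longrightarrow> pc r k = \<zero>"
    using nonzero_RX_lead[OF r(2) nz(2)] by blast
  \<comment> \<open>\<open>A\<close> is constant, while the product of leading coefficients is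
    nonzero at \<open>n + m\<close>; so \<open>n + m = 0\<close>, and \<open>g\<close> is
    constant.\<close>
  have "pc A (n \<^bold>+ m) = pc g n \<otimes> pc r m"
    using conv_lead[of "pc g" n "pc r" m] n(2) m(2) g(1) r by simp
  then have "pc A (n \<^bold>+ m) \<noteq> \<zero>" using R.integral[of "pc g n" "pc r m"] n(1) m(1) g(1) r(2) by auto
  then have "n = \<^bold>0" using A(2) by (auto split: if_splits)
  then have g0: "pc g k = \<zero>" if "k \<noteq> \<^bold>0" for k using n(2) that zero_less by blast
  \<comment> \<open>As \<open>g\<close> is constant, only the summand with \<open>i = 0\<close>
    survives.\<close>
  have "pc X \<^bold>1 = pc g \<^bold>0 \<otimes> pc s (\<^bold>1 \<^bold>- \<^bold>0)"
    unfolding s(1) mult_RX(2)[OF g(1) s(2)] conv_def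
    by (rule rsum_single) (use g(1) s(2) g0 in \<open>simp_all add: zero_less\<close>)
  then have X1: "\<one> = pc g \<^bold>0 \<otimes> pc s \<^bold>1" using X(2) by simp
  \<comment> \<open>The generator is itself in the ideal, as \<open>g\<close> times 1, so its
    constant coefficient is \<open>a c\<close>; the inverse of \<open>a\<close> is then
    \<open>c\<close> times the coefficient of \<open>s\<close> at 1.\<close>
  have "g \<in> I" using g by (auto intro!: exI[of _ "\<one>\<^bsub>RX\<^esub>"] simp del: one_RX(2))
  then obtain c where "c \<in> carrier R" "pc g \<^bold>0 = a \<otimes> c" by (auto simp: I_def)
  with X1 show ?thesis using a s(2) by (intro bexI[of _ "c \<otimes> pc s \<^bold>1"]) (simp_all add: R.m_assoc)
qed

lemma sigma1_PID_imp_field: "sigma1_PID M RX \<Longrightarrow> field R"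
  using sigma1_PID_imp_unit by (intro R.cring_fieldI2) auto

end

theorem theorem6p41:
  fixes M :: "'a l2_structure" and R :: "'a ring"
  assumes "RCA0_model M"
    and "countable_domain M R"
  shows "(field R \<longleftrightarrow> euclidean_dom M (polynomial_ring M R)) \<and>
         (euclidean_dom M (polynomial_ring M R) \<longleftrightarrow> sigma1_PID M (polynomial_ring M R))"
proof -
  interpret rca0_domain M R
    using assms by (simp add: rca0_domain_def rca0_def rca0_domain_axioms_def countable_domain_def)
  show ?thesis
    using field_imp_euclidean euclidean_imp_sigma1_PID sigma1_PID_imp_field by blast
qed

end
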